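(* Let $m\ge0$ and let $V=i\,\widetilde V$, where $\widetilde V=(\widetilde V_{ij})_{i,j=1}^2$ is a $2\times 2$ matrix-valued function on $\mathbb{R}$ with $\widetilde V(x)\ge 0$ (positive semidefinite) and $\widetilde V_{ij}\in L^1(\mathbb{R})$ for $i,j=1,2$. Let $H$ be the Dirac operator with potential $V$ (described in the context). Then $\sigma_{\rm d}(H)$ lies in the open upper half plane. Moreover, if $z\in\rho(H_0)=\mathbb{C}\setminus\big((-\infty,-m]\cup[m,\infty)\big)$ and $$\left(\operatorname{Re}\frac{z+m}{\sqrt{z^2-m^2}}\right)\|\widetilde V_{11}\|_1+\left(\operatorname{Re}\frac{\sqrt{z^2-m^2}}{z+m}\right)\|\widetilde V_{22}\|_1<2,$$ then $z\notin\sigma(H)$. In particular, if $m=0$ and $\|\widetilde V_{11}\|_1+\|\widetilde V_{22}\|_1<2$, then the spectrum of $H$ is $\mathbb{R}$.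
   Context: Units are chosen so that $\hbar=c=1$. The Hilbert space is $\mathcal{H}=L^2(\mathbb{R})\otimes\mathbb{C}^2=L^2(\mathbb{R};\mathbb{C}^2)$. The free Dirac operator is the selfadjoint operator $H_0=-i\frac{d}{dx}\sigma_1+m\sigma_3$ with domain $H^1(\mathbb{R};\mathbb{C}^2)$, where $\sigma_1=\begin{pmatrix}0&1\\1&0\end{pmatrix}$, $\sigma_3=\begin{pmatrix}1&0\\0&-1\end{pmatrix}$; $R_0(z)=(H_0-z)^{-1}$. $V$ is identified with the closed maximal multiplication operator in $\mathcal{H}$. For a scalar function $f$, $\|f\|_1=\int_{\mathbb{R}}|f(x)|\,dx$. Definition of $H$: let $V=U|V|$ be the polar decomposition and $A:=|V|^{1/2}$, $B:=U|V|^{1/2}$, so $V=BA$. For $z\in\rho(H_0)$, $AR_0(z)$ is bounded and $R_0(z)B$, $AR_0(z)B$ have bounded closures; put $Q(z):=\overline{AR_0(z)B}$. Then $H$ is the closed densely defined extension of $H_0+V$ with $\rho(H)\cap\rho(H_0)=\{z\in\rho(H_0): -1\in\rho(Q(z))\}\neq\emptyset$ and, for $z$ in this set, $(H-z)^{-1}=R_0(z)-\overline{R_0(z)B}\,(I+Q(z))^{-1}AR_0(z)$. If $V$ is bounded, $H=H_0+V$ on the domain of $H_0$. The branch of $\sqrt{z^2-m^2}$, $z\in\rho(H_0)$, is chosen such that $\operatorname{Im}\sqrt{z^2-m^2}>0$. For a closed operator $T$, $\sigma_{\rm d}(T)$ is the set of isolated eigenvalues of $T$ of finite multiplicity. *)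

theory Defs
  imports "HOL-Analysis.Analysis"
begin

section \<open>The Hilbert space of square-integrable two-component functions on the line\<close>

text \<open>
  Elements are almost-everywhere classes of Borel functions. Nothing is lost by not using
  Lebesgue measurable representatives, since each of them agrees almost everywhere with a Borel
  function. The norm on \<^typ>\<open>complex^2\<close> is the Euclidean one, and its
  real inner product is the real part of the Hermitian one.
\<close>

definition sq_int :: "(real \<Rightarrow> complex^2) \<Rightarrow> bool" where
  "sq_int f \<longleftrightarrow> f \<in> borel_measurable lborel \<and> integrable lborel (\<lambda>x. (norm (f x))\<^sup>2)"

lemma sq_int_zero: "sq_int (\<lambda>_. 0)"
  by (simp add: sq_int_def)

lemma sq_int_add:
  assumes "sq_int f" "sq_int g"
  shows "sq_int (\<lambda>x. f x + g x)"
proof -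
  have meas[measurable]: "f \<in> borel_measurable lborel" "g \<in> borel_measurable lborel"
    using assms by (auto simp: sq_int_def)
  have "integrable lborel (\<lambda>x. 2 * (norm (f x))\<^sup>2 + 2 * (norm (g x))\<^sup>2)"
    using assms by (auto simp: sq_int_def)
  moreover have "norm ((norm (f x + g x))\<^sup>2) \<le> norm (2 * (norm (f x))\<^sup>2 + 2 * (norm (g x))\<^sup>2)"
    for x
  proof -
    have "(norm (f x + g x))\<^sup>2 \<le> (norm (f x) + norm (g x))\<^sup>2"
      by (intro power_mono norm_triangle_ineq) auto
    also have "\<dots> \<le> 2 * (norm (f x))\<^sup>2 + 2 * (norm (g x))\<^sup>2"
      using sum_squares_ge_zero[of "norm (f x) - norm (g x)" 0]
      by (simp add: power2_eq_square algebra_simps)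
    finally show ?thesis by simp
  qed
  ultimately have "integrable lborel (\<lambda>x. (norm (f x + g x))\<^sup>2)"
    by - (rule Bochner_Integration.integrable_bound[OF _ _ AE_I2], assumption, measurable)
  then show ?thesis by (simp add: sq_int_def)
qed

lemma norm_vector_smult: "norm (c *s v) = cmod c * norm (v :: complex^'n)"
  by (simp add: norm_vec_def L2_set_def norm_mult power_mult_distrib
      sum_distrib_left[symmetric] real_sqrt_mult)

lemma scaleR_eq_vector_smult: "r *\<^sub>R v = complex_of_real r *s (v :: complex^'n)"
  by (simp add: vec_eq_iff) (simp add: scaleR_conv_of_real)

lemma sq_int_smult:
  assumes "sq_int f"
  shows "sq_int (\<lambda>x. c *s f x)"
proof -
  have "continuous_on UNIV (\<lambda>v :: complex^2. c *s v)"
    unfolding vector_scalar_mult_def by (intro continuous_intros)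
  then have [measurable]: "(\<lambda>v :: complex^2. c *s v) \<in> borel_measurable borel"
    by (rule borel_measurable_continuous_onI)
  have "f \<in> borel_measurable lborel" using assms by (simp add: sq_int_def)
  then have "(\<lambda>x. c *s f x) \<in> borel_measurable lborel" by measurable
  moreover have "integrable lborel (\<lambda>x. (norm (c *s f x))\<^sup>2)"
    using assms by (simp add: sq_int_def norm_vector_smult power_mult_distrib)
  ultimately show ?thesis by (simp add: sq_int_def)
qed

lemma sq_int_uminus: "sq_int f \<Longrightarrow> sq_int (\<lambda>x. - f x)"
  by (simp add: sq_int_def)

lemma sq_int_diff: "sq_int f \<Longrightarrow> sq_int g \<Longrightarrow> sq_int (\<lambda>x. f x - g x)"
  using sq_int_add[of f "\<lambda>x. - g x"] sq_int_uminus[of g] by simp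

lemma sq_int_scaleR: "sq_int f \<Longrightarrow> sq_int (\<lambda>x. r *\<^sub>R f x)"
  by (simp add: sq_int_smult scaleR_eq_vector_smult)

lemma sq_int_integrable_inner:
  assumes "sq_int f" "sq_int g"
  shows "integrable lborel (\<lambda>x. f x \<bullet> g x)"
proof -
  have meas[measurable]: "f \<in> borel_measurable lborel" "g \<in> borel_measurable lborel"
    using assms by (auto simp: sq_int_def)
  have "integrable lborel (\<lambda>x. (norm (f x))\<^sup>2 + (norm (g x))\<^sup>2)"
    using assms by (auto simp: sq_int_def)
  moreover have "norm (f x \<bullet> g x) \<le> norm ((norm (f x))\<^sup>2 + (norm (g x))\<^sup>2)" for x
  proof -
    have "\<bar>f x \<bullet> g x\<bar> \<le> norm (f x) * norm (g x)" by (rule Cauchy_Schwarz_ineq2)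
    also have "\<dots> \<le> (norm (f x))\<^sup>2 + (norm (g x))\<^sup>2"
      using sum_squares_bound[of "norm (f x)" "norm (g x)"]
        mult_nonneg_nonneg[OF norm_ge_zero[of "f x"] norm_ge_zero[of "g x"]] by linarith
    finally show ?thesis by simp
  qed
  ultimately show ?thesis
    by - (rule Bochner_Integration.integrable_bound[OF _ _ AE_I2], assumption, measurable)
qed

quotient_type l2 = "real \<Rightarrow> complex^2" /
  partial: "\<lambda>f g. sq_int f \<and> sq_int g \<and> (AE x in lborel. f x = g x)"
proof (rule part_equivpI)
  show "\<exists>f. sq_int f \<and> sq_int f \<and> (AE x in lborel. f x = f x)"
    using sq_int_zero by auto
  show "symp (\<lambda>f g. sq_int f \<and> sq_int g \<and> (AE x in lborel. f x = g x))"
    by (rule sympI) auto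
  show "transp (\<lambda>f g. sq_int f \<and> sq_int g \<and> (AE x in lborel. f x = g x))"
    by (rule transpI) auto
qed

lift_definition scaleC_l2 :: "complex \<Rightarrow> l2 \<Rightarrow> l2"  (infixr \<open>*\<^sub>C\<close> 75)
  is "\<lambda>c f x. c *s f x"
  by (auto simp: sq_int_smult)

instantiation l2 :: real_inner
begin

lift_definition zero_l2 :: l2 is "\<lambda>_. 0"
  by (simp add: sq_int_zero)

lift_definition plus_l2 :: "l2 \<Rightarrow> l2 \<Rightarrow> l2" is "\<lambda>f g x. f x + g x"
  by (auto simp: sq_int_add)

lift_definition minus_l2 :: "l2 \<Rightarrow> l2 \<Rightarrow> l2" is "\<lambda>f g x. f x - g x"
  by (auto simp: sq_int_diff)

lift_definition uminus_l2 :: "l2 \<Rightarrow> l2" is "\<lambda>f x. - f x"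
  by (auto simp: sq_int_uminus)

lift_definition scaleR_l2 :: "real \<Rightarrow> l2 \<Rightarrow> l2" is "\<lambda>r f x. r *\<^sub>R f x"
  by (auto simp: sq_int_scaleR)

lift_definition inner_l2 :: "l2 \<Rightarrow> l2 \<Rightarrow> real" is "\<lambda>f g. LINT x|lborel. f x \<bullet> g x"
  by (rule integral_cong_AE)
    (auto simp: sq_int_def intro!: borel_measurable_inner)

definition norm_l2 :: "l2 \<Rightarrow> real" where
  "norm_l2 f = sqrt (inner f f)"

definition sgn_l2 :: "l2 \<Rightarrow> l2" where
  "sgn_l2 f = inverse (norm f) *\<^sub>R f"

definition dist_l2 :: "l2 \<Rightarrow> l2 \<Rightarrow> real" where
  "dist_l2 f g = norm (f - g)"

definition uniformity_l2 :: "(l2 \<times> l2) filter" where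
  "uniformity_l2 = (INF e\<in>{0<..}. principal {(f, g). dist f g < e})"

definition open_l2 :: "l2 set \<Rightarrow> bool" where
  "open_l2 S \<longleftrightarrow> (\<forall>f\<in>S. \<forall>\<^sub>F (f', g) in uniformity. f' = f \<longrightarrow> g \<in> S)"

instance
proof
  fix f g h :: l2 and r s :: real and S :: "l2 set"
  show "f + g + h = f + (g + h)" by transfer (auto simp: sq_int_add add.assoc)
  show "f + g = g + f" by transfer (auto simp: sq_int_add add.commute)
  show "0 + f = f" by transfer (auto simp: sq_int_add)
  show "- f + f = 0" by transfer (auto simp: sq_int_zero)
  show "f - g = f + - g" by transfer (auto simp: sq_int_add sq_int_diff sq_int_uminus)
  show "r *\<^sub>R (f + g) = r *\<^sub>R f + r *\<^sub>R g"
    by transfer (auto simp: sq_int_add sq_int_scaleR scaleR_right_distrib simp del: vector_add_component)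
  show "(r + s) *\<^sub>R f = r *\<^sub>R f + s *\<^sub>R f"
    by transfer (auto simp: sq_int_add sq_int_scaleR scaleR_left_distrib)
  show "r *\<^sub>R s *\<^sub>R f = (r * s) *\<^sub>R f" by transfer (auto simp: sq_int_scaleR)
  show "1 *\<^sub>R f = f" by transfer auto
  show "sgn f = inverse (norm f) *\<^sub>R f" by (rule sgn_l2_def)
  show "dist f g = norm (f - g)" by (rule dist_l2_def)
  show "(uniformity :: (l2 \<times> l2) filter) =
      (INF e\<in>{0<..}. principal {(f, g). dist f g < e})"
    by (rule uniformity_l2_def)
  show "open S \<longleftrightarrow> (\<forall>f\<in>S. \<forall>\<^sub>F (f', g) in uniformity. f' = f \<longrightarrow> g \<in> S)"
    by (rule open_l2_def)
  show "inner f g = inner g f" by transfer (simp add: inner_commute)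
  show "inner (f + g) h = inner f h + inner g h"
    by transfer (simp add: inner_add_left sq_int_integrable_inner)
  show "inner (r *\<^sub>R f) g = r * inner f g" by transfer simp
  show "0 \<le> inner f f" by transfer simp
  show "inner f f = 0 \<longleftrightarrow> f = 0"
  proof transfer
    fix f :: "real \<Rightarrow> complex^2"
    assume "sq_int f \<and> sq_int f \<and> (AE x in lborel. f x = f x)"
    then have "sq_int f" by simp
    then show "(LINT x|lborel. f x \<bullet> f x) = 0 \<longleftrightarrow>
        sq_int f \<and> sq_int (\<lambda>_. 0) \<and> (AE x in lborel. f x = 0)"
      using integral_nonneg_eq_0_iff_AE[OF sq_int_integrable_inner[of f f]]
      by (simp add: sq_int_zero)
  qed
  show "norm f = sqrt (inner f f)" by (rule norm_l2_def)
qed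

end


section \<open>Unbounded operators and their spectra\<close>

text \<open>
  An operator is represented by its graph. Thus the product \<open>S T\<close> is the relation \<open>T O S\<close>, the
  inverse is the converse relation, extension is inclusion, and the closure of an operator is the
  topological closure of its graph.
\<close>

type_synonym l2_rel = "(l2 \<times> l2) set"

definition linear_op :: "l2_rel \<Rightarrow> bool" where
  "linear_op T \<longleftrightarrow> subspace T \<and> (\<forall>c f g. (f, g) \<in> T \<longrightarrow> (c *\<^sub>C f, c *\<^sub>C g) \<in> T) \<and> single_valued T"

definition bounded_op :: "l2_rel \<Rightarrow> bool" where
  "bounded_op T \<longleftrightarrow>
    (\<exists>F. bounded_linear F \<and> (\<forall>c f. F (c *\<^sub>C f) = c *\<^sub>C F f) \<and> T = {(f, F f) |f. True})"

definition op_add :: "l2_rel \<Rightarrow> l2_rel \<Rightarrow> l2_rel" where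
  "op_add S T = {(f, g + h) |f g h. (f, g) \<in> S \<and> (f, h) \<in> T}"

definition op_diff :: "l2_rel \<Rightarrow> l2_rel \<Rightarrow> l2_rel" where
  "op_diff S T = {(f, g - h) |f g h. (f, g) \<in> S \<and> (f, h) \<in> T}"

definition op_shift :: "l2_rel \<Rightarrow> complex \<Rightarrow> l2_rel" where
  "op_shift T z = {(f, g - z *\<^sub>C f) |f g. (f, g) \<in> T}"

definition resolvent :: "l2_rel \<Rightarrow> complex \<Rightarrow> l2_rel" where
  "resolvent T z = (op_shift T z)\<inverse>"

definition resolvent_set :: "l2_rel \<Rightarrow> complex set" where
  "resolvent_set T = {z. bounded_op (resolvent T z)}"

definition spectrum :: "l2_rel \<Rightarrow> complex set" where
  "spectrum T = - resolvent_set T"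

definition eigenspace :: "l2_rel \<Rightarrow> complex \<Rightarrow> l2 set" where
  "eigenspace T z = {f. (f, z *\<^sub>C f) \<in> T}"

text \<open>
  Finite multiplicity means that the eigenspace has finite dimension; here \<open>span\<close> is the real
  span, but a complex subspace has finite complex dimension iff it has finite real dimension.
  Since this is the geometric multiplicity, the set below contains the one obtained by requiring
  finite algebraic multiplicity.
\<close>

definition discrete_spectrum :: "l2_rel \<Rightarrow> complex set" where
  "discrete_spectrum T =
    {z. z isolated_in spectrum T \<and> eigenspace T z \<noteq> {0} \<and>
        (\<exists>B. finite B \<and> eigenspace T z \<subseteq> span B)}"


section \<open>Matrices\<close>

definition cadjoint :: "complex^2^2 \<Rightarrow> complex^2^2" where
  "cadjoint M = (\<chi> i j. cnj (M $ j $ i))"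

definition psd :: "complex^2^2 \<Rightarrow> bool" where
  "psd M \<longleftrightarrow> cadjoint M = M \<and> (\<forall>v. 0 \<le> Re (\<Sum>i\<in>UNIV. (M *v v) $ i * cnj (v $ i)))"

definition psd_sqrt :: "complex^2^2 \<Rightarrow> complex^2^2" where
  "psd_sqrt M = (THE P. psd P \<and> P ** P = M)"

definition mat_abs :: "complex^2^2 \<Rightarrow> complex^2^2" where
  "mat_abs M = psd_sqrt (cadjoint M ** M)"

text \<open>The partial isometry \<open>U\<close> in the polar decomposition, with the same kernel as \<open>M\<close>.\<close>

definition polar_part :: "complex^2^2 \<Rightarrow> complex^2^2" where
  "polar_part M = (THE U. M = U ** mat_abs M \<and> U ** cadjoint U ** U = U \<and>
    (\<forall>v. U *v v = 0 \<longleftrightarrow> M *v v = 0))"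

definition sigma1 :: "complex^2^2" where
  "sigma1 = vector [vector [0, 1], vector [1, 0]]"

definition sigma3 :: "complex^2^2" where
  "sigma3 = vector [vector [1, 0], vector [0, -1]]"


section \<open>Dirac operators\<close>

text \<open>Maximal multiplication operator; its domain is \<open>{f. M f is square integrable}\<close>.\<close>

definition mult_op :: "(real \<Rightarrow> complex^2^2) \<Rightarrow> l2_rel" where
  "mult_op M = {(f, g). AE x in lborel. rep_l2 g x = M x *v rep_l2 f x}"

text \<open>
  The derivative with domain \<open>H\<^sup>1\<close>: \<open>f\<close> has an absolutely continuous representative \<open>F\<close> with
  square-integrable derivative \<open>f'\<close>, that is, \<open>F\<close> is an indefinite integral of \<open>f'\<close>.
\<close>

definition deriv_op :: l2_rel where
  "deriv_op = {(f, f'). \<exists>F. (AE x in lborel. rep_l2 f x = F x) \<and>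
    (\<forall>a b. a \<le> b \<longrightarrow> (rep_l2 f' has_integral (F b - F a)) {a..b})}"

definition free_dirac :: "real \<Rightarrow> l2_rel" where
  "free_dirac m = {(f, g). \<exists>f'. (f, f') \<in> deriv_op \<and>
    (AE x in lborel. rep_l2 g x =
      (- \<i>) *s (sigma1 *v rep_l2 f' x) + complex_of_real m *s (sigma3 *v rep_l2 f x))}"

definition op_A :: "(real \<Rightarrow> complex^2^2) \<Rightarrow> l2_rel" where
  "op_A V = mult_op (\<lambda>x. psd_sqrt (mat_abs (V x)))"

definition op_B :: "(real \<Rightarrow> complex^2^2) \<Rightarrow> l2_rel" where
  "op_B V = mult_op (\<lambda>x. polar_part (V x) ** psd_sqrt (mat_abs (V x)))"

text \<open>The closures of \<open>R\<^sub>0(z) B\<close> and \<open>A R\<^sub>0(z) B\<close>, where \<open>R\<^sub>0(z)\<close> is the free resolvent.\<close>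

definition op_R0B :: "real \<Rightarrow> (real \<Rightarrow> complex^2^2) \<Rightarrow> complex \<Rightarrow> l2_rel" where
  "op_R0B m V z = closure (op_B V O resolvent (free_dirac m) z)"

definition op_Q :: "real \<Rightarrow> (real \<Rightarrow> complex^2^2) \<Rightarrow> complex \<Rightarrow> l2_rel" where
  "op_Q m V z = closure (op_B V O resolvent (free_dirac m) z O op_A V)"

text \<open>
  For an integrable potential \<open>V\<close>, \<open>H\<close> is defined through its resolvent, because
  \<open>H\<^sub>0 + V\<close> itself may have a very small domain. A single value of the resolvent determines an
  operator, so at most one \<open>H\<close> has this property. In the last line, \<open>(I + Q(z))\<inverse>\<close> is
  \<^term>\<open>resolvent (op_Q m V z) (-1)\<close>.
\<close>

definition dirac_operator :: "real \<Rightarrow> (real \<Rightarrow> complex^2^2) \<Rightarrow> l2_rel \<Rightarrow> bool" where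
  "dirac_operator m V H \<longleftrightarrow>
    linear_op H \<and> closed H \<and> closure (Domain H) = UNIV \<and>
    op_add (free_dirac m) (mult_op V) \<subseteq> H \<and>
    resolvent_set H \<inter> resolvent_set (free_dirac m) =
      {z \<in> resolvent_set (free_dirac m). -1 \<in> resolvent_set (op_Q m V z)} \<and>
    resolvent_set H \<inter> resolvent_set (free_dirac m) \<noteq> {} \<and>
    (\<forall>z \<in> resolvent_set H \<inter> resolvent_set (free_dirac m).
      resolvent H z =
        op_diff (resolvent (free_dirac m) z)
          ((resolvent (free_dirac m) z O op_A V) O resolvent (op_Q m V z) (-1) O op_R0B m V z))"

text \<open>The branch of the square root of \<open>z\<^sup>2 - m\<^sup>2\<close> in the upper half plane.\<close>

definition dirac_sqrt :: "real \<Rightarrow> complex \<Rightarrow> complex" where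
  "dirac_sqrt m z = (THE w. w\<^sup>2 = z\<^sup>2 - (complex_of_real m)\<^sup>2 \<and> Im w > 0)"

definition L1_norm :: "(real \<Rightarrow> complex) \<Rightarrow> real" where
  "L1_norm f = (LINT x|lebesgue. cmod (f x))"

end

theory Submission
  imports Defs
begin

text \<open>
  Since \<open>V = \<i> Vt\<close> with \<open>Vt \<ge> 0\<close>, the factorization is \<open>A = \<surd>Vt\<close>, \<open>B = \<i> A\<close>, and
  \<open>Q = \<i> A R\<^sub>0 A\<close>. The resolvent identity gives
  \<open>Re \<langle>f, Q f\<rangle> = - Im z \<parallel>R\<^sub>0 A f\<parallel>\<^sup>2\<close>. This is nonnegative for \<open>Im z \<le> 0\<close>.
  For \<open>Im z > 0\<close> the Hilbert--Schmidt norm of \<open>R\<^sub>0 A\<close>, computed from the explicit Green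
  matrix, bounds it from below by \<open>- t \<parallel>f\<parallel>\<^sup>2\<close>, where \<open>2 t\<close> is the left-hand side of the
  criterion. Hence \<open>I + Q\<close> is bounded and coercive, and therefore boundedly invertible.
  Conversely, the spectrum of \<open>H\<^sub>0\<close> is contained in that of \<open>H\<close>: a Weyl sequence of
  \<open>H\<^sub>0\<close>, translated to infinity, is one for \<open>H\<close>. As the spectrum of \<open>H\<^sub>0\<close> has no
  isolated points, it contains no discrete spectrum of \<open>H\<close>.
\<close>

section \<open>The Hilbert space\<close>

text \<open>The obstacle is that \<open>H\<close> is given only through its resolvent and
  \<open>Q\<close> only as the closure of a composite of relations, so nothing can be computed in
  the domain of \<open>H\<close>. Invertibility of \<open>H - z\<close> is read off from
  \<open>Q\<close>. A Weyl sequence for \<open>H\<close> is obtained by applying the resolvent of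
  \<open>H\<close> at \<open>z\<close> to \<open>(H\<^sub>0 - z) u\<close>; this changes
  \<open>u\<close> only by a term controlled by the norm of \<open>A u\<close>. The constant of the
  criterion comes from an identity. With \<zeta> = (z + m) / k, where k is the chosen root, both k
  \<zeta> = z + m and k / \<zeta> = z - m have imaginary part Im z, because m is real; hence Im z
  (|\<zeta>|^2 + 1) = 2 Im k Re \<zeta>. It turns Im z times the squared Hilbert--Schmidt norm of
  \<open>R\<^sub>0 A\<close>, which is the trace of \<open>A (Im R\<^sub>0) A\<close>, into exactly
  half the left-hand side of the criterion. The off-diagonal entries of \<open>Vt\<close> drop out
  of this trace because they enter it with the sign of x - y.\<close>

lemma sq_int_rep: "sq_int (rep_l2 f)"
  using Quotient3_rep_reflp[OF Quotient3_l2] by blast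

lemma rep_abs_l2: "sq_int f \<Longrightarrow> AE x in lborel. rep_l2 (abs_l2 f) x = f x"
  using Quotient3_rep_abs[OF Quotient3_l2, of f] by simp

lemma l2_eqI: "AE x in lborel. rep_l2 f x = rep_l2 g x \<Longrightarrow> f = g"
  using Quotient3_rel_rep[OF Quotient3_l2, of f g] sq_int_rep by blast

lemma rep_plus: "AE x in lborel. rep_l2 (f + g) x = rep_l2 f x + rep_l2 g x"
  unfolding plus_l2_def map_fun_def comp_def id_def
  by (rule rep_abs_l2) (simp add: sq_int_add sq_int_rep)

lemma rep_minus: "AE x in lborel. rep_l2 (f - g) x = rep_l2 f x - rep_l2 g x"
  unfolding minus_l2_def map_fun_def comp_def id_def
  by (rule rep_abs_l2) (simp add: sq_int_diff sq_int_rep)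

lemma rep_scaleR: "AE x in lborel. rep_l2 (r *\<^sub>R f) x = r *\<^sub>R rep_l2 f x"
  unfolding scaleR_l2_def map_fun_def comp_def id_def
  by (rule rep_abs_l2) (simp add: sq_int_scaleR sq_int_rep)

lemma rep_scaleC: "AE x in lborel. rep_l2 (c *\<^sub>C f) x = c *s rep_l2 f x"
  unfolding scaleC_l2_def map_fun_def comp_def id_def
  by (rule rep_abs_l2) (simp add: sq_int_smult sq_int_rep)

lemma rep_zero: "AE x in lborel. rep_l2 0 x = 0"
  unfolding zero_l2_def by (rule rep_abs_l2) (rule sq_int_zero)

lemma inner_l2_integral: "inner f g = (LINT x|lborel. rep_l2 f x \<bullet> rep_l2 g x)"
  by (simp add: inner_l2_def)

lemma norm_l2_integral: "(norm f)\<^sup>2 = (LINT x|lborel. (norm (rep_l2 f x))\<^sup>2)"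
  by (simp add: power2_norm_eq_inner inner_l2_integral)

lemma rep_meas [measurable]: "rep_l2 f \<in> borel_measurable borel"
  using sq_int_rep[of f] by (simp add: sq_int_def)

lemma rep_integrable: "integrable lborel (\<lambda>x. (norm (rep_l2 f x))\<^sup>2)"
  using sq_int_rep[of f] by (simp add: sq_int_def)

lemma norm_l2_nn_integral:
  "ennreal ((norm f)\<^sup>2) = (\<integral>\<^sup>+x. ennreal ((norm (rep_l2 f x))\<^sup>2) \<partial>lborel)"
  unfolding norm_l2_integral by (rule nn_integral_eq_integral[symmetric]) (auto intro: rep_integrable)

lemma scaleC_add_right: "c *\<^sub>C (f + g) = c *\<^sub>C f + c *\<^sub>C g"
  by (rule l2_eqI, use rep_scaleC[of c "f + g"] rep_plus[of f g] rep_plus[of "c *\<^sub>C f" "c *\<^sub>C g"]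
      rep_scaleC[of c f] rep_scaleC[of c g] in eventually_elim) (simp add: vec_eq_iff ring_distribs)

lemma scaleC_scaleC: "c *\<^sub>C d *\<^sub>C f = (c * d) *\<^sub>C f"
  by (rule l2_eqI, use rep_scaleC[of c "d *\<^sub>C f"] rep_scaleC[of d f] rep_scaleC[of "c * d" f]
      in eventually_elim) (simp add: vec_eq_iff)

lemma scaleC_of_real: "complex_of_real r *\<^sub>C f = r *\<^sub>R f"
  by (rule l2_eqI, use rep_scaleC[of "complex_of_real r" f] rep_scaleR[of r f]
      in eventually_elim) (simp add: scaleR_eq_vector_smult)

lemma scaleC_add_left: "(c + d) *\<^sub>C f = c *\<^sub>C f + d *\<^sub>C f"
  by (rule l2_eqI, use rep_plus[of "c *\<^sub>C f" "d *\<^sub>C f"] rep_scaleC[of c f] rep_scaleC[of d f]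
      rep_scaleC[of "c + d" f] in eventually_elim) (simp add: vec_eq_iff ring_distribs)

lemma scaleC_minus_one: "(-1) *\<^sub>C f = - f"
  using scaleC_of_real[of "-1" f] by simp

lemma scaleC_scaleR: "c *\<^sub>C (r *\<^sub>R f) = r *\<^sub>R (c *\<^sub>C f)"
  by (simp flip: scaleC_of_real add: scaleC_scaleC mult.commute)

lemma scaleC_diff_right: "c *\<^sub>C (f - g) = c *\<^sub>C f - c *\<^sub>C g"
proof -
  have "c *\<^sub>C (f - g) + c *\<^sub>C g = c *\<^sub>C f" by (simp flip: scaleC_add_right)
  then show ?thesis by (simp add: algebra_simps)
qed

lemma scaleC_diff_left: "(c - d) *\<^sub>C f = c *\<^sub>C f - d *\<^sub>C f"
proof -
  have "(c - d) *\<^sub>C f + d *\<^sub>C f = c *\<^sub>C f" by (simp flip: scaleC_add_left)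
  then show ?thesis by (simp add: algebra_simps)
qed

lemma norm_scaleC: "norm (c *\<^sub>C f) = cmod c * norm f"
proof -
  have "(norm (c *\<^sub>C f))\<^sup>2 = (LINT x|lborel. (norm (c *s rep_l2 f x))\<^sup>2)"
    unfolding norm_l2_integral
    by (rule integral_cong_AE, measurable)
      (use sq_int_smult[OF sq_int_rep[of f], of c] in \<open>simp add: sq_int_def\<close>,
       use rep_scaleC[of c f] in eventually_elim, simp)
  also have "\<dots> = (cmod c * norm f)\<^sup>2"
    by (simp add: norm_vector_smult power_mult_distrib norm_l2_integral)
  finally show ?thesis by (simp add: power2_eq_iff_nonneg)
qed

lemma bounded_linear_scaleC: "bounded_linear (\<lambda>f. c *\<^sub>C f)"
  by (rule bounded_linear_intro[where K = "cmod c"])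
    (auto simp: scaleC_add_right scaleC_scaleR norm_scaleC)

section \<open>Cauchy--Schwarz for scalar functions and completeness of \<open>l2\<close>\<close>

lemma real_Cauchy_Schwarz_integral:
  fixes a b :: "real \<Rightarrow> real"
  assumes [measurable]: "a \<in> borel_measurable borel" "b \<in> borel_measurable borel"
    and a: "integrable lborel (\<lambda>x. (a x)\<^sup>2)" and b: "integrable lborel (\<lambda>x. (b x)\<^sup>2)"
  shows "integrable lborel (\<lambda>x. a x * b x)"
    "(LINT x|lborel. a x * b x)\<^sup>2 \<le> (LINT x|lborel. (a x)\<^sup>2) * (LINT x|lborel. (b x)\<^sup>2)"
proof -
  \<comment> \<open>Multiplication by a fixed unit vector embeds real square-integrable functions
    isometrically into \<open>l2\<close>, where the abstract Cauchy--Schwarz inequality is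
    available.\<close>
  define e :: "complex^2" where "e = axis 1 1"
  have e: "e \<bullet> e = 1" "norm e = 1" by (simp_all add: e_def inner_axis_axis)
  have sa: "sq_int (\<lambda>x. a x *\<^sub>R e)" and sb: "sq_int (\<lambda>x. b x *\<^sub>R e)"
    using a b by (auto simp: sq_int_def e)
  show "integrable lborel (\<lambda>x. a x * b x)"
    using sq_int_integrable_inner[OF sa sb] by (simp add: e mult.commute)
  have I: "inner (abs_l2 f) (abs_l2 g) = (LINT x|lborel. f x \<bullet> g x)"
    if s: "sq_int f" "sq_int g" for f g
    unfolding inner_l2_integral
  proof (rule integral_cong_AE)
    show "(\<lambda>x. f x \<bullet> g x) \<in> borel_measurable lborel"
      using s by (auto simp: sq_int_def)
    show "AE x in lborel. rep_l2 (abs_l2 f) x \<bullet> rep_l2 (abs_l2 g) x = f x \<bullet> g x"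
      using rep_abs_l2[OF s(1)] rep_abs_l2[OF s(2)] by eventually_elim simp
  qed measurable
  show "(LINT x|lborel. a x * b x)\<^sup>2 \<le> (LINT x|lborel. (a x)\<^sup>2) * (LINT x|lborel. (b x)\<^sup>2)"
    using Cauchy_Schwarz_ineq[of "abs_l2 (\<lambda>x. a x *\<^sub>R e)" "abs_l2 (\<lambda>x. b x *\<^sub>R e)"]
    by (simp add: I sa sb e power2_eq_square mult.commute)
qed

lemma nn_integral_exp_minus_Ici:
  assumes "0 < c"
  shows "(\<integral>\<^sup>+x. indicator {0..} x * ennreal (exp (- (c * x))) \<partial>lborel) = ennreal (1 / c)"
proof -
  have "((\<lambda>x. exp (- c * x)) has_integral exp (- c * 0) / c) {0..}"
    by (rule has_integral_exp_minus_to_infinity) fact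
  from nn_integral_has_integral_lebesgue[OF _ this] show ?thesis
    by (simp add: ennreal_mult' ennreal_indicator)
qed

lemma integrable_exp_minus_abs:
  fixes c :: real
  assumes "0 < c"
  shows "integrable lborel (\<lambda>x. exp (- (c * \<bar>x\<bar>)))"
proof -
  have 1: "integrable lborel (\<lambda>x. indicator {0..} x * exp (- (c * x)) :: real)"
  proof (rule integrableI_bounded)
    have "(\<integral>\<^sup>+x. ennreal (norm (indicator {0..} x * exp (- (c * x)))) \<partial>lborel) =
        (\<integral>\<^sup>+x. indicator {0..} x * ennreal (exp (- (c * x))) \<partial>lborel)"
      by (rule nn_integral_cong) (auto simp: indicator_def)
    then show "(\<integral>\<^sup>+x. ennreal (norm (indicator {0..} x * exp (- (c * x)))) \<partial>lborel) < \<infinity>"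
      using nn_integral_exp_minus_Ici[OF assms] by simp
  qed simp
  from lborel_integrable_real_affine[OF 1, of "-1" 0]
  have 2: "integrable lborel (\<lambda>x. indicator {0..} (-x) * exp (c * x) :: real)" by simp
  show ?thesis
    by (rule Bochner_Integration.integrable_bound[OF Bochner_Integration.integrable_add[OF 1 2]])
      (auto simp: indicator_def)
qed

text \<open>Riesz--Fischer: a rapidly converging subsequence converges almost everywhere, and
  Fatou's lemma identifies the pointwise limit as the limit in norm. Completeness is needed to
  extend bounded operators from dense domains and for the fixed-point argument that inverts I +
  Q.\<close>

lemma complete_l2: "complete (UNIV :: l2 set)"
proof (rule completeI)
  fix X :: "nat \<Rightarrow> l2"
  assume "Cauchy X"
  then obtain r where r: "strict_mono r" "\<And>n. \<forall>i\<ge>r n. \<forall>j\<ge>r n. dist (X i) (X j) < (1/2)^n"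
  proof -
    have "\<exists>N. \<forall>i\<ge>N. \<forall>j\<ge>N. dist (X i) (X j) < (1/2)^n" for n
      using metric_CauchyD[OF \<open>Cauchy X\<close>, of "(1/2)^n"] by auto
    then obtain N where N: "\<And>n. \<forall>i\<ge>N n. \<forall>j\<ge>N n. dist (X i) (X j) < (1/2)^n" by metis
    define r where "r n = (\<Sum>k\<le>n. N k) + n" for n
    have "strict_mono r" by (auto simp: strict_mono_Suc_iff r_def)
    moreover have "N n \<le> r n" for n
      using member_le_sum[of n "{..n}" N] by (auto simp: r_def)
    moreover have "\<forall>i\<ge>r n. \<forall>j\<ge>r n. dist (X i) (X j) < (1/2)^n" for n
      using N[of n] \<open>N n \<le> r n\<close> by (meson order_trans)
    ultimately show ?thesis by (intro that) auto
  qed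
  define Y where "Y n = rep_l2 (X (r n))" for n
  have [measurable]: "Y n \<in> borel_measurable borel" for n unfolding Y_def by measurable
  define d where "d n x = norm (Y (Suc n) x - Y n x)" for n x
  have [measurable]: "d n \<in> borel_measurable borel" for n unfolding d_def[abs_def] by measurable
  \<comment> \<open>On a space of infinite measure, \<open>L\<^sup>2\<close> bounds on the
    increments do not bound their integrals. Pairing with a strictly positive square-integrable
    weight does, and dividing by \<open>w x\<close> afterwards recovers pointwise
    summability.\<close>
  define w :: "real \<Rightarrow> real" where "w x = exp (- \<bar>x\<bar>)" for x
  have [measurable]: "w \<in> borel_measurable borel" by (simp add: w_def[abs_def])
  define W where "W = (LINT x|lborel. (w x)\<^sup>2)"
  have w: "integrable lborel (\<lambda>x. (w x)\<^sup>2)"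
    using integrable_exp_minus_abs[of 2] by (simp add: w_def power2_eq_square flip: exp_add)
  have dY: "integrable lborel (\<lambda>x. (norm (Y m x - Y n x))\<^sup>2)"
    "(LINT x|lborel. (norm (Y m x - Y n x))\<^sup>2) = (dist (X (r m)) (X (r n)))\<^sup>2" for m n
  proof -
    show "integrable lborel (\<lambda>x. (norm (Y m x - Y n x))\<^sup>2)"
      using sq_int_diff[OF sq_int_rep[of "X (r m)"] sq_int_rep[of "X (r n)"]]
      by (simp add: Y_def sq_int_def)
    show "(LINT x|lborel. (norm (Y m x - Y n x))\<^sup>2) = (dist (X (r m)) (X (r n)))\<^sup>2"
      unfolding dist_norm norm_l2_integral Y_def
      by (rule integral_cong_AE, measurable)
        (use rep_minus[of "X (r m)" "X (r n)"] in eventually_elim, simp)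
  qed
  have small: "dist (X (r m)) (X (r n)) \<le> (1/2)^n" if "n \<le> m" for m n
    using r(2)[of n] strict_mono_less_eq[OF r(1), of n m] that by (auto intro: less_imp_le)
  have dw: "integrable lborel (\<lambda>x. d n x * w x)"
    "(LINT x|lborel. d n x * w x) \<le> (1/2)^n * sqrt W" for n
  proof -
    note cs = real_Cauchy_Schwarz_integral[of "d n" w, unfolded d_def, OF _ _ dY(1) w]
    show "integrable lborel (\<lambda>x. d n x * w x)"
      unfolding d_def by (rule cs(1)) measurable
    have "(LINT x|lborel. d n x * w x)\<^sup>2 \<le> (dist (X (r (Suc n))) (X (r n)))\<^sup>2 * W"
      unfolding d_def W_def dY(2)[symmetric] by (rule cs(2)) measurable
    also have "\<dots> \<le> ((1/2)^n)\<^sup>2 * W"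
      by (intro mult_right_mono power_mono small) (auto simp: W_def)
    also have "\<dots> = ((1/2)^n * sqrt W)\<^sup>2"
      by (simp add: power_mult_distrib W_def)
    finally show "(LINT x|lborel. d n x * w x) \<le> (1/2)^n * sqrt W"
      by (rule power2_le_imp_le) (auto simp: W_def)
  qed
  have dw0: "0 \<le> d n x * w x" for n x by (simp add: d_def w_def)
  have "(\<integral>\<^sup>+x. (\<Sum>n. ennreal (d n x * w x)) \<partial>lborel) = (\<Sum>n. \<integral>\<^sup>+x. ennreal (d n x * w x) \<partial>lborel)"
    by (rule nn_integral_suminf) measurable
  also have "\<dots> = (\<Sum>n. ennreal (LINT x|lborel. d n x * w x))"
    by (intro suminf_cong nn_integral_eq_integral dw) (simp add: dw0)
  also have "\<dots> \<le> (\<Sum>n. ennreal ((1/2)^n * sqrt W))"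
    by (intro suminf_le ennreal_leI dw) auto
  also have "\<dots> = ennreal (\<Sum>n. (1/2)^n * sqrt W)"
    by (rule suminf_ennreal2) (auto simp: W_def intro!: summable_mult2 summable_geometric)
  also have "\<dots> < \<infinity>" by simp
  finally have "AE x in lborel. (\<Sum>n. ennreal (d n x * w x)) \<noteq> \<infinity>"
    by (intro nn_integral_PInf_AE) auto
  then have conv: "AE x in lborel. convergent (\<lambda>n. Y n x)"
  proof eventually_elim
    case (elim x)
    then have "summable (\<lambda>n. d n x * w x)"
      by (intro summable_suminf_not_top) (auto simp: dw0)
    then have "summable (\<lambda>n. d n x * w x * (1 / w x))" by (rule summable_mult2)
    then have "summable (\<lambda>n. norm (Y (Suc n) x - Y n x))" by (simp add: w_def d_def)
    then have "summable (\<lambda>n. Y (Suc n) x - Y n x)" by (rule summable_norm_cancel)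
    then have "convergent (\<lambda>n. (\<Sum>k<n. Y (Suc k) x - Y k x) + Y 0 x)"
      by (auto simp: summable_iff_convergent intro: convergent_add convergent_const)
    moreover have "(\<Sum>k<n. Y (Suc k) x - Y k x) + Y 0 x = Y n x" for n
      by (simp add: sum_lessThan_telescope[of "\<lambda>k. Y k x"])
    ultimately show ?case by simp
  qed
  define y where "y x = lim (\<lambda>n. Y n x)" for x
  have [measurable]: "y \<in> borel_measurable borel" unfolding y_def by measurable
  \<comment> \<open>Fatou's lemma in the index m, with n fixed.\<close>
  have est: "(\<integral>\<^sup>+x. ennreal ((norm (y x - Y n x))\<^sup>2) \<partial>lborel) \<le> ennreal (((1/2)^n)\<^sup>2)" for n
  proof -
    have "(\<integral>\<^sup>+x. ennreal ((norm (y x - Y n x))\<^sup>2) \<partial>lborel) =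
        (\<integral>\<^sup>+x. liminf (\<lambda>m. ennreal ((norm (Y m x - Y n x))\<^sup>2)) \<partial>lborel)"
    proof (rule nn_integral_cong_AE, use conv in eventually_elim)
      case (elim x)
      then have "(\<lambda>m. Y m x) \<longlonglongrightarrow> y x" by (simp add: y_def convergent_LIMSEQ_iff)
      then have "(\<lambda>m. ennreal ((norm (Y m x - Y n x))\<^sup>2)) \<longlonglongrightarrow> ennreal ((norm (y x - Y n x))\<^sup>2)"
        by (intro tendsto_ennrealI tendsto_power tendsto_norm tendsto_diff tendsto_const)
      from lim_imp_Liminf[OF _ this] show ?case by simp
    qed
    also have "\<dots> \<le> liminf (\<lambda>m. \<integral>\<^sup>+x. ennreal ((norm (Y m x - Y n x))\<^sup>2) \<partial>lborel)"
      by (rule nn_integral_liminf) measurable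
    also have "\<dots> = liminf (\<lambda>m. ennreal ((dist (X (r m)) (X (r n)))\<^sup>2))"
      by (subst nn_integral_eq_integral[OF dY(1)]) (auto simp: dY)
    also have "\<dots> \<le> ennreal (((1/2)^n)\<^sup>2)"
      by (intro Liminf_le) (auto intro!: eventually_sequentiallyI[of n] ennreal_leI power_mono small)
    finally show ?thesis .
  qed
  have sqd: "sq_int (\<lambda>x. y x - Y n x)" for n
    unfolding sq_int_def
  proof
    show "integrable lborel (\<lambda>x. (norm (y x - Y n x))\<^sup>2)"
    proof (rule integrableI_bounded)
      show "(\<integral>\<^sup>+x. ennreal (norm ((norm (y x - Y n x))\<^sup>2)) \<partial>lborel) < \<infinity>"
        using est[of n] by (simp add: le_less_trans[OF _ ennreal_less_top])
    qed measurable
  qed measurable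
  have "sq_int (\<lambda>x. (y x - Y 0 x) + Y 0 x)"
    by (rule sq_int_add[OF sqd]) (simp add: Y_def sq_int_rep)
  then have sqy: "sq_int y" by simp
  have "dist (X (r n)) (abs_l2 y) \<le> (1/2)^n" for n
  proof -
    have "ennreal ((norm (abs_l2 y - X (r n)))\<^sup>2) \<le> ennreal (((1/2)^n)\<^sup>2)"
      unfolding norm_l2_nn_integral
    proof (rule order_trans[OF _ est], rule nn_integral_mono_AE)
      show "AE x in lborel. ennreal ((norm (rep_l2 (abs_l2 y - X (r n)) x))\<^sup>2)
          \<le> ennreal ((norm (y x - Y n x))\<^sup>2)"
        using rep_minus[of "abs_l2 y" "X (r n)"] rep_abs_l2[OF sqy]
        by eventually_elim (simp add: Y_def)
    qed
    then have "(norm (abs_l2 y - X (r n)))\<^sup>2 \<le> ((1/2)^n)\<^sup>2"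
      by (subst (asm) ennreal_le_iff) (rule zero_le_power2)
    then have "norm (abs_l2 y - X (r n)) \<le> (1/2)^n"
      by (rule power2_le_imp_le) simp
    then show ?thesis by (simp add: dist_norm norm_minus_commute)
  qed
  then have "(\<lambda>n. dist (X (r n)) (abs_l2 y)) \<longlonglongrightarrow> 0"
    by (intro tendsto_sandwich[OF _ _ tendsto_const LIMSEQ_realpow_zero[of "1/2"]] always_eventually) auto
  then have "(\<lambda>n. X (r n)) \<longlonglongrightarrow> abs_l2 y"
    by (rule iffD2[OF tendsto_dist_iff])
  then have "(X \<circ> r) \<longlonglongrightarrow> abs_l2 y" by (simp add: comp_def)
  then have "X \<longlonglongrightarrow> abs_l2 y"
    by (rule Cauchy_converges_subseq[OF \<open>Cauchy X\<close> r(1)])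
  then show "\<exists>l\<in>UNIV. X \<longlonglongrightarrow> l" by blast
qed

text \<open>A Lax--Milgram argument for an operator given by a graph \<open>q\<close>. The norm
  bound and density make the closure the graph of a bounded everywhere defined \<open>F\<close>, and
  the lower bound on the form, which passes to the closure by continuity, makes I + F coercive with
  constant c. As \<open>inner\<close> is the real part of the Hermitian product, this is a condition
  on the real part of \<open>q\<close> only.\<close>

lemma minus_one_in_resolvent_set_closure:
  fixes q :: l2_rel
  assumes add: "\<And>f g f' g'. (f, g) \<in> q \<Longrightarrow> (f', g') \<in> q \<Longrightarrow> (f + f', g + g') \<in> q"
    and scale: "\<And>a f g. (f, g) \<in> q \<Longrightarrow> (a *\<^sub>C f, a *\<^sub>C g) \<in> q"
    and dense: "closure (Domain q) = UNIV"
    and bound: "\<And>f g. (f, g) \<in> q \<Longrightarrow> norm g \<le> C * norm f"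
    and accretive: "\<And>f g. (f, g) \<in> q \<Longrightarrow> inner f g \<ge> (c - 1) * (norm f)\<^sup>2"
    and c: "0 < c" "c \<le> 1" and C: "0 \<le> C"
  shows "-1 \<in> resolvent_set (closure q)"
proof -
  have seq: "\<exists>X Y. (\<forall>n. (X n, Y n) \<in> q) \<and> X \<longlonglongrightarrow> f \<and> Y \<longlonglongrightarrow> g" if fg: "(f, g) \<in> closure q" for f g
  proof -
    from fg obtain Z where Z: "\<And>n. Z n \<in> q" "Z \<longlonglongrightarrow> (f, g)"
      by (auto simp: closure_sequential)
    show ?thesis
      using Z(1) tendsto_fst[OF Z(2)] tendsto_snd[OF Z(2)]
      by (intro exI[of _ "fst \<circ> Z"] exI[of _ "snd \<circ> Z"]) (auto simp: comp_def)
  qed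
  have clI: "(f, g) \<in> closure q" if "\<And>n. (X n, Y n) \<in> q" "X \<longlonglongrightarrow> f" "Y \<longlonglongrightarrow> g" for X Y f g
    unfolding closure_sequential using tendsto_Pair[OF that(2,3)] that(1)
    by (intro exI[of _ "\<lambda>n. (X n, Y n)"]) auto
  have add': "(f + f', g + g') \<in> closure q"
    if fg: "(f, g) \<in> closure q" "(f', g') \<in> closure q" for f g f' g'
  proof -
    obtain X Y X' Y' where XY: "\<And>n. (X n, Y n) \<in> q" "X \<longlonglongrightarrow> f" "Y \<longlonglongrightarrow> g"
        "\<And>n. (X' n, Y' n) \<in> q" "X' \<longlonglongrightarrow> f'" "Y' \<longlonglongrightarrow> g'"
      using seq[OF fg(1)] seq[OF fg(2)] by metis
    show ?thesis
      by (rule clI[of "\<lambda>n. X n + X' n" "\<lambda>n. Y n + Y' n"]) (intro add tendsto_add XY)+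
  qed
  have scale': "(a *\<^sub>C f, a *\<^sub>C g) \<in> closure q" if fg: "(f, g) \<in> closure q" for a f g
  proof -
    obtain X Y where XY: "\<And>n. (X n, Y n) \<in> q" "X \<longlonglongrightarrow> f" "Y \<longlonglongrightarrow> g"
      using seq[OF fg] by metis
    show ?thesis
      by (rule clI[of "\<lambda>n. a *\<^sub>C X n" "\<lambda>n. a *\<^sub>C Y n"])
        (intro scale bounded_linear.tendsto[OF bounded_linear_scaleC] XY)+
  qed
  have bound': "norm g \<le> C * norm f" if fg: "(f, g) \<in> closure q" for f g
  proof -
    obtain X Y where XY: "\<And>n. (X n, Y n) \<in> q" "X \<longlonglongrightarrow> f" "Y \<longlonglongrightarrow> g"
      using seq[OF fg] by metis
    have "(\<lambda>n. C * norm (X n)) \<longlonglongrightarrow> C * norm f" "(\<lambda>n. norm (Y n)) \<longlonglongrightarrow> norm g"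
      by (intro tendsto_intros XY)+
    then show ?thesis using bound[OF XY(1)] by (auto intro: LIMSEQ_le)
  qed
  have acc': "inner f g \<ge> (c - 1) * (norm f)\<^sup>2" if fg: "(f, g) \<in> closure q" for f g
  proof -
    obtain X Y where XY: "\<And>n. (X n, Y n) \<in> q" "X \<longlonglongrightarrow> f" "Y \<longlonglongrightarrow> g"
      using seq[OF fg] by metis
    have "(\<lambda>n. inner (X n) (Y n)) \<longlonglongrightarrow> inner f g"
        "(\<lambda>n. (c - 1) * (norm (X n))\<^sup>2) \<longlonglongrightarrow> (c - 1) * (norm f)\<^sup>2"
      by (intro tendsto_intros XY)+
    then show ?thesis using accretive[OF XY(1)] by (auto intro: LIMSEQ_le)
  qed
  have diffq: "(f - f', g - g') \<in> q" if "(f, g) \<in> q" "(f', g') \<in> q" for f g f' g'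
    using add[OF that(1) scale[OF that(2), of "-1"]] by (simp add: scaleC_minus_one)
  have diff': "(f - f', g - g') \<in> closure q" if "(f, g) \<in> closure q" "(f', g') \<in> closure q" for f g f' g'
    using add'[OF that(1) scale'[OF that(2), of "-1"]] by (simp add: scaleC_minus_one)
  \<comment> \<open>The bound applied to differences makes the images of an approximating sequence
    Cauchy.\<close>
  have total: "\<exists>g. (f, g) \<in> closure q" for f
  proof -
    have "f \<in> closure (Domain q)" using dense by simp
    then obtain X where X: "\<And>n. X n \<in> Domain q" "X \<longlonglongrightarrow> f"
      by (auto simp: closure_sequential)
    then obtain Y where Y: "\<And>n. (X n, Y n) \<in> q" unfolding Domain_iff by metis
    have "Cauchy Y"
    proof (rule metric_CauchyI)
      fix e :: real assume "0 < e"
      have "Cauchy X" by (rule LIMSEQ_imp_Cauchy[OF X(2)])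
      then obtain M where M: "\<And>m n. m \<ge> M \<Longrightarrow> n \<ge> M \<Longrightarrow> dist (X m) (X n) < e / (C + 1)"
        using metric_CauchyD[of X "e / (C + 1)"] \<open>0 < e\<close> C by auto
      have "dist (Y m) (Y n) < e" if "m \<ge> M" "n \<ge> M" for m n
      proof -
        have "dist (Y m) (Y n) \<le> C * dist (X m) (X n)"
          unfolding dist_norm by (rule bound[OF diffq[OF Y Y]])
        also have "\<dots> \<le> (C + 1) * dist (X m) (X n)" by (simp add: algebra_simps)
        also have "\<dots> < e" using M[OF that] C by (simp add: field_simps)
        finally show ?thesis .
      qed
      then show "\<exists>M. \<forall>m\<ge>M. \<forall>n\<ge>M. dist (Y m) (Y n) < e" by blast
    qed
    then obtain g where "Y \<longlonglongrightarrow> g" using complete_l2 by (auto simp: complete_def)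
    then show ?thesis using clI[OF Y X(2)] by blast
  qed
  then obtain F where F: "\<And>f. (f, F f) \<in> closure q" by metis
  have Feq: "g = F f" if "(f, g) \<in> closure q" for f g
    using bound'[OF diff'[OF that F[of f]]] by simp
  have Fadd: "F (f + g) = F f + F g" for f g using Feq[OF add'[OF F F]] by simp
  have FC: "F (a *\<^sub>C f) = a *\<^sub>C F f" for a f using Feq[OF scale'[OF F]] by simp
  have Fdiff: "F (f - g) = F f - F g" for f g using Feq[OF diff'[OF F F]] by simp
  define S where "S f = f + F f" for f
  define M where "M = C + 1"
  have S_bound: "norm (S f) \<le> M * norm f" for f
    using norm_triangle_ineq[of f "F f"] bound'[OF F, of f] by (simp add: S_def M_def algebra_simps)
  have S_acc: "c * (norm f)\<^sup>2 \<le> inner f (S f)" for f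
    using acc'[OF F, of f] by (simp add: S_def inner_add_right algebra_simps power2_norm_eq_inner)
  have S_diff: "S (f - g) = S f - S g" for f g by (simp add: S_def Fdiff)
  have S_add: "S (f + g) = S f + S g" for f g by (simp add: S_def Fadd)
  have S_C: "S (a *\<^sub>C f) = a *\<^sub>C S f" for a f by (simp add: S_def FC scaleC_add_right)
  have S_low: "c * norm f \<le> norm (S f)" for f
  proof (cases "f = 0")
    case False
    have "c * norm f * norm f \<le> norm (S f) * norm f"
      using S_acc[of f] norm_cauchy_schwarz[of f "S f"] by (simp add: power2_eq_square algebra_simps)
    then show ?thesis using False by simp
  qed simp
  have M1: "1 \<le> M" using C by (simp add: M_def)
  have S_ex1: "\<exists>!f. S f = h" for h
  proof -
    \<comment> \<open>This value minimises \<open>1 - 2 * t * c + t\<^sup>2 * M\<^sup>2\<close>, the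
      bound for the squared norm of I - t S. The minimum is
      \<open>1 - c\<^sup>2 / M\<^sup>2\<close>, which lies in [0, 1) since 0 < c \<le> 1 \<le>
      M.\<close>
    define t where "t = c / M\<^sup>2"
    have t0: "0 < t" using c M1 by (simp add: t_def)
    have cM: "c\<^sup>2 / M\<^sup>2 \<le> 1"
      using power_mono[of c M 2] c M1 by (simp add: field_simps)
    have contr: "norm (f - t *\<^sub>R S f) \<le> sqrt (1 - c\<^sup>2 / M\<^sup>2) * norm f" for f
    proof (rule power2_le_imp_le)
      have "(norm (f - t *\<^sub>R S f))\<^sup>2 = (norm f)\<^sup>2 - 2 * t * inner f (S f) + t\<^sup>2 * (norm (S f))\<^sup>2"
        unfolding power2_norm_eq_inner
        by (simp add: inner_diff_left inner_diff_right inner_commute power2_eq_square algebra_simps)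
      also have "\<dots> \<le> (norm f)\<^sup>2 - 2 * t * (c * (norm f)\<^sup>2) + t\<^sup>2 * (M * norm f)\<^sup>2"
        using t0 S_acc[of f] S_bound[of f]
        by (intro add_mono diff_mono mult_left_mono power_mono) auto
      also have "\<dots> = (1 - c\<^sup>2 / M\<^sup>2) * (norm f)\<^sup>2"
        using M1 by (simp add: t_def field_simps power2_eq_square)
      finally show "(norm (f - t *\<^sub>R S f))\<^sup>2 \<le> (sqrt (1 - c\<^sup>2 / M\<^sup>2) * norm f)\<^sup>2"
        using cM by (simp add: power_mult_distrib)
    qed (use cM in simp)
    \<comment> \<open>The fixed points of this damped iteration are the solutions of S f =
      h.\<close>
    have "\<exists>!f\<in>UNIV. f - t *\<^sub>R (S f - h) = f"
    proof (rule Banach_fix[OF complete_l2])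
      show "sqrt (1 - c\<^sup>2 / M\<^sup>2) < 1" "0 \<le> sqrt (1 - c\<^sup>2 / M\<^sup>2)" using c M1 cM by auto
      fix f g
      show "dist (f - t *\<^sub>R (S f - h)) (g - t *\<^sub>R (S g - h)) \<le> sqrt (1 - c\<^sup>2 / M\<^sup>2) * dist f g"
        using contr[of "f - g"] by (simp add: dist_norm S_diff algebra_simps)
    qed auto
    then show ?thesis using t0 by simp
  qed
  define G where "G h = (THE f. S f = h)" for h
  have SG: "S (G h) = h" for h unfolding G_def by (rule theI'[OF S_ex1])
  have GS: "G (S f) = f" for f using S_ex1[of "S f"] SG by blast
  have Gadd: "G (h + h') = G h + G h'" for h h' using GS[of "G h + G h'"] by (simp add: S_add SG)
  have GC: "G (a *\<^sub>C h) = a *\<^sub>C G h" for a h using GS[of "a *\<^sub>C G h"] by (simp add: S_C SG)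
  have "bounded_linear G"
  proof (rule bounded_linear_intro[where K = "1 / c"])
    show "G (r *\<^sub>R h) = r *\<^sub>R G h" for r h using GC[of "complex_of_real r" h] by (simp add: scaleC_of_real)
    show "norm (G h) \<le> norm h * (1 / c)" for h
      using S_low[of "G h"] c by (simp add: SG field_simps)
  qed (rule Gadd)
  moreover have "resolvent (closure q) (-1) = {(f, G f) |f. True}"
  proof -
    have "(f, h) \<in> closure q \<longleftrightarrow> h = F f" for f h using F Feq by auto
    then have "resolvent (closure q) (-1) = {(S f, f) |f. True}"
      by (auto simp: resolvent_def op_shift_def scaleC_minus_one S_def add.commute)
    also have "\<dots> = {(f, G f) |f. True}" using GS SG by (auto; metis)
    finally show ?thesis .
  qed
  ultimately have "bounded_op (resolvent (closure q) (-1))"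
    using GC by (auto simp: bounded_op_def)
  then show ?thesis by (simp add: resolvent_set_def)
qed

section \<open>Positive semidefinite matrices\<close>

lemma cadjoint_nth [simp]: "cadjoint M $ i $ j = cnj (M $ j $ i)"
  by (simp add: cadjoint_def)

lemma mat2_eq_iff: "(M::complex^2^2) = N \<longleftrightarrow> M$1$1 = N$1$1 \<and> M$1$2 = N$1$2 \<and> M$2$1 = N$2$1 \<and> M$2$2 = N$2$2"
  by (auto simp: vec_eq_iff forall_2)

lemma mat2_mult_nth: "((M::complex^2^2) ** N) $ i $ j = M$i$1 * N$1$j + M$i$2 * N$2$j"
  by (simp add: matrix_matrix_mult_def sum_2)

lemma mat2_vec_nth: "((M::complex^2^2) *v v) $ i = M$i$1 * v$1 + M$i$2 * v$2"
  by (simp add: matrix_vector_mult_def sum_2)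

text \<open>By Cayley--Hamilton, the positive semidefinite root \<open>P\<close> of \<open>M\<close> satisfies
  \<open>M = (tr P) P - det P\<close>, where \<open>det P = \<surd> (det M)\<close> and \<open>(tr P)\<^sup>2 = tr M + 2 det P\<close>. If \<open>tr P = 0\<close>,
  then \<open>P = 0\<close>, in accordance with \<open>x / 0 = 0\<close> below.\<close>

definition root_det :: "complex^2^2 \<Rightarrow> real" where
  "root_det M = sqrt (Re (M$1$1 * M$2$2 - M$1$2 * M$2$1))"

definition root_trace :: "complex^2^2 \<Rightarrow> real" where
  "root_trace M = sqrt (Re (M$1$1 + M$2$2) + 2 * root_det M)"

definition psd_root :: "complex^2^2 \<Rightarrow> complex^2^2" where
  "psd_root M = (\<chi> i j. (M$i$j + (if i = j then of_real (root_det M) else 0)) / of_real (root_trace M))"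

lemma psd_hermitian:
  assumes "psd M"
  shows "M$1$1 = of_real (Re (M$1$1))" "M$2$2 = of_real (Re (M$2$2))" "M$2$1 = cnj (M$1$2)"
proof -
  have h: "cadjoint M = M" using assms by (simp add: psd_def)
  have "cnj (M$i$j) = M$j$i" for i j using arg_cong[OF h, of "\<lambda>A. A$j$i"] by simp
  from this[of 1 1] this[of 2 2] this[of 1 2]
  show "M$1$1 = of_real (Re (M$1$1))" "M$2$2 = of_real (Re (M$2$2))" "M$2$1 = cnj (M$1$2)"
    by (auto simp: complex_eq_iff)
qed

text \<open>In dimension two positivity amounts to a nonnegative diagonal and a nonnegative
  determinant, conditions that can be checked on explicit entries. Sufficiency is the inequality
  between arithmetic and geometric means, with |b| \<le> \<open>sqrt a * sqrt d\<close> bounding the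
  mixed term.\<close>

lemma psd_iff:
  "psd M \<longleftrightarrow> M$1$1 = of_real (Re (M$1$1)) \<and> M$2$2 = of_real (Re (M$2$2)) \<and> M$2$1 = cnj (M$1$2) \<and>
    0 \<le> Re (M$1$1) \<and> 0 \<le> Re (M$2$2) \<and> (cmod (M$1$2))\<^sup>2 \<le> Re (M$1$1) * Re (M$2$2)" (is "_ \<longleftrightarrow> ?R")
proof
  assume M: "psd M"
  define a d b where "a = Re (M$1$1)" and "d = Re (M$2$2)" and "b = M$1$2"
  have form: "0 \<le> a * (cmod v)\<^sup>2 + d * (cmod w)\<^sup>2 + 2 * Re (b * w * cnj v)" for v w
  proof -
    have "0 \<le> Re (\<Sum>i\<in>UNIV. (M *v vector [v, w]) $ i * cnj (vector [v, w] $ i))"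
      using M by (simp add: psd_def)
    also have "\<dots> = a * (cmod v)\<^sup>2 + d * (cmod w)\<^sup>2 + 2 * Re (b * w * cnj v)"
    proof -
      have e: "M$1$1 = of_real a" "M$2$2 = of_real d" "M$1$2 = b" "M$2$1 = cnj b"
        using psd_hermitian[OF M] by (simp_all add: a_def d_def b_def)
      show ?thesis
        by (simp add: sum_2 mat2_vec_nth e cmod_power2) algebra
    qed
    finally show ?thesis .
  qed
  have a: "0 \<le> a" using form[of 1 0] by simp
  have d: "0 \<le> d" using form[of 0 1] by simp
  have "(cmod b)\<^sup>2 \<le> a * d"
  proof (cases "a = 0")
    case True
    have "b = 0"
    proof (rule ccontr)
      assume "b \<noteq> 0"
      then have nz: "(cmod b)\<^sup>2 > 0" by simp
      \<comment> \<open>For a = 0 the form is affine in v. This v is scaled so that its value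
        becomes d - 2 (d + 1), which is negative.\<close>
      have "0 \<le> d + 2 * Re (b * cnj (of_real (- (d + 1) / (cmod b)\<^sup>2) * b))"
        using form[of "of_real (- (d + 1) / (cmod b)\<^sup>2) * b" 1] True by simp
      also have "Re (b * cnj (of_real (- (d + 1) / (cmod b)\<^sup>2) * b)) = - (d + 1) / (cmod b)\<^sup>2 * (cmod b)\<^sup>2"
      proof -
        have "b * cnj (of_real r * b) = of_real (r * (cmod b)\<^sup>2)" for r
          by (simp add: complex_norm_square mult_ac del: complex_mult_cnj flip: of_real_power)
        then show ?thesis by (simp only: Re_complex_of_real)
      qed
      also have "\<dots> = - (d + 1)" using nz by simp
      finally show False using d by simp
    qed
    then show ?thesis using True by simp
  next
    case False
    \<comment> \<open>On the vector (- b, a) the form equals a times the determinant.\<close>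
    have "0 \<le> a * (a * d - (cmod b)\<^sup>2)"
      using form[of "- b" "of_real a"] unfolding cmod_power2
      by (simp add: power2_eq_square algebra_simps)
    then show ?thesis using a False by (simp add: zero_le_mult_iff)
  qed
  then show ?R using psd_hermitian[OF M] a d by (simp add: a_def d_def b_def)
next
  assume R: ?R
  define a d b where "a = Re (M$1$1)" and "d = Re (M$2$2)" and "b = M$1$2"
  have R': "M$1$1 = of_real a" "M$2$2 = of_real d" "M$1$2 = b" "M$2$1 = cnj b"
    "0 \<le> a" "0 \<le> d" "(cmod b)\<^sup>2 \<le> a * d"
    using R unfolding a_def d_def b_def by auto
  have "0 \<le> a * (cmod v)\<^sup>2 + d * (cmod w)\<^sup>2 + 2 * Re (b * w * cnj v)" for v w
  proof -
    have "\<bar>Re (b * w * cnj v)\<bar> \<le> cmod b * cmod w * cmod v"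
      using abs_Re_le_cmod[of "b * w * cnj v"] by (simp add: norm_mult)
    also have "\<dots> \<le> (sqrt a * cmod v) * (sqrt d * cmod w)"
    proof -
      have "cmod b \<le> sqrt a * sqrt d"
        using R'(7) by (simp add: real_le_rsqrt flip: real_sqrt_mult)
      then have "cmod b * (cmod w * cmod v) \<le> sqrt a * sqrt d * (cmod w * cmod v)"
        by (rule mult_right_mono) auto
      then show ?thesis by (simp add: mult_ac)
    qed
    finally have "2 * \<bar>Re (b * w * cnj v)\<bar> \<le> (sqrt a * cmod v)\<^sup>2 + (sqrt d * cmod w)\<^sup>2"
      using sum_squares_bound[of "sqrt a * cmod v" "sqrt d * cmod w"] by linarith
    then show ?thesis using R'(5,6) by (simp add: power_mult_distrib del: times_complex.sel)
  qed
  then have form: "0 \<le> a * (cmod (v$1))\<^sup>2 + d * (cmod (v$2))\<^sup>2 + 2 * Re (b * v$2 * cnj (v$1))"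
    for v :: "complex^2" .
  show "psd M"
  proof -
    have "Re (\<Sum>i\<in>UNIV. (M *v v) $ i * cnj (v $ i)) =
        a * (cmod (v$1))\<^sup>2 + d * (cmod (v$2))\<^sup>2 + 2 * Re (b * v$2 * cnj (v$1))" for v :: "complex^2"
      unfolding cmod_power2
      by (simp add: sum_2 mat2_vec_nth R' power2_eq_square algebra_simps)
    with form show "psd M" unfolding psd_def using R' by (simp add: mat2_eq_iff)
  qed
qed

text \<open>Uniqueness of the positive semidefinite root, which the definite description in
  \<open>psd_sqrt\<close> needs: on \<open>P ** P\<close> the functions \<open>root_det\<close> and
  \<open>root_trace\<close> return the determinant and the trace of \<open>P\<close>, so the formula
  solves the Cayley--Hamilton relation for \<open>P\<close>.\<close>

lemma psd_root_square:
  assumes P: "psd P"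
  shows "psd_root (P ** P) = P"
proof -
  define a d b where "a = Re (P$1$1)" and "d = Re (P$2$2)" and "b = P$1$2"
  have R: "P$1$1 = of_real a" "P$2$2 = of_real d" "P$1$2 = b" "P$2$1 = cnj b"
    "0 \<le> a" "0 \<le> d" "(cmod b)\<^sup>2 \<le> a * d"
    using P unfolding psd_iff a_def d_def b_def by auto
  have bb: "b * cnj b = of_real ((cmod b)\<^sup>2)" "cnj b * b = of_real ((cmod b)\<^sup>2)"
    by (simp_all add: complex_norm_square mult.commute flip: of_real_power)
  have M: "(P ** P)$1$1 = of_real (a\<^sup>2 + (cmod b)\<^sup>2)" "(P ** P)$2$2 = of_real (d\<^sup>2 + (cmod b)\<^sup>2)"
    "(P ** P)$1$2 = of_real (a + d) * b" "(P ** P)$2$1 = of_real (a + d) * cnj b"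
    by (simp_all add: mat2_mult_nth R bb power2_eq_square algebra_simps)
  have det: "root_det (P ** P) = a * d - (cmod b)\<^sup>2"
  proof -
    have "of_real (a + d) * b * (of_real (a + d) * cnj b) = of_real ((a + d)\<^sup>2 * (cmod b)\<^sup>2)"
      unfolding of_real_mult of_real_power of_real_add using bb
      unfolding of_real_power by algebra
    then have "Re ((P ** P)$1$1 * (P ** P)$2$2 - (P ** P)$1$2 * (P ** P)$2$1) =
        (a\<^sup>2 + (cmod b)\<^sup>2) * (d\<^sup>2 + (cmod b)\<^sup>2) - (a + d)\<^sup>2 * (cmod b)\<^sup>2"
      unfolding M by (simp flip: of_real_mult)
    also have "\<dots> = (a * d - (cmod b)\<^sup>2)\<^sup>2" by (simp add: power2_eq_square algebra_simps)
    finally show ?thesis using R by (simp add: root_det_def)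
  qed
  have tr: "root_trace (P ** P) = a + d"
  proof -
    have "Re ((P ** P)$1$1 + (P ** P)$2$2) + 2 * root_det (P ** P) = (a + d)\<^sup>2"
      unfolding M det by (simp add: power2_eq_square algebra_simps)
    then show ?thesis using R by (simp add: root_trace_def)
  qed
  show ?thesis
  proof (cases "a + d = 0")
    case True
    then have "a = 0" "d = 0" using R by auto
    then show ?thesis using R by (simp add: mat2_eq_iff psd_root_def tr)
  next
    case False
    then have nz: "complex_of_real a + complex_of_real d \<noteq> 0" by (simp flip: of_real_add)
    show ?thesis
      unfolding mat2_eq_iff psd_root_def tr det using nz
      by (simp add: M R field_simps power2_eq_square)
  qed
qed

lemma psd_sqrt_eq:
  assumes "psd P" "P ** P = M"
  shows "psd_sqrt M = P"
  unfolding psd_sqrt_def using assms psd_root_square by (intro the_equality) metis+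

text \<open>Existence of the root. Positivity of the numerator only needs
  \<open>(cmod b)\<^sup>2 \<le> a * d \<le> (a + s) * (d + s)\<close>; the square reduces to the
  identities \<open>e1\<close> below.\<close>

lemma psd_root_psd:
  assumes M: "psd M"
  shows "psd (psd_root M)" "psd_root M ** psd_root M = M"
proof -
  define a d b where "a = Re (M$1$1)" and "d = Re (M$2$2)" and "b = M$1$2"
  have R: "M$1$1 = of_real a" "M$2$2 = of_real d" "M$1$2 = b" "M$2$1 = cnj b"
    "0 \<le> a" "0 \<le> d" "(cmod b)\<^sup>2 \<le> a * d"
    using M unfolding psd_iff a_def d_def b_def by auto
  have bb: "b * cnj b = of_real ((cmod b)\<^sup>2)" "cnj b * b = of_real ((cmod b)\<^sup>2)"
    by (simp_all add: complex_norm_square mult.commute flip: of_real_power)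
  define s t where "s = root_det M" and "t = root_trace M"
  have s: "s = sqrt (a * d - (cmod b)\<^sup>2)"
    unfolding s_def root_det_def R bb by (simp flip: of_real_mult)
  have s0: "0 \<le> s" and s2: "s\<^sup>2 = a * d - (cmod b)\<^sup>2" using R by (auto simp: s)
  have t: "t = sqrt (a + d + 2 * s)" unfolding t_def root_trace_def R s_def[symmetric] by simp
  have t0: "0 \<le> t" and t2: "t\<^sup>2 = a + d + 2 * s" using R s0 by (auto simp: t)
  have q: "psd_root M $1$1 = of_real ((a + s) / t)" "psd_root M $2$2 = of_real ((d + s) / t)"
    "psd_root M $1$2 = b / of_real t" "psd_root M $2$1 = cnj b / of_real t"
    by (simp_all add: psd_root_def R s_def t_def)
  show "psd (psd_root M)"
    unfolding psd_iff q
  proof (intro conjI)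
    have "(cmod b)\<^sup>2 \<le> (a + s) * (d + s)"
      using R s0 mult_nonneg_nonneg[of a s] mult_nonneg_nonneg[of d s] mult_nonneg_nonneg[of s s]
      unfolding distrib_left distrib_right mult.commute[of s d] by linarith
    then show "(cmod (b / complex_of_real t))\<^sup>2 \<le>
        Re (complex_of_real ((a + s) / t)) * Re (complex_of_real ((d + s) / t))"
      by (simp add: norm_divide power_divide power2_eq_square divide_right_mono)
  qed (use R s0 t0 in auto)
  show "psd_root M ** psd_root M = M"
  proof (cases "t = 0")
    case True
    then have "a = 0" "d = 0" using t2 R s0 by auto
    then have "b = 0" using R(7) by simp
    then show ?thesis using \<open>a = 0\<close> \<open>d = 0\<close> True by (simp add: mat2_eq_iff mat2_mult_nth q R)
  next
    case False
    have c: "(of_real t :: complex) * of_real t = of_real (a + d + 2 * s)"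
      unfolding t2[symmetric] by (simp add: power2_eq_square)
    \<comment> \<open>Replacing \<open>s\<^sup>2 + (cmod b)\<^sup>2\<close> by \<open>a * d\<close>
      leaves a common factor a, respectively d, whose cofactor is a + d + 2 s.\<close>
    have e1: "(a + s)\<^sup>2 + (cmod b)\<^sup>2 = a * t\<^sup>2" "(d + s)\<^sup>2 + (cmod b)\<^sup>2 = d * t\<^sup>2"
      unfolding t2 using s2 by (simp_all add: power2_eq_square algebra_simps)
    have tz: "complex_of_real t \<noteq> 0" using False by simp
    have i1: "(psd_root M ** psd_root M)$1$1 = of_real a" "(psd_root M ** psd_root M)$2$2 = of_real d"
    proof -
      have "(psd_root M ** psd_root M)$1$1 = of_real (((a + s)\<^sup>2 + (cmod b)\<^sup>2) / t\<^sup>2)"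
        using tz bb by (simp add: mat2_mult_nth q field_simps power2_eq_square)
      then show "(psd_root M ** psd_root M)$1$1 = of_real a" using False e1 by simp
      have "(psd_root M ** psd_root M)$2$2 = of_real (((d + s)\<^sup>2 + (cmod b)\<^sup>2) / t\<^sup>2)"
        using tz bb by (simp add: mat2_mult_nth q field_simps power2_eq_square)
      then show "(psd_root M ** psd_root M)$2$2 = of_real d" using False e1 by simp
    qed
    have i2: "(psd_root M ** psd_root M)$1$2 = b" "(psd_root M ** psd_root M)$2$1 = cnj b"
    proof -
      have "(psd_root M ** psd_root M)$1$2 = b * of_real (a + d + 2 * s) / (of_real t * of_real t)"
        using tz by (simp add: mat2_mult_nth q field_simps)
      then show "(psd_root M ** psd_root M)$1$2 = b" using c tz by (metis mult_eq_0_iff nonzero_mult_div_cancel_right)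
      have "(psd_root M ** psd_root M)$2$1 = cnj b * of_real (a + d + 2 * s) / (of_real t * of_real t)"
        using tz by (simp add: mat2_mult_nth q field_simps)
      then show "(psd_root M ** psd_root M)$2$1 = cnj b" using c tz by (metis mult_eq_0_iff nonzero_mult_div_cancel_right)
    qed
    show ?thesis by (simp add: mat2_eq_iff i1 i2 R)
  qed
qed

lemma psd_sqrt_eq_psd_root: "psd M \<Longrightarrow> psd_sqrt M = psd_root M"
  by (intro psd_sqrt_eq psd_root_psd)

section \<open>Polar decomposition of \<i> M for positive semidefinite M\<close>

definition iscale :: "complex^2^2 \<Rightarrow> complex^2^2" where
  "iscale M = (\<chi> i j. \<i> * M $ i $ j)"

lemma iscale_nth [simp]: "iscale M $ i $ j = \<i> * M $ i $ j" by (simp add: iscale_def)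

lemma mat_abs_iscale:
  assumes M: "psd M"
  shows "mat_abs (iscale M) = M"
proof -
  have "cadjoint (iscale M) ** iscale M = cadjoint M ** M"
  proof -
    have "(\<i> * c) * (\<i> * d) = - (c * d)" for c d
    proof -
      have "(\<i> * c) * (\<i> * d) = (\<i> * \<i>) * (c * d)" by (simp only: mult_ac)
      then show ?thesis by simp
    qed
    then show ?thesis by (simp add: mat2_eq_iff mat2_mult_nth)
  qed
  then show ?thesis using M psd_sqrt_eq[OF M refl] by (simp add: mat_abs_def psd_def)
qed

text \<open>\<open>P\<close> is the orthogonal projection onto the range of \<open>M\<close>. The
  witness \<open>C\<close> records that \<open>P\<close> factors through \<open>M\<close> on both
  sides; this gives equality of kernels, and lets an unknown partial isometry be computed from its
  product with \<open>M\<close>, without spectral theory. The cases are rank zero, one and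
  two.\<close>

lemma psd_range_projection:
  assumes M: "psd M"
  obtains P C where "cadjoint P = P" "P ** P = P" "M ** P = M" "P = M ** C" "P = C ** M"
proof -
  define a d b where "a = Re (M$1$1)" and "d = Re (M$2$2)" and "b = M$1$2"
  have R: "M$1$1 = of_real a" "M$2$2 = of_real d" "M$1$2 = b" "M$2$1 = cnj b"
    "0 \<le> a" "0 \<le> d" "(cmod b)\<^sup>2 \<le> a * d"
    using M unfolding psd_iff a_def d_def b_def by auto
  have bb: "b * cnj b = of_real ((cmod b)\<^sup>2)"
    by (simp add: complex_norm_square flip: of_real_power)
  consider "(cmod b)\<^sup>2 = a * d" "a + d = 0" | "(cmod b)\<^sup>2 = a * d" "a + d \<noteq> 0" | "(cmod b)\<^sup>2 \<noteq> a * d"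
    by blast
  then show ?thesis
  proof cases
    case 1
    then have "a = 0" "d = 0" using R by auto
    moreover have "b = 0" using \<open>a = 0\<close> 1(1) by simp
    ultimately have "M = 0" using R by (simp add: mat2_eq_iff)
    then show ?thesis by (intro that[of 0 0]) (simp_all add: mat2_eq_iff mat2_mult_nth)
  next
    case 2
    have nz: "complex_of_real a + complex_of_real d \<noteq> 0" using 2 by (simp flip: of_real_add)
    define e where "e = inverse (complex_of_real (a + d))"
    have e: "e * complex_of_real a + e * complex_of_real d = 1" "cnj e = e"
      using nz by (simp_all add: e_def field_simps flip: of_real_inverse of_real_add)
    have b2: "b * cnj b = of_real a * of_real d" using bb 2 by simp
    \<comment> \<open>\<open>C\<close> is e times the identity, because e (a + d) = 1. A matrix with
      vanishing determinant satisfies \<open>M ** M\<close> = (tr M) M, so M divided by its trace is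
      a projection.\<close>
    define C :: "complex^2^2" where "C = (\<chi> i j. if i = j then e * e * (of_real a + of_real d) else 0)"
    define P :: "complex^2^2" where "P = (\<chi> i j. e * M$i$j)"
    have eee: "e * e * (of_real a + of_real d) = e" using e(1) by algebra
    have "M ** P = M"
      unfolding mat2_eq_iff mat2_mult_nth P_def using e(1) b2
      by (simp add: R) algebra
    moreover have "P ** P = P"
      unfolding mat2_eq_iff mat2_mult_nth P_def using e(1) b2
      by (simp add: R) algebra
    moreover have "cadjoint P = P"
      by (simp add: mat2_eq_iff P_def R e)
    moreover have "P = M ** C" "P = C ** M"
      by (simp_all add: mat2_eq_iff mat2_mult_nth P_def C_def eee)
    ultimately show ?thesis by (intro that)
  next
    case 3
    define D where "D = complex_of_real (a * d - (cmod b)\<^sup>2)"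
    have D: "D \<noteq> 0" "D = of_real a * of_real d - b * cnj b"
      using 3 unfolding D_def of_real_eq_0_iff by (simp_all add: bb)
    define C :: "complex^2^2" where "C = vector [vector [of_real d / D, - b / D], vector [- cnj b / D, of_real a / D]]"
    have "M ** C = mat 1" "C ** M = mat 1"
    proof -
      have "(of_real a * of_real d - b * cnj b) / D = 1" using D by simp
      then show "M ** C = mat 1" "C ** M = mat 1"
        unfolding mat2_eq_iff mat2_mult_nth C_def
        by (simp_all add: R mat_def diff_divide_distrib mult_ac)
    qed
    then show ?thesis
    proof (intro that[of "mat 1" C])
      show "cadjoint (mat 1) = mat 1" by (simp add: mat2_eq_iff mat_def)
    qed simp_all
  qed
qed

text \<open>The polar part of \<i> M is \<i> P with P the range projection of M. It does not disturb
  the square root, since M and its root have the same range. This is the pointwise form of B = \<i>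
  A.\<close>

lemma polar_part_iscale:
  assumes M: "psd M"
  shows "polar_part (iscale M) ** psd_root M = iscale (psd_root M)"
proof -
  obtain P C where P: "cadjoint P = P" "P ** P = P" "M ** P = M" "P = M ** C" "P = C ** M"
    using psd_range_projection[OF M] by blast
  have iM: "iscale A ** B = iscale (A ** B)" "A ** iscale B = iscale (A ** B)" for A B
    by (simp_all add: mat2_eq_iff mat2_mult_nth algebra_simps)
  have kerM: "P *v v = 0 \<longleftrightarrow> M *v v = 0" for v
  proof -
    have "P *v v = C *v (M *v v)" "M *v v = M *v (P *v v)"
      using P by (simp_all add: matrix_vector_mul_assoc)
    then show ?thesis by (metis matrix_vector_mult_0_right)
  qed
  have kersc: "iscale A *v v = 0 \<longleftrightarrow> A *v v = 0" for A v
    by (simp add: vec_eq_iff mat2_vec_nth forall_2 flip: distrib_left mult.assoc)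
      (simp add: mult.assoc flip: distrib_left)
  have PM: "P ** M = M"
  proof -
    have "cadjoint (M ** P) = cadjoint P ** cadjoint M"
      by (simp add: mat2_eq_iff mat2_mult_nth algebra_simps)
    then show ?thesis using P M by (simp add: psd_def)
  qed
  have "polar_part (iscale M) = iscale P"
    unfolding polar_part_def mat_abs_iscale[OF M]
  proof (rule the_equality)
    have "cadjoint (iscale P) = (\<chi> i j. - (iscale P $ i $ j))"
      using P(1) by (simp add: mat2_eq_iff)
    then have "iscale P ** cadjoint (iscale P) ** iscale P = iscale (P ** P ** P)"
      by (simp add: mat2_eq_iff mat2_mult_nth algebra_simps)
    then show "iscale M = iscale P ** M \<and> iscale P ** cadjoint (iscale P) ** iscale P = iscale P \<and>
        (\<forall>v. iscale P *v v = 0 \<longleftrightarrow> iscale M *v v = 0)"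
      by (simp add: iM PM kersc kerM P(2))
  next
    \<comment> \<open>The kernel condition determines U on the kernel of M, giving U = U P; on the
      range, P = M C reduces U to the prescribed product \<open>U ** M\<close>.\<close>
    fix U
    assume U: "iscale M = U ** M \<and> U ** cadjoint U ** U = U \<and> (\<forall>v. U *v v = 0 \<longleftrightarrow> iscale M *v v = 0)"
    have "U *v (v - P *v v) = 0" for v
    proof -
      have "M *v (v - P *v v) = 0"
        using P(3) by (simp add: matrix_vector_mult_diff_distrib matrix_vector_mul_assoc)
      then show ?thesis using U by (simp add: kersc)
    qed
    then have "U *v v = (U ** P) *v v" for v
      by (simp add: matrix_vector_mult_diff_distrib matrix_vector_mul_assoc)
    then have "U = U ** P" by (simp add: matrix_eq)
    also have "\<dots> = (U ** M) ** C" using P(4) by (simp add: matrix_mul_assoc)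
    also have "\<dots> = iscale M ** C" using U by simp
    also have "\<dots> = iscale P" using P(4) by (simp add: iM)
    finally show "U = iscale P" .
  qed
  then have *: "polar_part (iscale M) ** psd_root M = iscale (P ** psd_root M)" by (simp add: iM)
  \<comment> \<open>\<open>D\<close> vanishes because \<open>D ** cadjoint D\<close> does: that
    product contains the factor \<open>D ** psd_root M\<close> = P M - M = 0. Its diagonal entries
    are the squared norms of the rows of \<open>D\<close>.\<close>
  define D where "D = P ** psd_root M - psd_root M"
  have "D ** psd_root M = 0"
  proof -
    have "D ** psd_root M = P ** (psd_root M ** psd_root M) - psd_root M ** psd_root M"
      by (simp add: D_def mat2_eq_iff mat2_mult_nth algebra_simps)
    then show ?thesis using PM psd_root_psd(2)[OF M] by simp
  qed
  moreover have "cadjoint (psd_root M) = psd_root M" using psd_root_psd(1)[OF M] by (simp add: psd_def)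
  then have "D ** cadjoint D = D ** psd_root M ** (P - mat 1)"
    using P(1) by (simp add: D_def mat2_eq_iff mat2_mult_nth mat_def algebra_simps)
  ultimately have DD: "D ** cadjoint D = 0" by (simp add: mat2_eq_iff mat2_mult_nth)
  have "D = 0"
  proof -
    have "(cmod (D$i$1))\<^sup>2 + (cmod (D$i$2))\<^sup>2 = 0" for i
      using arg_cong[OF DD, of "\<lambda>A. Re (A$i$i)"] by (simp add: mat2_mult_nth del: complex_mult_cnj flip: complex_norm_square of_real_power)
    then show ?thesis by (simp add: mat2_eq_iff add_nonneg_eq_0_iff)
  qed
  then show ?thesis by (simp add: * D_def)
qed

section \<open>Convolution with one-sided exponentials\<close>

text \<open>The Green matrix contains both exp (\<i> k |t|) and sgn t exp (\<i> k |t|). These are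
  the sum and the difference of the two one-sided kernels selected by \<open>b\<close>, and each of
  the latter satisfies a first-order equation.\<close>

definition exp_ker :: "bool \<Rightarrow> complex \<Rightarrow> real \<Rightarrow> complex" where
  "exp_ker b k t = (if (if b then 0 < t else t < 0) then exp (\<i> * k * of_real \<bar>t\<bar>) else 0)"

definition csq :: "(real \<Rightarrow> complex) \<Rightarrow> bool" where
  "csq g \<longleftrightarrow> g \<in> borel_measurable borel \<and> integrable lborel (\<lambda>x. (cmod (g x))\<^sup>2)"

definition exp_conv :: "bool \<Rightarrow> complex \<Rightarrow> (real \<Rightarrow> complex) \<Rightarrow> real \<Rightarrow> complex" where
  "exp_conv b k g x = (LINT y|lborel. exp_ker b k (x - y) * g y)"

lemma exp_ker_measurable [measurable]: "exp_ker b k \<in> borel_measurable borel"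
  unfolding exp_ker_def by (cases b) simp_all

lemma exp_ker_minus: "exp_ker b k (- t) = exp_ker (\<not> b) k t"
  by (auto simp: exp_ker_def)

lemma norm_exp_ker: "cmod (exp_ker b k t) = (if (if b then 0 < t else t < 0) then exp (- (Im k * \<bar>t\<bar>)) else 0)"
  by (simp add: exp_ker_def)

lemma norm_exp_ker_le_1: "0 < Im k \<Longrightarrow> cmod (exp_ker b k t) \<le> 1"
  by (simp add: norm_exp_ker)

lemma norm_exp_ker_square: "(cmod (exp_ker b k t))\<^sup>2 = cmod (exp_ker b (2 * k) t)"
  by (auto simp: norm_exp_ker power2_eq_square simp flip: exp_add)

text \<open>The exponent \<open>- cnj k\<close> again has positive imaginary part if
  \<open>k\<close> does; it is the one that belongs to the conjugate spectral parameter.\<close>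

lemma cnj_exp_ker: "cnj (exp_ker b k t) = exp_ker b (- cnj k) t"
  by (simp add: exp_ker_def exp_cnj)

lemma nn_integral_exp_ker:
  assumes "0 < Im k"
  shows "(\<integral>\<^sup>+t. ennreal (cmod (exp_ker b k t)) \<partial>lborel) = ennreal (1 / Im k)"
proof -
  have *: "(\<integral>\<^sup>+t. ennreal (cmod (exp_ker True k t)) \<partial>lborel) = ennreal (1 / Im k)"
  proof -
    have "(\<integral>\<^sup>+t. indicator {0..} t * ennreal (exp (- (Im k * t))) \<partial>lborel) = ennreal (1 / Im k)"
      by (rule nn_integral_exp_minus_Ici) fact
    also have "(\<integral>\<^sup>+t. indicator {0..} t * ennreal (exp (- (Im k * t))) \<partial>lborel) =
        (\<integral>\<^sup>+t. ennreal (cmod (exp_ker True k t)) \<partial>lborel)"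
      by (intro nn_integral_cong_AE, use AE_lborel_singleton[of 0] in eventually_elim)
        (auto simp: norm_exp_ker indicator_def)
    finally show ?thesis .
  qed
  show ?thesis
  proof (cases b)
    case False
    have "(\<integral>\<^sup>+t. ennreal (cmod (exp_ker True k t)) \<partial>lborel) =
        (\<integral>\<^sup>+t. ennreal (cmod (exp_ker False k t)) \<partial>lborel)"
      by (subst nn_integral_real_affine[where c = "-1" and t = 0]) (auto simp: exp_ker_minus)
    then show ?thesis using * False by simp
  qed (use * in simp)
qed

lemma nn_integral_exp_ker_shift:
  assumes "0 < Im k"
  shows "(\<integral>\<^sup>+x. ennreal (cmod (exp_ker b k (x - y))) \<partial>lborel) = ennreal (1 / Im k)"
    "(\<integral>\<^sup>+y. ennreal (cmod (exp_ker b k (x - y))) \<partial>lborel) = ennreal (1 / Im k)"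
  using nn_integral_exp_ker[OF assms, of b]
    nn_integral_real_affine[where c = 1 and t = "- y" and f = "\<lambda>t. ennreal (cmod (exp_ker b k t))"]
    nn_integral_real_affine[where c = "-1" and t = x and f = "\<lambda>t. ennreal (cmod (exp_ker b k t))"]
  by simp_all

lemma integrable_norm_exp_ker:
  assumes "0 < Im k"
  shows "integrable lborel (\<lambda>y. cmod (exp_ker b k (x - y)))"
    "(LINT y|lborel. cmod (exp_ker b k (x - y))) = 1 / Im k"
proof -
  have "has_bochner_integral lborel (\<lambda>y. cmod (exp_ker b k (x - y))) (1 / Im k)"
    by (rule has_bochner_integral_nn_integral) (use nn_integral_exp_ker_shift[OF assms] assms in auto)
  then show "integrable lborel (\<lambda>y. cmod (exp_ker b k (x - y)))"
    "(LINT y|lborel. cmod (exp_ker b k (x - y))) = 1 / Im k"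
    by (auto simp: has_bochner_integral_iff)
qed

lemma csq_measurable: "csq g \<Longrightarrow> g \<in> borel_measurable borel"
  by (simp add: csq_def)

lemma csq_bound:
  assumes "f \<in> borel_measurable borel" "csq g" "AE x in lborel. cmod (f x) \<le> C * cmod (g x)"
  shows "csq f"
  unfolding csq_def
proof
  have [measurable]: "f \<in> borel_measurable borel" "g \<in> borel_measurable borel"
    using assms by (auto simp: csq_def)
  have "integrable lborel (\<lambda>x. C\<^sup>2 * (cmod (g x))\<^sup>2)" using assms by (simp add: csq_def)
  then show "integrable lborel (\<lambda>x. (cmod (f x))\<^sup>2)"
  proof (rule Bochner_Integration.integrable_bound)
    show "AE x in lborel. norm ((cmod (f x))\<^sup>2) \<le> norm (C\<^sup>2 * (cmod (g x))\<^sup>2)"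
      using assms(3)
    proof eventually_elim
      case (elim x)
      then show ?case using power_mono[OF elim, of 2] by (simp add: power_mult_distrib)
    qed
  qed measurable
qed (rule assms)

lemma csq_add:
  assumes "csq f" "csq g"
  shows "csq (\<lambda>x. f x + g x)"
  unfolding csq_def
proof
  have [measurable]: "f \<in> borel_measurable borel" "g \<in> borel_measurable borel"
    using assms by (auto simp: csq_def)
  show "(\<lambda>x. f x + g x) \<in> borel_measurable borel" by measurable
  have "integrable lborel (\<lambda>x. 2 * (cmod (f x))\<^sup>2 + 2 * (cmod (g x))\<^sup>2)"
    using assms by (auto simp: csq_def)
  then show "integrable lborel (\<lambda>x. (cmod (f x + g x))\<^sup>2)"
  proof (rule Bochner_Integration.integrable_bound)
    have "(cmod (u + v))\<^sup>2 \<le> 2 * (cmod u)\<^sup>2 + 2 * (cmod v)\<^sup>2" for u v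
    proof -
      have "(cmod (u + v))\<^sup>2 \<le> (cmod u + cmod v)\<^sup>2" by (intro power_mono norm_triangle_ineq) auto
      then show ?thesis using sum_squares_bound[of "cmod u" "cmod v"]
        by (simp add: power2_eq_square algebra_simps)
    qed
    then show "AE x in lborel. norm ((cmod (f x + g x))\<^sup>2) \<le> norm (2 * (cmod (f x))\<^sup>2 + 2 * (cmod (g x))\<^sup>2)"
      by simp
  qed measurable
qed

lemma csq_cmult: "csq f \<Longrightarrow> csq (\<lambda>x. c * f x)"
  by (rule csq_bound[where C = "cmod c" and g = f]) (auto simp: csq_def norm_mult)

lemma csq_diff: "csq f \<Longrightarrow> csq g \<Longrightarrow> csq (\<lambda>x. f x - g x)"
  using csq_add[of f "\<lambda>x. (-1) * g x"] csq_cmult[of g "-1"] by simp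

lemma csq_cnj: "csq f \<Longrightarrow> csq (\<lambda>x. cnj (f x))"
proof (rule csq_bound[where C = 1 and g = f])
  assume "csq f"
  then have [measurable]: "f \<in> borel_measurable borel" by (simp add: csq_def)
  have "cnj \<in> borel_measurable borel"
    by (intro borel_measurable_continuous_onI continuous_intros)
  then show "(\<lambda>x. cnj (f x)) \<in> borel_measurable borel" by measurable
qed auto

lemma csq_reflect: "csq f \<Longrightarrow> csq (\<lambda>x. f (- x))"
  using lborel_integrable_real_affine[of "\<lambda>x. (cmod (f x))\<^sup>2" "-1" 0]
    measurable_compose[of uminus borel borel f borel] by (simp add: csq_def)

lemma csq_indicator: "csq (\<lambda>x. indicator {a..b} x)"
  unfolding csq_def
proof
  have "integrable lborel (indicator {a..b} :: real \<Rightarrow> real)"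
    using emeasure_lborel_Icc_eq[of a b] by (intro integrable_real_indicator) auto
  moreover have "(\<lambda>x. (cmod (indicator {a..b} x))\<^sup>2) = indicator {a..b}"
    by (auto simp: indicator_def)
  ultimately show "integrable lborel (\<lambda>x. (cmod (indicator {a..b} x))\<^sup>2)" by simp
qed simp

lemma csq_integrable_mult:
  assumes f: "csq f" and g: "csq g"
  shows "integrable lborel (\<lambda>x. f x * g x)"
proof -
  have [measurable]: "f \<in> borel_measurable borel" "g \<in> borel_measurable borel"
    using assms by (auto simp: csq_def)
  have "integrable lborel (\<lambda>x. cmod (f x) * cmod (g x))"
    by (rule real_Cauchy_Schwarz_integral) (use f g in \<open>auto simp: csq_def\<close>)
  then show ?thesis
    by (rule Bochner_Integration.integrable_bound) (auto simp: norm_mult)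
qed

lemma csq_exp_ker: "0 < Im k \<Longrightarrow> csq (\<lambda>y. exp_ker b k (x - y))"
  using integrable_norm_exp_ker(1)[of "2 * k" b x] by (simp add: csq_def norm_exp_ker_square)

lemma exp_conv_integrable:
  "0 < Im k \<Longrightarrow> csq g \<Longrightarrow> integrable lborel (\<lambda>y. exp_ker b k (x - y) * g y)"
  by (intro csq_integrable_mult csq_exp_ker)

lemma exp_conv_measurable:
  assumes [measurable]: "g \<in> borel_measurable borel"
  shows "exp_conv b k g \<in> borel_measurable borel"
  unfolding exp_conv_def[abs_def] by measurable

lemma exp_conv_cmult: "exp_conv b k (\<lambda>y. c * g y) x = c * exp_conv b k g x"
  by (simp add: exp_conv_def mult.left_commute[of _ c])

lemma exp_conv_add:
  assumes "0 < Im k" "csq f" "csq g"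
  shows "exp_conv b k (\<lambda>y. f y + g y) x = exp_conv b k f x + exp_conv b k g x"
  unfolding exp_conv_def using exp_conv_integrable[OF assms(1,2)] exp_conv_integrable[OF assms(1,3)]
  by (simp add: distrib_left)

lemma exp_conv_cong:
  assumes "f \<in> borel_measurable borel" "g \<in> borel_measurable borel" "AE x in lborel. f x = g x"
  shows "exp_conv b k f = exp_conv b k g"
proof
  fix x
  have [measurable]: "f \<in> borel_measurable borel" "g \<in> borel_measurable borel" by fact+
  show "exp_conv b k f x = exp_conv b k g x"
    unfolding exp_conv_def
    by (rule integral_cong_AE, measurable) (use assms(3) in eventually_elim, simp)
qed

lemma cnj_exp_conv: "cnj (exp_conv b k g x) = exp_conv b (- cnj k) (\<lambda>y. cnj (g y)) x"
proof -
  have "cnj (exp_conv b k g x) = (LINT y|lborel. cnj (exp_ker b k (x - y) * g y))"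
    unfolding exp_conv_def by (rule Bochner_Integration.integral_cnj[symmetric])
  then show ?thesis by (simp add: exp_conv_def cnj_exp_ker)
qed

text \<open>Tonelli, as the kernel has total mass 1 / Im k in either variable. The weight in y
  serves the Schur test, and both weights together justify Fubini in the adjoint formula.\<close>

lemma nn_integral_exp_ker_double:
  assumes k: "0 < Im k" and g: "csq g"
  shows "(\<integral>\<^sup>+x. \<integral>\<^sup>+y. ennreal (cmod (exp_ker b k (x - y)) * (cmod (g y))\<^sup>2) \<partial>lborel \<partial>lborel) =
    ennreal (1 / Im k * (LINT x|lborel. (cmod (g x))\<^sup>2))"
    "(\<integral>\<^sup>+x. \<integral>\<^sup>+y. ennreal (cmod (exp_ker b k (x - y)) * (cmod (g x))\<^sup>2) \<partial>lborel \<partial>lborel) =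
    ennreal (1 / Im k * (LINT x|lborel. (cmod (g x))\<^sup>2))"
proof -
  have [measurable]: "g \<in> borel_measurable borel" using g by (simp add: csq_def)
  have e: "(\<integral>\<^sup>+y. ennreal (1 / Im k) * ennreal ((cmod (g y))\<^sup>2) \<partial>lborel) =
      ennreal (1 / Im k * (LINT x|lborel. (cmod (g x))\<^sup>2))"
  proof -
    have "(\<integral>\<^sup>+y. ennreal (1 / Im k) * ennreal ((cmod (g y))\<^sup>2) \<partial>lborel) =
        ennreal (1 / Im k) * ennreal (LINT x|lborel. (cmod (g x))\<^sup>2)"
      using g by (simp add: nn_integral_cmult nn_integral_eq_integral csq_def)
    also have "\<dots> = ennreal (1 / Im k * (LINT x|lborel. (cmod (g x))\<^sup>2))"
      by (rule ennreal_mult[symmetric]) (use k in auto)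
    finally show ?thesis .
  qed
  have "(\<integral>\<^sup>+x. \<integral>\<^sup>+y. ennreal (cmod (exp_ker b k (x - y)) * (cmod (g y))\<^sup>2) \<partial>lborel \<partial>lborel) =
    (\<integral>\<^sup>+y. \<integral>\<^sup>+x. ennreal (cmod (exp_ker b k (x - y)) * (cmod (g y))\<^sup>2) \<partial>lborel \<partial>lborel)"
    by (rule lborel_pair.Fubini') measurable
  also have "\<dots> = (\<integral>\<^sup>+y. ennreal (1 / Im k) * ennreal ((cmod (g y))\<^sup>2) \<partial>lborel)"
    by (simp add: ennreal_mult nn_integral_multc nn_integral_exp_ker_shift[OF k])
  finally show "(\<integral>\<^sup>+x. \<integral>\<^sup>+y. ennreal (cmod (exp_ker b k (x - y)) * (cmod (g y))\<^sup>2) \<partial>lborel \<partial>lborel) =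
    ennreal (1 / Im k * (LINT x|lborel. (cmod (g x))\<^sup>2))" using e by simp
  show "(\<integral>\<^sup>+x. \<integral>\<^sup>+y. ennreal (cmod (exp_ker b k (x - y)) * (cmod (g x))\<^sup>2) \<partial>lborel \<partial>lborel) =
    ennreal (1 / Im k * (LINT x|lborel. (cmod (g x))\<^sup>2))"
    using e by (simp add: ennreal_mult nn_integral_multc nn_integral_exp_ker_shift[OF k])
qed

text \<open>Young's inequality for an integrable kernel, in the form of the Schur test; the constant
  is the square of the mass of the kernel.\<close>

lemma exp_conv_csq:
  assumes k: "0 < Im k" and g: "csq g"
  shows "csq (exp_conv b k g)"
    "(LINT x|lborel. (cmod (exp_conv b k g x))\<^sup>2) \<le> (1 / Im k)\<^sup>2 * (LINT x|lborel. (cmod (g x))\<^sup>2)"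
proof -
  have [measurable]: "g \<in> borel_measurable borel" using g by (simp add: csq_def)
  have [measurable]: "exp_conv b k g \<in> borel_measurable borel" by (rule exp_conv_measurable) simp
  have pw: "(cmod (exp_conv b k g x))\<^sup>2 \<le>
      1 / Im k * (LINT y|lborel. cmod (exp_ker b k (x - y)) * (cmod (g y))\<^sup>2)"
    and int: "integrable lborel (\<lambda>y. cmod (exp_ker b k (x - y)) * (cmod (g y))\<^sup>2)" for x
  proof -
    \<comment> \<open>Writing the kernel as the product of two square roots, one of them kept with
      g, lets Cauchy--Schwarz produce the mass of the kernel as a factor.\<close>
    define s where "s y = sqrt (cmod (exp_ker b k (x - y)))" for y
    have [measurable]: "s \<in> borel_measurable borel" unfolding s_def[abs_def] by measurable
    have ss: "s y * (s y * c) = cmod (exp_ker b k (x - y)) * c" for y c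
      by (simp add: s_def flip: mult.assoc)
    have int1: "integrable lborel (\<lambda>y. (s y)\<^sup>2)"
      using integrable_norm_exp_ker[OF k] by (simp add: s_def)
    have gi: "integrable lborel (\<lambda>y. (cmod (g y))\<^sup>2)" using g by (simp add: csq_def)
    show int: "integrable lborel (\<lambda>y. cmod (exp_ker b k (x - y)) * (cmod (g y))\<^sup>2)"
      by (rule Bochner_Integration.integrable_bound[OF gi])
        (auto simp: norm_mult norm_exp_ker_le_1[OF k] mult_left_le_one_le)
    then have int2: "integrable lborel (\<lambda>y. (s y * cmod (g y))\<^sup>2)"
      by (simp add: s_def power_mult_distrib)
    have "cmod (exp_conv b k g x) \<le> (LINT y|lborel. s y * (s y * cmod (g y)))"
      unfolding exp_conv_def by (rule order_trans[OF integral_norm_bound]) (simp add: ss norm_mult)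
    then have "(cmod (exp_conv b k g x))\<^sup>2 \<le> (LINT y|lborel. s y * (s y * cmod (g y)))\<^sup>2"
      by (rule power_mono) simp
    also have "\<dots> \<le> (LINT y|lborel. (s y)\<^sup>2) * (LINT y|lborel. (s y * cmod (g y))\<^sup>2)"
      by (rule real_Cauchy_Schwarz_integral(2)[OF _ _ int1 int2]) measurable
    finally show "(cmod (exp_conv b k g x))\<^sup>2 \<le>
      1 / Im k * (LINT y|lborel. cmod (exp_ker b k (x - y)) * (cmod (g y))\<^sup>2)"
      by (simp add: s_def power_mult_distrib integrable_norm_exp_ker[OF k])
  qed
  have "(\<integral>\<^sup>+x. ennreal ((cmod (exp_conv b k g x))\<^sup>2) \<partial>lborel) \<le>
      (\<integral>\<^sup>+x. ennreal (1 / Im k) * (\<integral>\<^sup>+y. ennreal (cmod (exp_ker b k (x - y)) * (cmod (g y))\<^sup>2) \<partial>lborel) \<partial>lborel)"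
  proof (rule nn_integral_mono)
    fix x
    have "ennreal ((cmod (exp_conv b k g x))\<^sup>2) \<le>
        ennreal (1 / Im k * (LINT y|lborel. cmod (exp_ker b k (x - y)) * (cmod (g y))\<^sup>2))"
      by (rule ennreal_leI) (rule pw)
    then show "ennreal ((cmod (exp_conv b k g x))\<^sup>2) \<le> ennreal (1 / Im k) *
        (\<integral>\<^sup>+y. ennreal (cmod (exp_ker b k (x - y)) * (cmod (g y))\<^sup>2) \<partial>lborel)"
      by (subst nn_integral_eq_integral[OF int], simp, subst (asm) ennreal_mult) (use k in auto)
  qed
  also have "\<dots> = ennreal (1 / Im k) *
      (\<integral>\<^sup>+x. \<integral>\<^sup>+y. ennreal (cmod (exp_ker b k (x - y)) * (cmod (g y))\<^sup>2) \<partial>lborel \<partial>lborel)"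
    by (rule nn_integral_cmult) measurable
  also have "\<dots> = ennreal ((1 / Im k)\<^sup>2 * (LINT x|lborel. (cmod (g x))\<^sup>2))"
    unfolding nn_integral_exp_ker_double[OF k g] using k
    by (simp add: power2_eq_square flip: ennreal_mult)
  finally have bound: "(\<integral>\<^sup>+x. ennreal ((cmod (exp_conv b k g x))\<^sup>2) \<partial>lborel) \<le>
      ennreal ((1 / Im k)\<^sup>2 * (LINT x|lborel. (cmod (g x))\<^sup>2))" .
  have i: "integrable lborel (\<lambda>x. (cmod (exp_conv b k g x))\<^sup>2)"
    by (rule integrableI_bounded) (auto intro: le_less_trans[OF bound])
  then show "csq (exp_conv b k g)" by (simp add: csq_def)
  show "(LINT x|lborel. (cmod (exp_conv b k g x))\<^sup>2) \<le> (1 / Im k)\<^sup>2 * (LINT x|lborel. (cmod (g x))\<^sup>2)"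
    using bound by (subst (asm) nn_integral_eq_integral[OF i]) (auto simp: ennreal_le_iff)
qed

text \<open>Transposing the kernel replaces t by - t and hence exchanges the two sides. The pairing
  is bilinear, without conjugation, so k stays the same. Fubini applies because |g(y) h(x)| is at
  most the sum of the two squares.\<close>

lemma exp_conv_adjoint:
  assumes k: "0 < Im k" and g: "csq g" and h: "csq h"
  shows "(LINT x|lborel. exp_conv b k g x * h x) = (LINT y|lborel. g y * exp_conv (\<not> b) k h y)"
proof -
  have [measurable]: "g \<in> borel_measurable borel" "h \<in> borel_measurable borel"
    using g h by (auto simp: csq_def)
  define f where "f x y = exp_ker b k (x - y) * g y * h x" for x y
  have f: "integrable (lborel \<Otimes>\<^sub>M lborel) (\<lambda>(x, y). f x y)"
  proof (rule integrableI_bounded)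
    show "(\<lambda>(x, y). f x y) \<in> borel_measurable (lborel \<Otimes>\<^sub>M lborel)"
      unfolding f_def by measurable
    have pw: "cmod (f x y) \<le> cmod (exp_ker b k (x - y)) * (cmod (g y))\<^sup>2 +
        cmod (exp_ker b k (x - y)) * (cmod (h x))\<^sup>2" for x y
    proof -
      have "cmod (g y) * cmod (h x) \<le> (cmod (g y))\<^sup>2 + (cmod (h x))\<^sup>2"
        using sum_squares_bound[of "cmod (g y)" "cmod (h x)"]
          mult_nonneg_nonneg[OF norm_ge_zero[of "g y"] norm_ge_zero[of "h x"]] by linarith
      from mult_left_mono[OF this norm_ge_zero[of "exp_ker b k (x - y)"]]
      show ?thesis by (simp add: f_def norm_mult algebra_simps)
    qed
    have "(\<integral>\<^sup>+z. ennreal (norm (case z of (x, y) \<Rightarrow> f x y)) \<partial>(lborel \<Otimes>\<^sub>M lborel)) =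
        (\<integral>\<^sup>+x. \<integral>\<^sup>+y. ennreal (cmod (f x y)) \<partial>lborel \<partial>lborel)"
    proof (subst lborel.nn_integral_fst[symmetric])
      show "(\<lambda>z. ennreal (norm (case z of (x, y) \<Rightarrow> f x y))) \<in> borel_measurable (lborel \<Otimes>\<^sub>M lborel)"
        unfolding f_def by measurable
    qed simp
    also have "\<dots> \<le> (\<integral>\<^sup>+x. \<integral>\<^sup>+y. ennreal (cmod (exp_ker b k (x - y)) * (cmod (g y))\<^sup>2) +
        ennreal (cmod (exp_ker b k (x - y)) * (cmod (h x))\<^sup>2) \<partial>lborel \<partial>lborel)"
      by (intro nn_integral_mono) (use pw in \<open>simp flip: ennreal_plus\<close>)
    also have "\<dots> = ennreal (1 / Im k * (LINT x|lborel. (cmod (g x))\<^sup>2)) +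
        ennreal (1 / Im k * (LINT x|lborel. (cmod (h x))\<^sup>2))"
      by (simp add: nn_integral_add nn_integral_exp_ker_double[OF k g] nn_integral_exp_ker_double[OF k h])
    also have "\<dots> < \<infinity>" by simp
    finally show "(\<integral>\<^sup>+z. ennreal (norm (case z of (x, y) \<Rightarrow> f x y)) \<partial>(lborel \<Otimes>\<^sub>M lborel)) < \<infinity>" .
  qed
  have "(LINT x|lborel. exp_conv b k g x * h x) = (LINT x|lborel. LINT y|lborel. f x y)"
    by (simp add: exp_conv_def f_def)
  also have "\<dots> = (LINT y|lborel. LINT x|lborel. f x y)"
    by (rule lborel_pair.Fubini_integral[OF f, symmetric])
  also have "\<dots> = (LINT y|lborel. g y * exp_conv (\<not> b) k h y)"
  proof (rule Bochner_Integration.integral_cong[OF refl])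
    fix y
    have "f x y = g y * (exp_ker (\<not> b) k (y - x) * h x)" for x
      using exp_ker_minus[of b k "y - x"] by (simp add: f_def)
    then show "(LINT x|lborel. f x y) = g y * exp_conv (\<not> b) k h y"
      by (simp add: exp_conv_def)
  qed
  finally show ?thesis .
qed

lemma csq_set_integrable:
  assumes "csq g"
  shows "set_integrable lborel {a..b} g"
proof -
  have "indicator {a..b} x *\<^sub>R g x = indicator {a..b} x * g x" for x
    by (simp add: indicator_def)
  then show ?thesis
    using csq_integrable_mult[OF csq_indicator[of a b] assms] by (simp add: set_integrable_def)
qed

lemma csq_has_integral: "csq g \<Longrightarrow> (g has_integral (LINT x:{a..b}|lborel. g x)) {a..b}"
  using set_borel_integral_eq_integral[OF csq_set_integrable, of g a b] by (simp add: has_integral_iff)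

text \<open>The left-hand side is the integral of \<i> k exp (\<i> k (x - y)) over the part of
  [a, b] to the right of y, evaluated by the fundamental theorem of calculus. At y = b the formula
  would depend on the value of the kernel at 0; the endpoints are a null set for the later
  integration in y.\<close>

lemma exp_conv_indicator:
  assumes "k \<noteq> 0" "a \<le> b" "y \<noteq> a" "y \<noteq> b"
  shows "\<i> * k * exp_conv False k (indicator {a..b}) y =
    exp_ker True k (b - y) - exp_ker True k (a - y) - indicator {a..b} y"
proof -
  define c where "c = max a y"
  define F where "F x = exp (\<i> * k * of_real (x - y)) / (\<i> * k)" for x
  have F: "(F has_vector_derivative exp (\<i> * k * of_real (x - y))) (at x within S)" for x S
  proof -
    have "((\<lambda>z. exp (\<i> * k * (z - of_real y)) / (\<i> * k)) has_field_derivative exp (\<i> * k * (of_real x - of_real y)))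
        (at (of_real x))"
      using assms by (auto intro!: derivative_eq_intros)
    from has_vector_derivative_real_field[OF this, of S] show ?thesis by (simp add: F_def[abs_def])
  qed
  have e: "exp_conv False k (indicator {a..b}) y =
      (LINT x|lborel. indicator {c..b} x *\<^sub>R exp (\<i> * k * of_real (x - y)))"
    unfolding exp_conv_def
    by (rule integral_cong_AE, measurable, use AE_lborel_singleton[of y] in eventually_elim)
      (auto simp: exp_ker_def indicator_def c_def)
  show ?thesis
  proof (cases "c \<le> b")
    case True
    have "has_bochner_integral lborel (\<lambda>x. indicator {c..b} x *\<^sub>R exp (\<i> * k * of_real (x - y))) (F b - F c)"
      by (rule has_bochner_integral_FTC_Icc[OF True F]) (auto intro!: continuous_intros)
    then have "exp_conv False k (indicator {a..b}) y = F b - F c"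
      unfolding e by (simp add: has_bochner_integral_iff)
    then show ?thesis using assms True
      by (auto simp: F_def c_def exp_ker_def max_def field_simps split: if_splits)
  next
    case False
    then have "exp_conv False k (indicator {a..b}) y = 0" unfolding e by simp
    then show ?thesis using assms False by (auto simp: c_def exp_ker_def max_def split: if_splits)
  qed
qed

text \<open>The integrated form of F' = g + \<i> k F for the one-sided convolution F. No derivative
  of F is taken: the integral of F over [a, b] is its pairing with an indicator function, and the
  adjoint formula moves the convolution onto the indicator, where it is explicit.\<close>

lemma exp_conv_True_integral:
  assumes k: "0 < Im k" and g: "csq g" and ab: "a \<le> b"
  shows "((\<lambda>x. g x + \<i> * k * exp_conv True k g x) has_integral
    (exp_conv True k g b - exp_conv True k g a)) {a..b}"
proof -
  have [measurable]: "g \<in> borel_measurable borel" using g by (simp add: csq_def)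
  have [measurable]: "exp_conv True k g \<in> borel_measurable borel" by (rule exp_conv_measurable) simp
  have [measurable]: "exp_conv False k (indicator {a..b}) \<in> borel_measurable borel" by (rule exp_conv_measurable) simp
  note S = exp_conv_csq(1)[OF k g, of True]
  have k0: "k \<noteq> 0" using k by auto
  have "csq (\<lambda>x. g x + \<i> * k * exp_conv True k g x)" by (intro csq_add csq_cmult g S)
  from csq_has_integral[OF this, of a b]
  have "((\<lambda>x. g x + \<i> * k * exp_conv True k g x) has_integral
      (LINT x:{a..b}|lborel. g x) + \<i> * k * (LINT x:{a..b}|lborel. exp_conv True k g x)) {a..b}"
    using csq_set_integrable[OF g, of a b] csq_set_integrable[OF S, of a b]
    by (simp add: set_integral_add)
  also have "(LINT x:{a..b}|lborel. exp_conv True k g x) =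
      (LINT x|lborel. exp_conv True k g x * indicator {a..b} x)"
    unfolding set_lebesgue_integral_def
    by (rule Bochner_Integration.integral_cong) (auto simp: indicator_def)
  also have "\<dots> = (LINT y|lborel. g y * exp_conv False k (indicator {a..b}) y)"
    using exp_conv_adjoint[OF k g csq_indicator[of a b], of True] by simp
  also have "\<i> * k * \<dots> = (LINT y|lborel. exp_ker True k (b - y) * g y - exp_ker True k (a - y) * g y -
      indicator {a..b} y * g y)"
    unfolding integral_mult_right_zero[symmetric]
  proof (rule integral_cong_AE)
    show "AE y in lborel. \<i> * k * (g y * exp_conv False k (indicator {a..b}) y) =
        exp_ker True k (b - y) * g y - exp_ker True k (a - y) * g y - indicator {a..b} y * g y"
      using AE_lborel_singleton[of a] AE_lborel_singleton[of b]
    proof eventually_elim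
      case (elim y)
      have "\<i> * k * (g y * exp_conv False k (indicator {a..b}) y) =
          (\<i> * k * exp_conv False k (indicator {a..b}) y) * g y" by (simp add: mult_ac)
      then show ?case unfolding exp_conv_indicator[OF k0 ab elim] by (simp add: algebra_simps)
    qed
  qed measurable
  also have "\<dots> = exp_conv True k g b - exp_conv True k g a - (LINT x:{a..b}|lborel. g x)"
  proof -
    have "(LINT x:{a..b}|lborel. g x) = (LINT y|lborel. indicator {a..b} y * g y)"
      unfolding set_lebesgue_integral_def
      by (rule Bochner_Integration.integral_cong) (auto simp: indicator_def)
    then show ?thesis
      using exp_conv_integrable[OF k g] csq_integrable_mult[OF csq_indicator g]
      by (simp add: exp_conv_def)
  qed
  finally show ?thesis by simp
qed

lemma exp_conv_reflect: "exp_conv False k g x = exp_conv True k (\<lambda>y. g (- y)) (- x)"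
proof -
  have e: "exp_ker False k (x + y) = exp_ker True k (- x - y)" for y
    using exp_ker_minus[of True k "x + y"] by simp
  show ?thesis
    unfolding exp_conv_def
    by (subst lborel_integral_real_affine[where c = "-1" and t = 0]) (simp_all add: e)
qed

text \<open>Reflection of the line exchanges the two kernels and reverses the sign of the
  derivative.\<close>

lemma exp_conv_False_integral:
  assumes k: "0 < Im k" and g: "csq g" and ab: "a \<le> b"
  shows "((\<lambda>x. - g x - \<i> * k * exp_conv False k g x) has_integral
    (exp_conv False k g b - exp_conv False k g a)) {a..b}"
proof -
  have "((\<lambda>x. g (- x) + \<i> * k * exp_conv True k (\<lambda>y. g (- y)) x) has_integral
    (exp_conv True k (\<lambda>y. g (- y)) (- a) - exp_conv True k (\<lambda>y. g (- y)) (- b))) {- b.. - a}"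
    by (rule exp_conv_True_integral[OF k csq_reflect[OF g]]) (use ab in simp)
  then have "((\<lambda>x. g x + \<i> * k * exp_conv False k g x) has_integral
    (exp_conv False k g a - exp_conv False k g b)) {a..b}"
    by (subst (asm) has_integral_reflect_real[symmetric]) (simp add: exp_conv_reflect)
  from has_integral_neg[OF this] show ?thesis by simp
qed

section \<open>The free Dirac operator\<close>

lemma norm_vec2: "(norm (v :: complex^2))\<^sup>2 = (cmod (v $ 1))\<^sup>2 + (cmod (v $ 2))\<^sup>2"
  by (simp add: norm_vec_def L2_set_def sum_2)

lemma inner_vec2: "(v :: complex^2) \<bullet> w = Re (v $ 1 * cnj (w $ 1) + v $ 2 * cnj (w $ 2))"
  by (simp add: inner_vec_def sum_2 inner_complex_def)

lemma vec2_eq_iff: "(v :: complex^2) = w \<longleftrightarrow> v $ 1 = w $ 1 \<and> v $ 2 = w $ 2"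
  by (auto simp: vec_eq_iff forall_2)

lemma vec2_decompose: "(v :: complex^2) = v $ 1 *s axis 1 1 + v $ 2 *s axis 2 1"
  by (simp add: vec2_eq_iff axis_def)

lemma bounded_linear_smult_axis: "bounded_linear (\<lambda>c. c *s axis i 1 :: complex^2)"
proof (rule bounded_linear_intro[where K = 1])
  show "norm (c *s axis i 1 :: complex^2) \<le> norm c * 1" for c
    by (simp add: norm_vector_smult)
qed (simp_all add: vec_eq_iff axis_def ring_distribs)

lemma measurable_vec2:
  fixes f :: "real \<Rightarrow> complex^2"
  shows "f \<in> borel_measurable borel \<longleftrightarrow>
    (\<lambda>x. f x $ 1) \<in> borel_measurable borel \<and> (\<lambda>x. f x $ 2) \<in> borel_measurable borel"
proof
  assume [measurable]: "f \<in> borel_measurable borel"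
  have [measurable]: "(\<lambda>v :: complex^2. v $ i) \<in> borel_measurable borel" for i
    by (intro borel_measurable_continuous_onI continuous_intros)
  show "(\<lambda>x. f x $ 1) \<in> borel_measurable borel \<and> (\<lambda>x. f x $ 2) \<in> borel_measurable borel"
    by measurable
next
  assume A: "(\<lambda>x. f x $ 1) \<in> borel_measurable borel \<and> (\<lambda>x. f x $ 2) \<in> borel_measurable borel"
  have M: "(\<lambda>c. c *s axis i 1 :: complex^2) \<in> borel_measurable borel" for i
    by (intro borel_measurable_continuous_onI linear_continuous_on bounded_linear_smult_axis)
  have "(\<lambda>x. f x $ 1 *s axis 1 1 + f x $ 2 *s axis 2 1 :: complex^2) \<in> borel_measurable borel"
    using A by (auto intro!: borel_measurable_add measurable_compose[OF _ M])
  then show "f \<in> borel_measurable borel" by (simp flip: vec2_decompose)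
qed

lemma sq_int_iff_csq: "sq_int f \<longleftrightarrow> csq (\<lambda>x. f x $ 1) \<and> csq (\<lambda>x. f x $ 2)"
proof
  assume f: "sq_int f"
  then have [measurable]: "(\<lambda>x. f x $ 1) \<in> borel_measurable borel" "(\<lambda>x. f x $ 2) \<in> borel_measurable borel"
    by (auto simp: sq_int_def measurable_vec2)
  have i: "integrable lborel (\<lambda>x. (cmod (f x $ 1))\<^sup>2 + (cmod (f x $ 2))\<^sup>2)"
    using f by (simp add: sq_int_def norm_vec2)
  show "csq (\<lambda>x. f x $ 1) \<and> csq (\<lambda>x. f x $ 2)"
    unfolding csq_def
  proof (intro conjI)
    show "integrable lborel (\<lambda>x. (cmod (f x $ 1))\<^sup>2)" "integrable lborel (\<lambda>x. (cmod (f x $ 2))\<^sup>2)"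
      by (rule Bochner_Integration.integrable_bound[OF i]; simp)+
  qed measurable
qed (auto simp: sq_int_def csq_def norm_vec2 measurable_vec2)

lemma csq_rep: "csq (\<lambda>x. rep_l2 f x $ 1)" "csq (\<lambda>x. rep_l2 f x $ 2)"
  using sq_int_rep[of f] by (auto simp: sq_int_iff_csq)

lemma rep_nth_measurable [measurable]:
  "(\<lambda>x. rep_l2 f x $ 1) \<in> borel_measurable borel" "(\<lambda>x. rep_l2 f x $ 2) \<in> borel_measurable borel"
  using csq_rep[of f] by (simp_all add: csq_def)

lemma norm_l2_components:
  "(norm f)\<^sup>2 = (LINT x|lborel. (cmod (rep_l2 f x $ 1))\<^sup>2) + (LINT x|lborel. (cmod (rep_l2 f x $ 2))\<^sup>2)"
  unfolding norm_l2_integral norm_vec2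
  using csq_rep[of f] by (subst Bochner_Integration.integral_add) (auto simp: csq_def)

lemma inner_l2_components:
  assumes "sq_int u" "sq_int v" "AE x in lborel. rep_l2 f x = u x" "AE x in lborel. rep_l2 g x = v x"
  shows "inner f g = Re ((LINT x|lborel. u x $ 1 * cnj (v x $ 1)) + (LINT x|lborel. u x $ 2 * cnj (v x $ 2)))"
proof -
  have c: "csq (\<lambda>x. u x $ 1)" "csq (\<lambda>x. u x $ 2)" "csq (\<lambda>x. cnj (v x $ 1))" "csq (\<lambda>x. cnj (v x $ 2))"
    using assms by (auto simp: sq_int_iff_csq intro: csq_cnj)
  have [measurable]: "u \<in> borel_measurable borel" "v \<in> borel_measurable borel"
    using assms by (auto simp: sq_int_def)
  have "inner f g = (LINT x|lborel. u x \<bullet> v x)"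
    unfolding inner_l2_integral
    by (rule integral_cong_AE, measurable) (use assms(3,4) in eventually_elim, simp)
  also have "\<dots> = Re (LINT x|lborel. u x $ 1 * cnj (v x $ 1) + u x $ 2 * cnj (v x $ 2))"
    unfolding inner_vec2
    by (rule integral_Re) (intro Bochner_Integration.integrable_add csq_integrable_mult c)
  also have "(LINT x|lborel. u x $ 1 * cnj (v x $ 1) + u x $ 2 * cnj (v x $ 2)) =
      (LINT x|lborel. u x $ 1 * cnj (v x $ 1)) + (LINT x|lborel. u x $ 2 * cnj (v x $ 2))"
    by (intro Bochner_Integration.integral_add csq_integrable_mult c)
  finally show ?thesis .
qed

lemma inner_scaleC_left: "inner (c *\<^sub>C f) g = inner f (cnj c *\<^sub>C g)"
proof -
  have "inner (c *\<^sub>C f) g = (LINT x|lborel. (c *s rep_l2 f x) \<bullet> rep_l2 g x)"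
    unfolding inner_l2_integral
    by (rule integral_cong_AE)
      (use sq_int_smult[OF sq_int_rep[of f], of c] rep_scaleC[of c f] in \<open>auto simp: sq_int_def\<close>)
  also have "\<dots> = (LINT x|lborel. rep_l2 f x \<bullet> (cnj c *s rep_l2 g x))"
    by (simp add: inner_vec2 algebra_simps)
  also have "\<dots> = inner f (cnj c *\<^sub>C g)"
    unfolding inner_l2_integral
    by (rule integral_cong_AE)
      (use sq_int_smult[OF sq_int_rep[of g], of "cnj c"] rep_scaleC[of "cnj c" g] in \<open>auto simp: sq_int_def\<close>)
  finally show ?thesis .
qed

lemma has_integral_vec2:
  fixes f :: "real \<Rightarrow> complex^2"
  shows "(f has_integral I) S \<longleftrightarrow>
    ((\<lambda>x. f x $ 1) has_integral I $ 1) S \<and> ((\<lambda>x. f x $ 2) has_integral I $ 2) S"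
proof
  assume "(f has_integral I) S"
  from has_integral_linear[OF this bounded_linear_vec_nth]
  show "((\<lambda>x. f x $ 1) has_integral I $ 1) S \<and> ((\<lambda>x. f x $ 2) has_integral I $ 2) S"
    by (simp add: comp_def)
next
  assume A: "((\<lambda>x. f x $ 1) has_integral I $ 1) S \<and> ((\<lambda>x. f x $ 2) has_integral I $ 2) S"
  from has_integral_linear[OF conjunct1[OF A] bounded_linear_smult_axis[of 1]]
    has_integral_linear[OF conjunct2[OF A] bounded_linear_smult_axis[of 2]]
  have "((\<lambda>x. f x $ 1 *s axis 1 1 + f x $ 2 *s axis 2 1 :: complex^2) has_integral I $ 1 *s axis 1 1 + I $ 2 *s axis 2 1) S"
    by (intro has_integral_add) (simp_all add: comp_def)
  then show "(f has_integral I) S" by (simp flip: vec2_decompose)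
qed

section \<open>The derivative and the free Dirac operator as complex linear graphs\<close>

lemma has_integral_AE_cong:
  fixes f g :: "real \<Rightarrow> 'a :: euclidean_space"
  assumes "AE x in lborel. f x = g x"
  shows "(f has_integral I) S \<longleftrightarrow> (g has_integral I) S"
proof -
  obtain N where N: "N \<in> null_sets lborel" "\<And>x. x \<notin> N \<Longrightarrow> f x = g x"
    using assms unfolding eventually_ae_filter by auto
  then have "negligible N"
    by (simp add: negligible_iff_null_sets null_sets_completionI)
  then show ?thesis using N(2) by (intro has_integral_spike_eq) auto
qed

abbreviation dirac_eq :: "real \<Rightarrow> complex^2 \<Rightarrow> complex^2 \<Rightarrow> complex^2 \<Rightarrow> bool" where
  "dirac_eq m g f' f \<equiv> g $ 1 = - \<i> * f' $ 2 + of_real m * f $ 1 \<and> g $ 2 = - \<i> * f' $ 1 - of_real m * f $ 2"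

lemma free_dirac_iff:
  "(f, g) \<in> free_dirac m \<longleftrightarrow>
    (\<exists>f'. (f, f') \<in> deriv_op \<and> (AE x in lborel.
      dirac_eq m (rep_l2 g x) (rep_l2 f' x) (rep_l2 f x)))"
proof -
  have "v = (- \<i>) *s (sigma1 *v w) + complex_of_real m *s (sigma3 *v u) \<longleftrightarrow>
      v $ 1 = - \<i> * w $ 2 + of_real m * u $ 1 \<and> v $ 2 = - \<i> * w $ 1 - of_real m * u $ 2" for u v w
    by (simp add: vec2_eq_iff sigma1_def sigma3_def matrix_vector_mult_def sum_2)
      (simp add: minus_diff_commute)
  then show ?thesis by (simp only: free_dirac_def mem_Collect_eq case_prod_conv)
qed

lemma deriv_op_add:
  assumes "(f, f') \<in> deriv_op" "(g, g') \<in> deriv_op"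
  shows "(f + g, f' + g') \<in> deriv_op"
proof -
  from assms obtain F G where F: "AE x in lborel. rep_l2 f x = F x"
      "\<And>a b. a \<le> b \<Longrightarrow> (rep_l2 f' has_integral (F b - F a)) {a..b}"
    and G: "AE x in lborel. rep_l2 g x = G x"
      "\<And>a b. a \<le> b \<Longrightarrow> (rep_l2 g' has_integral (G b - G a)) {a..b}"
    unfolding deriv_op_def by auto
  have "AE x in lborel. rep_l2 (f + g) x = F x + G x"
    using F(1) G(1) rep_plus[of f g] by eventually_elim simp
  moreover have "(rep_l2 (f' + g') has_integral ((F b + G b) - (F a + G a))) {a..b}" if "a \<le> b" for a b
    unfolding has_integral_AE_cong[OF rep_plus]
    using has_integral_add[OF F(2)[OF that] G(2)[OF that]] by (simp add: algebra_simps)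
  ultimately show ?thesis unfolding deriv_op_def by (auto intro!: exI[of _ "\<lambda>x. F x + G x"])
qed

lemma deriv_op_scaleC:
  assumes "(f, f') \<in> deriv_op"
  shows "(c *\<^sub>C f, c *\<^sub>C f') \<in> deriv_op"
proof -
  from assms obtain F where F: "AE x in lborel. rep_l2 f x = F x"
      "\<And>a b. a \<le> b \<Longrightarrow> (rep_l2 f' has_integral (F b - F a)) {a..b}"
    unfolding deriv_op_def by auto
  have "AE x in lborel. rep_l2 (c *\<^sub>C f) x = c *s F x"
    using F(1) rep_scaleC[of c f] by eventually_elim simp
  moreover have "(rep_l2 (c *\<^sub>C f') has_integral (c *s F b - c *s F a)) {a..b}" if "a \<le> b" for a b
    unfolding has_integral_AE_cong[OF rep_scaleC]
    using F(2)[OF that] has_integral_mult_right[of _ _ "{a..b}" c]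
    by (simp add: has_integral_vec2 flip: right_diff_distrib)
  ultimately show ?thesis unfolding deriv_op_def by (auto intro!: exI[of _ "\<lambda>x. c *s F x"])
qed

lemma free_dirac_add:
  assumes "(f, g) \<in> free_dirac m" "(f1, g1) \<in> free_dirac m"
  shows "(f + f1, g + g1) \<in> free_dirac m"
proof -
  from assms obtain f' f1' where d: "(f, f') \<in> deriv_op" "(f1, f1') \<in> deriv_op"
    and a: "AE x in lborel. dirac_eq m (rep_l2 g x) (rep_l2 f' x) (rep_l2 f x)"
      "AE x in lborel. dirac_eq m (rep_l2 g1 x) (rep_l2 f1' x) (rep_l2 f1 x)"
    unfolding free_dirac_iff by auto
  have "AE x in lborel. dirac_eq m (rep_l2 (g + g1) x) (rep_l2 (f' + f1') x) (rep_l2 (f + f1) x)"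
    using a rep_plus[of g g1] rep_plus[of f' f1'] rep_plus[of f f1]
    by eventually_elim (simp add: algebra_simps)
  then show ?thesis unfolding free_dirac_iff using deriv_op_add[OF d] by blast
qed

lemma free_dirac_scaleC:
  assumes "(f, g) \<in> free_dirac m"
  shows "(c *\<^sub>C f, c *\<^sub>C g) \<in> free_dirac m"
proof -
  from assms obtain f' where d: "(f, f') \<in> deriv_op"
    and a: "AE x in lborel. dirac_eq m (rep_l2 g x) (rep_l2 f' x) (rep_l2 f x)"
    unfolding free_dirac_iff by auto
  have "AE x in lborel. dirac_eq m (rep_l2 (c *\<^sub>C g) x) (rep_l2 (c *\<^sub>C f') x) (rep_l2 (c *\<^sub>C f) x)"
    using a rep_scaleC[of c g] rep_scaleC[of c f'] rep_scaleC[of c f]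
  proof eventually_elim
    case (elim x)
    then show ?case by (simp add: ring_distribs mult.left_commute[of c])
  qed
  then show ?thesis unfolding free_dirac_iff using deriv_op_scaleC[OF d] by blast
qed

lemma free_dirac_diff:
  assumes "(f, g) \<in> free_dirac m" "(f1, g1) \<in> free_dirac m"
  shows "(f - f1, g - g1) \<in> free_dirac m"
  using free_dirac_add[OF assms(1) free_dirac_scaleC[OF assms(2), of "-1"]]
  by (simp add: scaleC_minus_one)

text \<open>The free resolvent is convolution with the Green matrix
  \<open>(\<i> / 2) [[\<zeta>, sgn t], [sgn t, 1 / \<zeta>]] exp (\<i> k \<bar>t\<bar>)\<close>, where \<open>k\<^sup>2 = z\<^sup>2 - m\<^sup>2\<close> and
  \<open>\<zeta> = (z + m) / k = k / (z - m)\<close>.\<close>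

definition green_conv :: "complex \<Rightarrow> complex \<Rightarrow> (real \<Rightarrow> complex^2) \<Rightarrow> real \<Rightarrow> complex^2" where
  "green_conv k \<zeta> g x =
    (let p = (\<lambda>j. exp_conv True k (\<lambda>y. g y $ j) x); q = (\<lambda>j. exp_conv False k (\<lambda>y. g y $ j) x)
     in vector [\<i> / 2 * (\<zeta> * (p 1 + q 1) + (p 2 - q 2)), \<i> / 2 * ((p 1 - q 1) + (p 2 + q 2) / \<zeta>)])"

lemma green_conv_nth:
  "green_conv k \<zeta> g x $ 1 = \<i> / 2 * (\<zeta> * (exp_conv True k (\<lambda>y. g y $ 1) x + exp_conv False k (\<lambda>y. g y $ 1) x) +
    (exp_conv True k (\<lambda>y. g y $ 2) x - exp_conv False k (\<lambda>y. g y $ 2) x))"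
  "green_conv k \<zeta> g x $ 2 = \<i> / 2 * ((exp_conv True k (\<lambda>y. g y $ 1) x - exp_conv False k (\<lambda>y. g y $ 1) x) +
    (exp_conv True k (\<lambda>y. g y $ 2) x + exp_conv False k (\<lambda>y. g y $ 2) x) / \<zeta>)"
  by (simp_all add: green_conv_def Let_def)

definition green_op :: "complex \<Rightarrow> complex \<Rightarrow> l2 \<Rightarrow> l2" where
  "green_op k \<zeta> g = abs_l2 (green_conv k \<zeta> (rep_l2 g))"

lemma green_conv_sq_int:
  assumes k: "0 < Im k" and g: "sq_int g"
  shows "sq_int (green_conv k \<zeta> g)"
proof -
  have c: "csq (\<lambda>y. g y $ 1)" "csq (\<lambda>y. g y $ 2)" using g by (auto simp: sq_int_iff_csq)
  note S = exp_conv_csq(1)[OF k c(1)] exp_conv_csq(1)[OF k c(2)]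
  show ?thesis
    unfolding sq_int_iff_csq green_conv_nth divide_inverse mult.commute[of _ "inverse \<zeta>"]
    by (intro conjI csq_cmult csq_add csq_diff S)
qed

lemma rep_green_op:
  "0 < Im k \<Longrightarrow> AE x in lborel. rep_l2 (green_op k \<zeta> g) x = green_conv k \<zeta> (rep_l2 g) x"
  unfolding green_op_def by (rule rep_abs_l2, rule green_conv_sq_int, assumption, rule sq_int_rep)

lemma green_conv_cong:
  assumes "f \<in> borel_measurable borel" "g \<in> borel_measurable borel" "AE x in lborel. f x = g x"
  shows "green_conv k \<zeta> f = green_conv k \<zeta> g"
proof -
  have "exp_conv b k (\<lambda>y. f y $ j) = exp_conv b k (\<lambda>y. g y $ j)" if "j = 1 \<or> j = 2" for b j
    using assms that by (intro exp_conv_cong) (auto simp: measurable_vec2)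
  then show ?thesis by (simp add: fun_eq_iff green_conv_def Let_def)
qed

lemma green_op_add:
  assumes k: "0 < Im k"
  shows "green_op k \<zeta> (f + g) = green_op k \<zeta> f + green_op k \<zeta> g"
proof (rule l2_eqI)
  have e1: "green_conv k \<zeta> (rep_l2 (f + g)) = green_conv k \<zeta> (\<lambda>x. rep_l2 f x + rep_l2 g x)"
    by (rule green_conv_cong) (measurable, rule rep_plus)
  have e2: "green_conv k \<zeta> (\<lambda>x. rep_l2 f x + rep_l2 g x) x =
      green_conv k \<zeta> (rep_l2 f) x + green_conv k \<zeta> (rep_l2 g) x" for x
    by (simp add: vec2_eq_iff green_conv_nth exp_conv_add[OF k] csq_rep ring_distribs
        diff_divide_distrib add_divide_distrib)
  show "AE x in lborel. rep_l2 (green_op k \<zeta> (f + g)) x = rep_l2 (green_op k \<zeta> f + green_op k \<zeta> g) x"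
    using rep_green_op[OF k, of \<zeta> "f + g"] rep_green_op[OF k, of \<zeta> f] rep_green_op[OF k, of \<zeta> g]
      rep_plus[of "green_op k \<zeta> f" "green_op k \<zeta> g"]
    by eventually_elim (simp add: e1 e2)
qed

lemma green_op_scaleC:
  assumes k: "0 < Im k"
  shows "green_op k \<zeta> (c *\<^sub>C f) = c *\<^sub>C green_op k \<zeta> f"
proof (rule l2_eqI)
  have e1: "green_conv k \<zeta> (rep_l2 (c *\<^sub>C f)) = green_conv k \<zeta> (\<lambda>x. c *s rep_l2 f x)"
    using sq_int_smult[OF sq_int_rep[of f], of c]
    by (intro green_conv_cong rep_scaleC) (measurable, simp add: sq_int_def)
  have e2: "green_conv k \<zeta> (\<lambda>x. c *s rep_l2 f x) x = c *s green_conv k \<zeta> (rep_l2 f) x" for x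
    by (simp add: vec2_eq_iff green_conv_nth exp_conv_cmult algebra_simps)
  show "AE x in lborel. rep_l2 (green_op k \<zeta> (c *\<^sub>C f)) x = rep_l2 (c *\<^sub>C green_op k \<zeta> f) x"
    using rep_green_op[OF k, of \<zeta> "c *\<^sub>C f"] rep_green_op[OF k, of \<zeta> f] rep_scaleC[of c "green_op k \<zeta> f"]
    by eventually_elim (simp add: e1 e2)
qed

text \<open>This serves boundedness alone, so the constant is crude: the sum of |\<zeta>|, 1 and 1 /
  |\<zeta>| dominates each coefficient of the Green matrix, and each of the four scalar convolutions
  is bounded by 1 / Im k.\<close>

lemma norm_green_op:
  assumes k: "0 < Im k"
  shows "(norm (green_op k \<zeta> g))\<^sup>2 \<le> 4 * ((cmod \<zeta> + 1 + 1 / cmod \<zeta>) / Im k)\<^sup>2 * (norm g)\<^sup>2"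
proof -
  define S where "S = cmod \<zeta> + 1 + 1 / cmod \<zeta>"
  define P where "P b j = exp_conv b k (\<lambda>y. rep_l2 g y $ j)" for b j
  define n where "n j = (LINT x|lborel. (cmod (rep_l2 g x $ j))\<^sup>2)" for j
  define \<sigma> where "\<sigma> x = (cmod (P True 1 x))\<^sup>2 + (cmod (P False 1 x))\<^sup>2 +
    (cmod (P True 2 x))\<^sup>2 + (cmod (P False 2 x))\<^sup>2" for x
  have iP: "integrable lborel (\<lambda>x. (cmod (P b 1 x))\<^sup>2)" "integrable lborel (\<lambda>x. (cmod (P b 2 x))\<^sup>2)" for b
    using exp_conv_csq(1)[OF k csq_rep(1)] exp_conv_csq(1)[OF k csq_rep(2)]
    by (auto simp: csq_def P_def)
  have NP: "(LINT x|lborel. (cmod (P b 1 x))\<^sup>2) \<le> (1 / Im k)\<^sup>2 * n 1"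
    "(LINT x|lborel. (cmod (P b 2 x))\<^sup>2) \<le> (1 / Im k)\<^sup>2 * n 2" for b
    unfolding P_def n_def by (intro exp_conv_csq k csq_rep)+
  have i\<sigma>: "integrable lborel \<sigma>" unfolding \<sigma>_def[abs_def] using iP by simp
  have "integral\<^sup>L lborel \<sigma> \<le> 2 * (1 / Im k)\<^sup>2 * (n 1 + n 2)"
    using NP(1)[of True] NP(1)[of False] NP(2)[of True] NP(2)[of False] iP
    unfolding \<sigma>_def[abs_def] by (simp add: algebra_simps)
  then have \<sigma>: "integral\<^sup>L lborel \<sigma> \<le> 2 * (1 / Im k)\<^sup>2 * (norm g)\<^sup>2"
    by (simp add: norm_l2_components n_def)
  have pw: "(norm (green_conv k \<zeta> (rep_l2 g) x))\<^sup>2 \<le> 2 * S\<^sup>2 * \<sigma> x" for x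
  proof -
    define a b c d where "a = P True 1 x" and "b = P False 1 x" and "c = P True 2 x" and "d = P False 2 x"
    define q where "q = cmod a + cmod b + (cmod c + cmod d)"
    have S: "cmod \<zeta> \<le> S" "1 \<le> S" "1 / cmod \<zeta> \<le> S" by (simp_all add: S_def)
    have comp: "(cmod (\<i> / 2 * (u * (a + s * b) + v * (c + t * d))))\<^sup>2 \<le> (S / 2 * q)\<^sup>2"
      if "cmod u \<le> S" "cmod v \<le> S" "cmod s = 1" "cmod t = 1" for u v s t
    proof (rule power_mono)
      have "cmod (u * (a + s * b) + v * (c + t * d)) \<le> cmod u * (cmod a + cmod b) + cmod v * (cmod c + cmod d)"
        using norm_triangle_ineq[of a "s * b"] norm_triangle_ineq[of c "t * d"] that(3,4)
        by (intro norm_triangle_le) (auto simp: norm_mult intro!: add_mono mult_left_mono)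
      also have "\<dots> \<le> S * q"
        unfolding q_def distrib_left[of S "cmod a + cmod b" "cmod c + cmod d"] using that(1,2) by (intro add_mono mult_right_mono) auto
      finally show "cmod (\<i> / 2 * (u * (a + s * b) + v * (c + t * d))) \<le> S / 2 * q"
        by (simp add: norm_mult)
    qed simp
    have "(norm (green_conv k \<zeta> (rep_l2 g) x))\<^sup>2 \<le> 2 * (S / 2 * q)\<^sup>2"
      using comp[of \<zeta> 1 1 "-1"] comp[of 1 "1 / \<zeta>" "-1" 1] S
      by (simp add: norm_vec2 green_conv_nth a_def b_def c_def d_def norm_divide flip: P_def)
    also have "\<dots> = S\<^sup>2 / 2 * q\<^sup>2" by (simp add: power_mult_distrib power_divide)
    also have "\<dots> \<le> S\<^sup>2 / 2 * (4 * \<sigma> x)"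
    proof (rule mult_left_mono)
      show "q\<^sup>2 \<le> 4 * \<sigma> x"
      proof -
        have "4 * (p\<^sup>2 + q\<^sup>2 + r\<^sup>2 + s\<^sup>2) - (p + q + (r + s))\<^sup>2 =
            (p - q)\<^sup>2 + (p - r)\<^sup>2 + (p - s)\<^sup>2 + (q - r)\<^sup>2 + (q - s)\<^sup>2 + (r - s)\<^sup>2" for p q r s :: real
          by (simp add: power2_eq_square algebra_simps)
        from this[of "cmod a" "cmod b" "cmod c" "cmod d"]
        have "0 \<le> 4 * ((cmod a)\<^sup>2 + (cmod b)\<^sup>2 + (cmod c)\<^sup>2 + (cmod d)\<^sup>2) - q\<^sup>2"
          unfolding q_def by simp
        then show ?thesis by (simp add: \<sigma>_def a_def b_def c_def d_def)
      qed
    qed simp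
    finally show ?thesis by (simp add: mult_ac)
  qed
  have sU: "sq_int (green_conv k \<zeta> (rep_l2 g))" by (rule green_conv_sq_int[OF k sq_int_rep])
  have "(norm (green_op k \<zeta> g))\<^sup>2 = (LINT x|lborel. (norm (green_conv k \<zeta> (rep_l2 g) x))\<^sup>2)"
    unfolding norm_l2_integral
    by (rule integral_cong_AE) (use sU rep_green_op[OF k, of \<zeta> g] in \<open>auto simp: sq_int_def\<close>)
  also have "\<dots> \<le> (LINT x|lborel. 2 * S\<^sup>2 * \<sigma> x)"
    by (rule integral_mono) (use sU i\<sigma> pw in \<open>auto simp: sq_int_def\<close>)
  also have "\<dots> \<le> 2 * S\<^sup>2 * (2 * (1 / Im k)\<^sup>2 * (norm g)\<^sup>2)"
    using mult_left_mono[OF \<sigma>, of "2 * S\<^sup>2"] by simp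
  finally show ?thesis by (simp add: S_def power_divide)
qed

lemma bounded_linear_green_op:
  assumes k: "0 < Im k"
  shows "bounded_linear (green_op k \<zeta>)"
proof -
  define C where "C = 4 * ((cmod \<zeta> + 1 + 1 / cmod \<zeta>) / Im k)\<^sup>2"
  have C: "0 \<le> C" by (auto simp: C_def)
  show ?thesis
  proof (rule bounded_linear_intro[where K = "sqrt C"])
    show "green_op k \<zeta> (r *\<^sub>R f) = r *\<^sub>R green_op k \<zeta> f" for r f
      using green_op_scaleC[OF k, of \<zeta> "complex_of_real r" f] by (simp add: scaleC_of_real)
    show "norm (green_op k \<zeta> f) \<le> norm f * sqrt C" for f
    proof (rule power2_le_imp_le)
      show "(norm (green_op k \<zeta> f))\<^sup>2 \<le> (norm f * sqrt C)\<^sup>2"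
        using norm_green_op[OF k, of \<zeta> f] C
        by (simp only: power_mult_distrib C_def[symmetric] real_sqrt_pow2 mult.commute)
    qed (use C in auto)
  qed (rule green_op_add[OF k])
qed

text \<open>This is the relation between the adjoint of the resolvent at z and the resolvent at the
  conjugate point: transposition exchanges the two one-sided kernels, and conjugation sends k and
  \<zeta> to \<open>- cnj k\<close> and \<open>- cnj \<zeta>\<close>; the minus signs absorb the
  conjugation of the prefactor \<i> / 2 and the sign change of sgn t.\<close>

lemma green_op_adjoint:
  assumes k: "0 < Im k"
  shows "inner (green_op k \<zeta> g) h = inner g (green_op (- cnj k) (- cnj \<zeta>) h)"
proof -
  define P where "P b j = exp_conv b k (\<lambda>y. cnj (rep_l2 h y $ j))" for b j
  define I where "I f g = (LINT x|lborel. f x * g x)" for f g :: "real \<Rightarrow> complex"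
  define G where "G j = (\<lambda>x. rep_l2 g x $ j)" for j
  define H where "H j = (\<lambda>x. cnj (rep_l2 h x $ j))" for j
  have cs: "csq (G 1)" "csq (G 2)" "csq (H 1)" "csq (H 2)"
    unfolding G_def H_def by (intro csq_rep csq_cnj)+
  have csP: "csq (P b 1)" "csq (P b 2)" for b
    unfolding P_def using cs(3,4) by (auto simp: H_def intro!: exp_conv_csq k)
  have csS: "csq (exp_conv b k (G 1))" "csq (exp_conv b k (G 2))" for b
    by (intro exp_conv_csq k cs)+
  have k': "0 < Im (- cnj k)" using k by simp
  have I_add: "I (\<lambda>x. u x + v x) w = I u w + I v w" "I w (\<lambda>x. u x + v x) = I w u + I w v"
    "I (\<lambda>x. u x - v x) w = I u w - I v w" "I w (\<lambda>x. u x - v x) = I w u - I w v"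
    if "csq u" "csq v" "csq w" for u v w
    unfolding I_def using that by (simp_all add: csq_integrable_mult ring_distribs)
  have I_mult: "I (\<lambda>x. c * u x) w = c * I u w" "I w (\<lambda>x. c * u x) = c * I w u" for c u w
    unfolding I_def by (simp_all add: mult.assoc mult.left_commute[of _ c])
  have I_div: "I (\<lambda>x. u x / c) w = I u w / c" "I w (\<lambda>x. u x / c) = I w u / c" for c u w
    unfolding I_def by simp_all
  have I_minus: "I w (\<lambda>x. - u x) = - I w u" for u w
    unfolding I_def by simp
  have csq_div: "csq (\<lambda>x. u x / c)" if "csq u" for u c
    using csq_cmult[OF that, of "inverse c"] by (simp add: divide_inverse mult.commute)
  have cP: "cnj (exp_conv b (- cnj k) (\<lambda>y. rep_l2 h y $ j) x) = P b j x" for b j x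
    by (simp add: cnj_exp_conv P_def)
  have adj: "I (exp_conv b k (G i)) (H j) = I (G i) (P (\<not> b) j)" if "i \<in> {1, 2}" "j \<in> {1, 2}" for b i j
    unfolding I_def P_def H_def[symmetric] using that cs by (intro exp_conv_adjoint[OF k]) auto
  have "inner (green_op k \<zeta> g) h = Re (I (\<lambda>x. green_conv k \<zeta> (rep_l2 g) x $ 1) (H 1) +
      I (\<lambda>x. green_conv k \<zeta> (rep_l2 g) x $ 2) (H 2))"
    unfolding I_def H_def
    by (rule inner_l2_components) (use green_conv_sq_int[OF k] sq_int_rep rep_green_op[OF k] in auto)
  also have "I (\<lambda>x. green_conv k \<zeta> (rep_l2 g) x $ 1) (H 1) + I (\<lambda>x. green_conv k \<zeta> (rep_l2 g) x $ 2) (H 2) =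
      I (G 1) (\<lambda>x. cnj (green_conv (- cnj k) (- cnj \<zeta>) (rep_l2 h) x $ 1)) +
      I (G 2) (\<lambda>x. cnj (green_conv (- cnj k) (- cnj \<zeta>) (rep_l2 h) x $ 2))"
  proof -
    \<comment> \<open>A common normal form for the two sides: only pairings of components of g with
      convolutions of the conjugated components of h remain.\<close>
    define E where "E = \<i> / 2 * (\<zeta> * (I (G 1) (P True 1) + I (G 1) (P False 1)) +
      (I (G 2) (P False 1) - I (G 2) (P True 1)) + (I (G 1) (P False 2) - I (G 1) (P True 2)) +
      (I (G 2) (P False 2) + I (G 2) (P True 2)) / \<zeta>)"
    have "I (\<lambda>x. green_conv k \<zeta> (rep_l2 g) x $ 1) (H 1) + I (\<lambda>x. green_conv k \<zeta> (rep_l2 g) x $ 2) (H 2) = E"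
      unfolding green_conv_nth G_def[symmetric]
      by (simp add: I_mult I_div I_add cs csS csq_add csq_diff csq_cmult csq_div adj,
          (simp add: E_def ring_distribs add_divide_distrib diff_divide_distrib)?, (simp add: mult.commute[of \<zeta> 2])?)
    moreover have "I (G 1) (\<lambda>x. cnj (green_conv (- cnj k) (- cnj \<zeta>) (rep_l2 h) x $ 1)) +
      I (G 2) (\<lambda>x. cnj (green_conv (- cnj k) (- cnj \<zeta>) (rep_l2 h) x $ 2)) = E"
      unfolding green_conv_nth
      by (simp add: cP I_mult I_div I_add I_minus cs csP csq_add csq_diff csq_cmult csq_div,
          (simp add: E_def ring_distribs add_divide_distrib diff_divide_distrib)?, (simp add: mult.commute[of \<zeta> 2])?)
    ultimately show ?thesis by simp
  qed
  also have "Re \<dots> = inner g (green_op (- cnj k) (- cnj \<zeta>) h)"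
    unfolding I_def G_def
    by (rule inner_l2_components[symmetric])
      (use green_conv_sq_int[OF k'] sq_int_rep rep_green_op[OF k'] in auto)
  finally show ?thesis .
qed

text \<open>The integral equation makes \<phi> continuous, hence differentiable with \<phi>' = c
  \<phi>, so \<phi> is a multiple of exp (c x). As Re c \<noteq> 0, its modulus stays bounded below
  on a half-line, which is incompatible with square integrability.\<close>

lemma sq_int_solution_zero:
  fixes \<phi> :: "real \<Rightarrow> complex"
  assumes c: "Re c \<noteq> 0"
    and int: "\<And>a b. a \<le> b \<Longrightarrow> ((\<lambda>x. c * \<phi> x) has_integral (\<phi> b - \<phi> a)) {a..b}"
    and h: "csq h" "AE x in lborel. h x = \<phi> x"
  shows "\<phi> x = 0"
proof -
  have cont: "continuous_on {a..b} \<phi>" for a b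
  proof (cases "a \<le> b")
    case True
    have "continuous_on {a..b} (\<lambda>x. \<phi> a + integral {a..x} (\<lambda>x. c * \<phi> x))"
      using int[OF True] by (intro continuous_intros indefinite_integral_continuous_1) auto
    moreover have "\<phi> a + integral {a..x} (\<lambda>x. c * \<phi> x) = \<phi> x" if "x \<in> {a..b}" for x
      using integral_unique[OF int[of a x]] that by simp
    ultimately show ?thesis by (subst continuous_on_cong[OF refl, symmetric]) auto
  qed simp
  have deriv: "(\<phi> has_vector_derivative c * \<phi> x) (at x)" for x
  proof -
    have "((\<lambda>y. integral {x - 1..y} (\<lambda>x. c * \<phi> x)) has_vector_derivative c * \<phi> x) (at x within {x - 1..x + 1})"
      by (rule integral_has_vector_derivative) (auto intro!: continuous_intros cont)
    then have "((\<lambda>y. integral {x - 1..y} (\<lambda>x. c * \<phi> x) + \<phi> (x - 1)) has_vector_derivative c * \<phi> x + 0) (at x within {x - 1..x + 1})"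
      by (rule has_vector_derivative_add[OF _ has_vector_derivative_const])
    then have "(\<phi> has_vector_derivative c * \<phi> x) (at x within {x - 1..x + 1})"
      unfolding add_0_right
    proof (rule has_vector_derivative_transform[rotated 2])
      show "\<phi> y = integral {x - 1..y} (\<lambda>x. c * \<phi> x) + \<phi> (x - 1)" if "y \<in> {x - 1..x + 1}" for y
        using integral_unique[OF int[of "x - 1" y]] that by simp
    qed auto
    then show ?thesis
      by (subst (asm) at_within_interior) auto
  qed
  have "((\<lambda>x. \<phi> x * exp (- c * of_real x)) has_vector_derivative 0) (at x within UNIV)" for x
  proof -
    have "((\<lambda>w. exp (- c * w)) has_field_derivative - c * exp (- c * of_real x)) (at (of_real x))"
      by (auto intro!: derivative_eq_intros)
    from has_vector_derivative_mult[OF deriv[of x] has_vector_derivative_real_field[OF this, of UNIV]]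
    show ?thesis by simp
  qed
  then obtain C where C: "\<And>x. \<phi> x * exp (- c * of_real x) = C"
    by (rule has_vector_derivative_zero_constant[OF convex_UNIV]) auto
  have \<phi>: "\<phi> x = C * exp (c * of_real x)" for x
    using C[of x] by (simp add: exp_minus field_simps)
  have "C = 0"
  proof (rule ccontr)
    assume "C \<noteq> 0"
    define N where "N = (LINT x|lborel. (cmod (h x))\<^sup>2)"
    obtain n :: nat where n: "N / (cmod C)\<^sup>2 < real n" using reals_Archimedean2 by blast
    \<comment> \<open>An interval of length n on the side where exp (c x) has modulus at least 1; n
      was chosen so that its contribution alone exceeds the squared norm.\<close>
    define S where "S = (if 0 < Re c then {0..real n} else {- real n..0})"
    have "real n * (cmod C)\<^sup>2 = (LINT x|lborel. indicator S x * (cmod C)\<^sup>2)"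
      by (simp add: S_def)
    also have "\<dots> \<le> N"
      unfolding N_def
    proof (rule integral_mono_AE)
      have "integrable lborel (indicator S :: real \<Rightarrow> real)"
        by (intro integrable_real_indicator) (auto simp: S_def)
      then show "integrable lborel (\<lambda>x. indicator S x * (cmod C)\<^sup>2)" by simp
      show "integrable lborel (\<lambda>x. (cmod (h x))\<^sup>2)" using h by (simp add: csq_def)
      show "AE x in lborel. indicator S x * (cmod C)\<^sup>2 \<le> (cmod (h x))\<^sup>2"
        using h(2)
      proof eventually_elim
        case (elim x)
        have "0 \<le> Re c * x" if "x \<in> S"
          using that c by (auto simp: S_def zero_le_mult_iff split: if_splits)
        then have "cmod C \<le> cmod (h x)" if "x \<in> S"
          unfolding elim \<phi> using that by (simp add: norm_mult mult_le_cancel_left1)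
        then show ?case by (auto simp: indicator_def intro: power_mono)
      qed
    qed
    finally show False using n \<open>C \<noteq> 0\<close> by (simp add: field_simps)
  qed
  then show ?thesis by (simp add: \<phi>)
qed

text \<open>The two relations say that k \<zeta> = z + m and k / \<zeta> = z - m, so that
  \<open>k\<^sup>2 = z\<^sup>2 - m\<^sup>2\<close>. Keeping k and \<zeta> abstract makes the
  conjugate data another instance; the branch of the square root enters only at the final
  instantiation.\<close>

locale green =
  fixes m :: real and z k \<zeta> :: complex
  assumes k: "0 < Im k"
    and k\<zeta>: "k * \<zeta> = z + of_real m"
    and \<zeta>k: "\<zeta> * (z - of_real m) = k"
begin

lemma \<zeta>_nonzero: "\<zeta> \<noteq> 0"
  using k \<zeta>k by auto

text \<open>Differentiating the convolutions, the terms \<open>G\<close> produced by the jump of the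
  kernel at 0 cancel in sums and double in differences of the two sides. What remains is \<i> k
  times a convolution, which the two locale relations turn into z + m or z - m times a component of
  \<open>U\<close>.\<close>

lemma green_op_free_dirac: "(green_op k \<zeta> g, g + z *\<^sub>C green_op k \<zeta> g) \<in> free_dirac m"
proof -
  define G where "G j = (\<lambda>x. rep_l2 g x $ j)" for j
  define P Q where "P j = exp_conv True k (G j)" and "Q j = exp_conv False k (G j)" for j
  define U where "U = green_conv k \<zeta> (rep_l2 g)"
  have U: "U x $ 1 = \<i> / 2 * (\<zeta> * (P 1 x + Q 1 x) + (P 2 x - Q 2 x))"
    "U x $ 2 = \<i> / 2 * ((P 1 x - Q 1 x) + (P 2 x + Q 2 x) / \<zeta>)" for x
    by (simp_all add: U_def green_conv_nth P_def Q_def G_def)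
  have sU: "sq_int U" unfolding U_def by (rule green_conv_sq_int[OF k sq_int_rep])
  \<comment> \<open>The equation (H_0 - z) U = g, solved for the derivative of
    \<open>U\<close>.\<close>
  define D :: "real \<Rightarrow> complex^2" where
    "D x = vector [\<i> * (G 2 x + (z + of_real m) * U x $ 2), \<i> * (G 1 x + (z - of_real m) * U x $ 1)]" for x
  have D: "D x $ 1 = \<i> * (G 2 x + (z + of_real m) * U x $ 2)"
    "D x $ 2 = \<i> * (G 1 x + (z - of_real m) * U x $ 1)" for x
    by (simp_all add: D_def)
  have csG: "csq (G 1)" "csq (G 2)" unfolding G_def by (rule csq_rep)+
  have sD: "sq_int D"
    using sU csG unfolding sq_int_iff_csq D by (auto intro!: csq_cmult csq_add)
  have int: "(D has_integral (U b - U a)) {a..b}" if ab: "a \<le> b" for a b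
  proof -
    note T = exp_conv_True_integral[OF k csG(1) ab] exp_conv_True_integral[OF k csG(2) ab]
    note F = exp_conv_False_integral[OF k csG(1) ab] exp_conv_False_integral[OF k csG(2) ab]
    have 1: "((\<lambda>x. \<i> / 2 * (\<zeta> * ((G 1 x + \<i> * k * P 1 x) + (- G 1 x - \<i> * k * Q 1 x)) +
        ((G 2 x + \<i> * k * P 2 x) - (- G 2 x - \<i> * k * Q 2 x)))) has_integral
        \<i> / 2 * (\<zeta> * ((P 1 b - P 1 a) + (Q 1 b - Q 1 a)) + ((P 2 b - P 2 a) - (Q 2 b - Q 2 a)))) {a..b}"
      unfolding P_def Q_def
      by (intro has_integral_mult_right has_integral_add has_integral_diff T F)
    have 2: "((\<lambda>x. \<i> / 2 * (((G 1 x + \<i> * k * P 1 x) - (- G 1 x - \<i> * k * Q 1 x)) +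
        inverse \<zeta> * ((G 2 x + \<i> * k * P 2 x) + (- G 2 x - \<i> * k * Q 2 x)))) has_integral
        \<i> / 2 * (((P 1 b - P 1 a) - (Q 1 b - Q 1 a)) + inverse \<zeta> * ((P 2 b - P 2 a) + (Q 2 b - Q 2 a)))) {a..b}"
      unfolding P_def Q_def
      by (intro has_integral_mult_right has_integral_add has_integral_diff T F)
    have e1: "\<i> / 2 * (\<zeta> * ((G 1 x + \<i> * k * P 1 x) + (- G 1 x - \<i> * k * Q 1 x)) +
        ((G 2 x + \<i> * k * P 2 x) - (- G 2 x - \<i> * k * Q 2 x))) = D x $ 1" for x
      unfolding D U k\<zeta>[symmetric] using \<zeta>_nonzero by (simp add: field_simps)
    have e2: "\<i> / 2 * (((G 1 x + \<i> * k * P 1 x) - (- G 1 x - \<i> * k * Q 1 x)) +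
        inverse \<zeta> * ((G 2 x + \<i> * k * P 2 x) + (- G 2 x - \<i> * k * Q 2 x))) = D x $ 2" for x
    proof -
      have zm: "z - of_real m = k / \<zeta>" using \<zeta>k \<zeta>_nonzero by (simp add: field_simps)
      show ?thesis unfolding D U zm using \<zeta>_nonzero by (simp add: field_simps)
    qed
    have f1: "\<i> / 2 * (\<zeta> * ((P 1 b - P 1 a) + (Q 1 b - Q 1 a)) + ((P 2 b - P 2 a) - (Q 2 b - Q 2 a))) =
        (U b - U a) $ 1"
      by (simp add: U algebra_simps diff_divide_distrib add_divide_distrib)
    have f2: "\<i> / 2 * (((P 1 b - P 1 a) - (Q 1 b - Q 1 a)) + inverse \<zeta> * ((P 2 b - P 2 a) + (Q 2 b - Q 2 a))) =
        (U b - U a) $ 2"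
      using \<zeta>_nonzero by (simp add: U field_simps)
    show ?thesis
      unfolding has_integral_vec2 using 1 2 unfolding e1 e2 f1 f2 by blast
  qed
  have "(green_op k \<zeta> g, abs_l2 D) \<in> deriv_op"
    unfolding deriv_op_def has_integral_AE_cong[OF rep_abs_l2[OF sD]]
    using rep_green_op[OF k, of \<zeta> g] int
    by (auto simp: has_integral_AE_cong[OF rep_abs_l2[OF sD]] U_def)
  moreover have "AE x in lborel.
      dirac_eq m (rep_l2 (g + z *\<^sub>C green_op k \<zeta> g) x) (rep_l2 (abs_l2 D) x) (rep_l2 (green_op k \<zeta> g) x)"
    using rep_plus[of g "z *\<^sub>C green_op k \<zeta> g"] rep_scaleC[of z "green_op k \<zeta> g"] rep_abs_l2[OF sD]
      rep_green_op[OF k, of \<zeta> g]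
    by eventually_elim (simp add: D G_def U_def algebra_simps)
  ultimately show ?thesis unfolding free_dirac_iff by blast
qed

text \<open>The combinations F_1 + s \<zeta> F_2 with s = 1 and s = -1 decouple the system into
  \<phi>' = \<i> s k \<phi>, whose rate has nonzero real part because Im k > 0.\<close>

lemma free_dirac_eigenvector_zero:
  assumes "(u, z *\<^sub>C u) \<in> free_dirac m"
  shows "u = 0"
proof -
  from assms obtain u' where d: "(u, u') \<in> deriv_op"
    and a: "AE x in lborel. dirac_eq m (rep_l2 (z *\<^sub>C u) x) (rep_l2 u' x) (rep_l2 u x)"
    unfolding free_dirac_iff by auto
  from d obtain F where F: "AE x in lborel. rep_l2 u x = F x"
      "\<And>a b. a \<le> b \<Longrightarrow> (rep_l2 u' has_integral (F b - F a)) {a..b}"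
    unfolding deriv_op_def by auto
  have u': "AE x in lborel. rep_l2 u' x $ 1 = \<i> * (z + of_real m) * F x $ 2 \<and>
      rep_l2 u' x $ 2 = \<i> * (z - of_real m) * F x $ 1"
    using a F(1) rep_scaleC[of z u]
  proof eventually_elim
    case (elim x)
    then have e: "z * F x $ 1 = - \<i> * rep_l2 u' x $ 2 + of_real m * F x $ 1"
      "z * F x $ 2 = - \<i> * rep_l2 u' x $ 1 - of_real m * F x $ 2" by auto
    have "rep_l2 u' x $ 2 = \<i> * (- \<i> * rep_l2 u' x $ 2)" by simp
    also have "- \<i> * rep_l2 u' x $ 2 = z * F x $ 1 - of_real m * F x $ 1" using e(1) by simp
    finally have 2: "rep_l2 u' x $ 2 = \<i> * (z - of_real m) * F x $ 1" by (simp add: algebra_simps)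
    have "rep_l2 u' x $ 1 = \<i> * (- \<i> * rep_l2 u' x $ 1)" by simp
    also have "- \<i> * rep_l2 u' x $ 1 = z * F x $ 2 + of_real m * F x $ 2" using e(2) by simp
    finally have 1: "rep_l2 u' x $ 1 = \<i> * (z + of_real m) * F x $ 2" by (simp add: algebra_simps)
    from 1 2 show ?case by blast
  qed
  have zero: "F x $ 1 + s * \<zeta> * F x $ 2 = 0" if s: "s = 1 \<or> s = -1" for s :: complex and x
  proof (rule sq_int_solution_zero[where c = "\<i> * s * k" and h = "\<lambda>x. rep_l2 u x $ 1 + s * \<zeta> * rep_l2 u x $ 2"])
    show "Re (\<i> * s * k) \<noteq> 0" using s k by auto
    show "csq (\<lambda>x. rep_l2 u x $ 1 + s * \<zeta> * rep_l2 u x $ 2)" by (intro csq_add csq_cmult csq_rep)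
    show "AE x in lborel. rep_l2 u x $ 1 + s * \<zeta> * rep_l2 u x $ 2 = F x $ 1 + s * \<zeta> * F x $ 2"
      using F(1) by eventually_elim simp
    fix a b :: real assume "a \<le> b"
    have "((\<lambda>x. rep_l2 u' x $ 1 + s * \<zeta> * rep_l2 u' x $ 2) has_integral
        ((F b - F a) $ 1 + s * \<zeta> * (F b - F a) $ 2)) {a..b}"
      using F(2)[OF \<open>a \<le> b\<close>] unfolding has_integral_vec2
      by (intro has_integral_add has_integral_mult_right) auto
    also have "(F b - F a) $ 1 + s * \<zeta> * (F b - F a) $ 2 =
        (F b $ 1 + s * \<zeta> * F b $ 2) - (F a $ 1 + s * \<zeta> * F a $ 2)"
      by (simp add: algebra_simps)
    finally show "((\<lambda>x. \<i> * s * k * (F x $ 1 + s * \<zeta> * F x $ 2)) has_integral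
        (F b $ 1 + s * \<zeta> * F b $ 2) - (F a $ 1 + s * \<zeta> * F a $ 2)) {a..b}"
    proof (subst has_integral_AE_cong)
      show "AE x in lborel. \<i> * s * k * (F x $ 1 + s * \<zeta> * F x $ 2) = rep_l2 u' x $ 1 + s * \<zeta> * rep_l2 u' x $ 2"
        using u'
      proof eventually_elim
        case (elim x)
        have "\<i> * s * k * (F x $ 1 + s * \<zeta> * F x $ 2) = \<i> * (s * s) * (k * \<zeta>) * F x $ 2 + \<i> * s * k * F x $ 1"
          by (simp add: algebra_simps)
        also have "\<dots> = \<i> * (z + of_real m) * F x $ 2 + s * \<zeta> * (\<i> * (z - of_real m) * F x $ 1)"
          unfolding k\<zeta> using s by (auto simp flip: \<zeta>k)
        finally show ?case using elim by simp
      qed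
    qed
  qed
  have "F x = 0" for x
  proof -
    have 1: "F x $ 1 + \<zeta> * F x $ 2 = 0" and 2: "F x $ 1 - \<zeta> * F x $ 2 = 0"
      using zero[of 1 x] zero[of "-1" x] by simp_all
    have "2 * F x $ 1 = 0" "2 * \<zeta> * F x $ 2 = 0" using 1 2 by algebra+
    then show ?thesis using \<zeta>_nonzero by (simp add: vec2_eq_iff)
  qed
  then show ?thesis
    by (intro l2_eqI) (use F(1) rep_zero in eventually_elim, simp)
qed

lemma resolvent_iff: "(g, u) \<in> resolvent (free_dirac m) z \<longleftrightarrow> u = green_op k \<zeta> g"
proof
  assume "(g, u) \<in> resolvent (free_dirac m) z"
  then have u: "(u, g + z *\<^sub>C u) \<in> free_dirac m"
    by (auto simp: resolvent_def op_shift_def)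
  have "(u - green_op k \<zeta> g, z *\<^sub>C (u - green_op k \<zeta> g)) \<in> free_dirac m"
    using free_dirac_diff[OF u green_op_free_dirac[of g]] by (simp add: scaleC_diff_right)
  from free_dirac_eigenvector_zero[OF this] show "u = green_op k \<zeta> g" by simp
next
  assume "u = green_op k \<zeta> g"
  then show "(g, u) \<in> resolvent (free_dirac m) z"
    using green_op_free_dirac[of g] by (force simp: resolvent_def op_shift_def)
qed

lemma in_resolvent_set: "z \<in> resolvent_set (free_dirac m)"
proof -
  have "resolvent (free_dirac m) z = {(f, green_op k \<zeta> f) |f. True}"
    using resolvent_iff by auto
  then show ?thesis
    unfolding resolvent_set_def bounded_op_def
    using bounded_linear_green_op[OF k] green_op_scaleC[OF k] by (auto intro!: exI[of _ "green_op k \<zeta>"])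
qed

lemma green_cnj: "green m (cnj z) (- cnj k) (- cnj \<zeta>)"
proof
  show "0 < Im (- cnj k)" using k by simp
  show "- cnj k * - cnj \<zeta> = cnj z + of_real m" using arg_cong[OF k\<zeta>, of cnj] by simp
  show "- cnj \<zeta> * (cnj z - of_real m) = - cnj k" using arg_cong[OF \<zeta>k, of cnj] by simp
qed

text \<open>With \<open>R\<close> the free resolvent at \<open>z\<close>, this is \<open>Im R = Im z R\<^sup>* R\<close>; it follows from
  the resolvent identity for \<open>z\<close> and \<open>cnj z\<close>.\<close>

lemma inner_green_op: "inner g (\<i> *\<^sub>C green_op k \<zeta> g) = - Im z * (norm (green_op k \<zeta> g))\<^sup>2"
proof -
  interpret c: green m "cnj z" "- cnj k" "- cnj \<zeta>" by (rule green_cnj)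
  define u v where "u = green_op k \<zeta> g" and "v = green_op (- cnj k) (- cnj \<zeta>) g"
  \<comment> \<open>Subtracting the equations (H_0 - z) u = g and (H_0 - cnj z) v = g gives the
    resolvent identity directly on the graph.\<close>
  have "(u - v, (z *\<^sub>C u - cnj z *\<^sub>C u) + cnj z *\<^sub>C (u - v)) \<in> free_dirac m"
    using free_dirac_diff[OF green_op_free_dirac[of g] c.green_op_free_dirac[of g]]
    by (simp add: u_def v_def scaleC_diff_right)
  then have "(z *\<^sub>C u - cnj z *\<^sub>C u, u - v) \<in> resolvent (free_dirac m) (cnj z)"
    by (force simp: resolvent_def op_shift_def)
  then have "u - v = green_op (- cnj k) (- cnj \<zeta>) ((z - cnj z) *\<^sub>C u)"
    by (simp add: c.resolvent_iff scaleC_diff_left)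
  also have "z - cnj z = \<i> * of_real (2 * Im z)" by (simp add: complex_eq_iff)
  finally have uv: "u - v = (\<i> * of_real (2 * Im z)) *\<^sub>C green_op (- cnj k) (- cnj \<zeta>) u"
    by (simp add: green_op_scaleC[OF c.k])
  have uu: "(norm u)\<^sup>2 = inner g (green_op (- cnj k) (- cnj \<zeta>) u)"
    using green_op_adjoint[OF k, of \<zeta> g u] by (simp add: u_def power2_norm_eq_inner)
  have "\<i> *\<^sub>C (u - v) = (- (2 * Im z)) *\<^sub>R green_op (- cnj k) (- cnj \<zeta>) u"
    unfolding uv scaleC_scaleC by (simp flip: scaleC_of_real add: mult.assoc[symmetric])
  then have 1: "inner g (\<i> *\<^sub>C u) - inner g (\<i> *\<^sub>C v) = - (2 * Im z) * (norm u)\<^sup>2"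
    by (simp add: uu scaleC_diff_right flip: inner_diff_right)
  \<comment> \<open>By the adjoint relation the term with v is the negative of the term with u, so
    the left-hand side of fact \<open>1\<close> is twice the wanted quantity.\<close>
  have "inner g (\<i> *\<^sub>C v) = inner g (green_op (- cnj k) (- cnj \<zeta>) (\<i> *\<^sub>C g))"
    by (simp add: v_def green_op_scaleC[OF c.k])
  also have "\<dots> = inner u (\<i> *\<^sub>C g)"
    using green_op_adjoint[OF k, of \<zeta> g "\<i> *\<^sub>C g"] by (simp add: u_def)
  also have "\<dots> = inner (- (\<i> *\<^sub>C u)) g"
    using inner_scaleC_left[of "- \<i>" u g] scaleC_diff_left[of 0 \<i> u] scaleC_of_real[of 0 u] by simp
  finally have "inner g (\<i> *\<^sub>C v) = - inner g (\<i> *\<^sub>C u)" by (simp add: inner_commute)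
  with 1 show ?thesis by (simp add: u_def)
qed

end

section \<open>Hilbert--Schmidt estimates for the free resolvent times a matrix function\<close>

lemma cmod_Cauchy_Schwarz:
  "(cmod (a * u + b * v))\<^sup>2 \<le> ((cmod a)\<^sup>2 + (cmod b)\<^sup>2) * ((cmod u)\<^sup>2 + (cmod v)\<^sup>2)"
proof -
  have "(cmod (a * u + b * v))\<^sup>2 \<le> (cmod a * cmod u + cmod b * cmod v)\<^sup>2"
    by (intro power_mono) (auto intro!: norm_triangle_le simp: norm_mult)
  also have "\<dots> \<le> ((cmod a)\<^sup>2 + (cmod b)\<^sup>2) * ((cmod u)\<^sup>2 + (cmod v)\<^sup>2)"
    using zero_le_power2[of "cmod a * cmod v - cmod b * cmod u"]
    by (simp add: power2_eq_square algebra_simps)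
  finally show ?thesis .
qed

lemma row_integral_bound:
  assumes a: "csq a" "csq b"
  shows "(cmod (LINT y|lborel. a y * rep_l2 f y $ 1 + b y * rep_l2 f y $ 2))\<^sup>2 \<le>
    (LINT y|lborel. (cmod (a y))\<^sup>2 + (cmod (b y))\<^sup>2) * (norm f)\<^sup>2"
proof -
  have [measurable]: "a \<in> borel_measurable borel" "b \<in> borel_measurable borel" using a by (auto simp: csq_def)
  define r where "r y = sqrt ((cmod (a y))\<^sup>2 + (cmod (b y))\<^sup>2)" for y
  have [measurable]: "r \<in> borel_measurable borel" unfolding r_def[abs_def] by measurable
  have r2: "(r y)\<^sup>2 = (cmod (a y))\<^sup>2 + (cmod (b y))\<^sup>2" for y by (simp add: r_def)
  have ir: "integrable lborel (\<lambda>y. (r y)\<^sup>2)" unfolding r2 using a by (auto simp: csq_def)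
  note cs = real_Cauchy_Schwarz_integral[OF _ _ ir rep_integrable[of f]]
  have pw: "cmod (a y * rep_l2 f y $ 1 + b y * rep_l2 f y $ 2) \<le> r y * norm (rep_l2 f y)" for y
  proof (rule power2_le_imp_le)
    show "(cmod (a y * rep_l2 f y $ 1 + b y * rep_l2 f y $ 2))\<^sup>2 \<le> (r y * norm (rep_l2 f y))\<^sup>2"
      unfolding power_mult_distrib r2 norm_vec2 by (rule cmod_Cauchy_Schwarz)
  qed (simp add: r_def)
  have "cmod (LINT y|lborel. a y * rep_l2 f y $ 1 + b y * rep_l2 f y $ 2) \<le> (LINT y|lborel. r y * norm (rep_l2 f y))"
  proof (rule order_trans[OF integral_norm_bound integral_mono])
    show "integrable lborel (\<lambda>y. norm (a y * rep_l2 f y $ 1 + b y * rep_l2 f y $ 2))"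
      by (intro integrable_norm Bochner_Integration.integrable_add csq_integrable_mult a csq_rep)
    show "integrable lborel (\<lambda>y. r y * norm (rep_l2 f y))" by (rule cs(1)) measurable
  qed (rule pw)
  then have "(cmod (LINT y|lborel. a y * rep_l2 f y $ 1 + b y * rep_l2 f y $ 2))\<^sup>2 \<le>
      (LINT y|lborel. r y * norm (rep_l2 f y))\<^sup>2"
    by (rule power_mono) simp
  also have "\<dots> \<le> (LINT y|lborel. (r y)\<^sup>2) * (LINT y|lborel. (norm (rep_l2 f y))\<^sup>2)"
    by (rule cs(2)) measurable
  finally show ?thesis by (simp add: r2 norm_l2_integral)
qed

text \<open>If A is the Hermitian root of \<open>Vt\<close>, the squared length of its i-th row is
  the i-th diagonal entry of \<open>A ** A\<close> = \<open>Vt\<close>. Thus this becomes the norm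
  of a diagonal entry of the potential.\<close>

definition row_norm :: "(real \<Rightarrow> complex^2^2) \<Rightarrow> 2 \<Rightarrow> real" where
  "row_norm A i = (LINT x|lborel. (cmod (A x $ i $ 1))\<^sup>2 + (cmod (A x $ i $ 2))\<^sup>2)"

text \<open>Half the integral of the squared Hilbert--Schmidt norm of the Green matrix (without the
  factor \<open>(\<i> / 2) exp (\<i> k \<bar>t\<bar>)\<close>) times \<open>A\<close>, averaged over the two signs of \<open>t\<close>.\<close>

definition hs_bound :: "complex \<Rightarrow> (real \<Rightarrow> complex^2^2) \<Rightarrow> real" where
  "hs_bound \<zeta> A = (((cmod \<zeta>)\<^sup>2 + 1) * row_norm A 1 + (1 + (1 / cmod \<zeta>)\<^sup>2) * row_norm A 2) / 2"

context green
begin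

text \<open>Cauchy--Schwarz in y bounds the value at t by the squared Hilbert--Schmidt norm w t y of
  the kernel, integrated over y. Estimating the exponential by 1 gives the bound uniform in t, which
  will make \<open>Q\<close> bounded; integrating it over t gives the bound on the resolvent that
  controls the real part of \<open>Q\<close>.\<close>

lemma green_conv_mult_bounds:
  assumes A: "\<And>i j. csq (\<lambda>x. A x $ i $ j)"
    and g: "AE x in lborel. rep_l2 g x = A x *v rep_l2 f x"
  shows "(norm (green_conv k \<zeta> (rep_l2 g) t))\<^sup>2 \<le> hs_bound \<zeta> A * (norm f)\<^sup>2"
    "(norm (green_op k \<zeta> g))\<^sup>2 \<le> hs_bound \<zeta> A / (2 * Im k) * (norm f)\<^sup>2"
proof -
  have Am [measurable]: "(\<lambda>x. A x $ i $ j) \<in> borel_measurable borel" for i j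
    using A by (simp add: csq_def)
  define p q where "p t y = exp_ker True k (t - y)" and "q t y = exp_ker False k (t - y)" for t y
  \<comment> \<open>\<open>a l\<close> and \<open>b l\<close> are the l-th entries of the two rows
    of the kernel, Green matrix times A, up to the common factor \<i>.\<close>
  define a where "a l t y = (\<zeta> * (p t y + q t y) * A y $ 1 $ l + (p t y - q t y) * A y $ 2 $ l) / 2" for l t y
  define b where "b l t y = ((p t y - q t y) * A y $ 1 $ l + (p t y + q t y) / \<zeta> * A y $ 2 $ l) / 2" for l t y
  have cspq: "csq (\<lambda>y. p t y * A y $ i $ j)" "csq (\<lambda>y. q t y * A y $ i $ j)" for t i j
  proof -
    have "csq (\<lambda>y. exp_ker b k (t - y) * A y $ i $ j)" for b
      by (rule csq_bound[OF _ A[of i j], where C = 1])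
        (auto simp: norm_mult norm_exp_ker_le_1[OF k] mult_left_le_one_le)
    then show "csq (\<lambda>y. p t y * A y $ i $ j)" "csq (\<lambda>y. q t y * A y $ i $ j)"
      by (simp_all add: p_def q_def)
  qed
  have a_eq: "a l t y = (1 / 2) * (\<zeta> * (p t y * A y $ 1 $ l + q t y * A y $ 1 $ l) +
      (p t y * A y $ 2 $ l - q t y * A y $ 2 $ l))" for l t y
    by (simp add: a_def algebra_simps add_divide_distrib diff_divide_distrib)
  have b_eq: "b l t y = (1 / 2) * ((p t y * A y $ 1 $ l - q t y * A y $ 1 $ l) +
      (1 / \<zeta>) * (p t y * A y $ 2 $ l + q t y * A y $ 2 $ l))" for l t y
    by (simp add: b_def algebra_simps add_divide_distrib diff_divide_distrib)
  have csa: "csq (a l t)" and csb: "csq (b l t)" for l t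
    unfolding a_eq[abs_def] b_eq[abs_def] by (intro csq_cmult csq_add csq_diff cspq)+
  have gi: "AE y in lborel. rep_l2 g y $ i = A y $ i $ 1 * rep_l2 f y $ 1 + A y $ i $ 2 * rep_l2 f y $ 2" for i
    using g by eventually_elim (simp add: matrix_vector_mult_def sum_2)
  have U: "green_conv k \<zeta> (rep_l2 g) t $ 1 = \<i> * (LINT y|lborel. a 1 t y * rep_l2 f y $ 1 + a 2 t y * rep_l2 f y $ 2)"
    "green_conv k \<zeta> (rep_l2 g) t $ 2 = \<i> * (LINT y|lborel. b 1 t y * rep_l2 f y $ 1 + b 2 t y * rep_l2 f y $ 2)" for t
  proof -
    have ig: "integrable lborel (\<lambda>y. p t y * rep_l2 g y $ 1)" "integrable lborel (\<lambda>y. p t y * rep_l2 g y $ 2)"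
      "integrable lborel (\<lambda>y. q t y * rep_l2 g y $ 1)" "integrable lborel (\<lambda>y. q t y * rep_l2 g y $ 2)"
      unfolding p_def q_def by (intro exp_conv_integrable k csq_rep)+
    have ma: "(\<lambda>y. a 1 t y * rep_l2 f y $ 1 + a 2 t y * rep_l2 f y $ 2) \<in> borel_measurable lborel"
      "(\<lambda>y. b 1 t y * rep_l2 f y $ 1 + b 2 t y * rep_l2 f y $ 2) \<in> borel_measurable lborel"
      using csa[THEN csq_measurable] csb[THEN csq_measurable] by (auto intro!: borel_measurable_add borel_measurable_times)
    have mp: "p t \<in> borel_measurable borel" "q t \<in> borel_measurable borel"
      unfolding p_def[abs_def] q_def[abs_def] by measurable
    have "(LINT y|lborel. a 1 t y * rep_l2 f y $ 1 + a 2 t y * rep_l2 f y $ 2) =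
        (LINT y|lborel. (\<zeta> * (p t y * rep_l2 g y $ 1 + q t y * rep_l2 g y $ 1) +
          (p t y * rep_l2 g y $ 2 - q t y * rep_l2 g y $ 2)) / 2)"
      by (rule integral_cong_AE[OF ma(1)], use mp in measurable)
        (use gi[of 1] gi[of 2] in eventually_elim, simp add: a_def algebra_simps add_divide_distrib diff_divide_distrib)
    then show "green_conv k \<zeta> (rep_l2 g) t $ 1 = \<i> * (LINT y|lborel. a 1 t y * rep_l2 f y $ 1 + a 2 t y * rep_l2 f y $ 2)"
      using ig by (simp add: green_conv_nth exp_conv_def flip: p_def q_def)
    have "(LINT y|lborel. b 1 t y * rep_l2 f y $ 1 + b 2 t y * rep_l2 f y $ 2) =
        (LINT y|lborel. ((p t y * rep_l2 g y $ 1 - q t y * rep_l2 g y $ 1) +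
          (p t y * rep_l2 g y $ 2 + q t y * rep_l2 g y $ 2) / \<zeta>) / 2)"
      by (rule integral_cong_AE[OF ma(2)], use mp in measurable)
        (use gi[of 1] gi[of 2] in eventually_elim, simp add: b_def algebra_simps add_divide_distrib diff_divide_distrib)
    then show "green_conv k \<zeta> (rep_l2 g) t $ 2 = \<i> * (LINT y|lborel. b 1 t y * rep_l2 f y $ 1 + b 2 t y * rep_l2 f y $ 2)"
      using ig by (simp add: green_conv_nth exp_conv_def flip: p_def q_def)
  qed
  define w where "w t y = ((cmod (a 1 t y))\<^sup>2 + (cmod (a 2 t y))\<^sup>2) + ((cmod (b 1 t y))\<^sup>2 + (cmod (b 2 t y))\<^sup>2)" for t y
  have iw: "integrable lborel (w t)" for t
    unfolding w_def using csa csb by (auto simp: csq_def)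
  have Uw: "(norm (green_conv k \<zeta> (rep_l2 g) t))\<^sup>2 \<le> (LINT y|lborel. w t y) * (norm f)\<^sup>2" for t
  proof -
    have "(LINT y|lborel. w t y) = (LINT y|lborel. (cmod (a 1 t y))\<^sup>2 + (cmod (a 2 t y))\<^sup>2) +
        (LINT y|lborel. (cmod (b 1 t y))\<^sup>2 + (cmod (b 2 t y))\<^sup>2)"
      unfolding w_def using csa csb
      by (intro Bochner_Integration.integral_add Bochner_Integration.integrable_add) (auto simp: csq_def)
    then show ?thesis
      unfolding norm_vec2 U using row_integral_bound[OF csa[of 1 t] csa[of 2 t], of f]
        row_integral_bound[OF csb[of 1 t] csb[of 2 t], of f]
      by (simp add: norm_mult distrib_right)
  qed
  \<comment> \<open>A quarter of the squared Hilbert--Schmidt norm of [[\<zeta>, s],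
    [s, 1 / \<zeta>]] times A y, with s the sign of t - y.\<close>
  define hs where "hs s y = ((cmod (\<zeta> * A y $ 1 $ 1 + s * A y $ 2 $ 1))\<^sup>2 + (cmod (\<zeta> * A y $ 1 $ 2 + s * A y $ 2 $ 2))\<^sup>2 +
      (cmod (s * A y $ 1 $ 1 + A y $ 2 $ 1 / \<zeta>))\<^sup>2 + (cmod (s * A y $ 1 $ 2 + A y $ 2 $ 2 / \<zeta>))\<^sup>2) / 4"
    for s :: complex and y
  have hs_m [measurable]: "hs s \<in> borel_measurable borel" for s unfolding hs_def[abs_def] by measurable
  have hs0: "0 \<le> hs s y" for s y by (simp add: hs_def)
  have w_eq: "w t y = cmod (exp_ker True (2 * k) (t - y)) * hs 1 y + cmod (exp_ker False (2 * k) (t - y)) * hs (-1) y" for t y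
  proof -
    have "p t y = 0 \<or> q t y = 0" by (auto simp: p_def q_def exp_ker_def)
    then have "w t y = (cmod (p t y))\<^sup>2 * hs 1 y + (cmod (q t y))\<^sup>2 * hs (-1) y"
    proof
      assume 0: "q t y = 0"
      have "a l t y = p t y * (\<zeta> * A y $ 1 $ l + 1 * A y $ 2 $ l) / 2"
        "b l t y = p t y * (1 * A y $ 1 $ l + A y $ 2 $ l / \<zeta>) / 2" for l
        by (simp_all add: a_def b_def 0 algebra_simps)
      then have n: "(cmod (a l t y))\<^sup>2 = (cmod (p t y))\<^sup>2 * (cmod (\<zeta> * A y $ 1 $ l + 1 * A y $ 2 $ l))\<^sup>2 / 4"
        "(cmod (b l t y))\<^sup>2 = (cmod (p t y))\<^sup>2 * (cmod (1 * A y $ 1 $ l + A y $ 2 $ l / \<zeta>))\<^sup>2 / 4" for l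
        by (simp_all only: norm_mult norm_divide power_mult_distrib power_divide) simp_all
      show ?thesis
        unfolding w_def hs_def 0 n by (simp add: ring_distribs add_divide_distrib)
    next
      assume 0: "p t y = 0"
      have "a l t y = q t y * (\<zeta> * A y $ 1 $ l + (-1) * A y $ 2 $ l) / 2"
        "b l t y = q t y * ((-1) * A y $ 1 $ l + A y $ 2 $ l / \<zeta>) / 2" for l
        by (simp_all add: a_def b_def 0 algebra_simps)
      then have n: "(cmod (a l t y))\<^sup>2 = (cmod (q t y))\<^sup>2 * (cmod (\<zeta> * A y $ 1 $ l + (-1) * A y $ 2 $ l))\<^sup>2 / 4"
        "(cmod (b l t y))\<^sup>2 = (cmod (q t y))\<^sup>2 * (cmod ((-1) * A y $ 1 $ l + A y $ 2 $ l / \<zeta>))\<^sup>2 / 4" for l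
        by (simp_all only: norm_mult norm_divide power_mult_distrib power_divide) simp_all
      show ?thesis
        unfolding w_def hs_def 0 n by (simp add: ring_distribs add_divide_distrib)
    qed
    then show ?thesis by (simp add: p_def q_def norm_exp_ker_square)
  qed
  \<comment> \<open>By the parallelogram law the products of the first with the second row of A
    cancel between the two signs, and only the squared lengths of the rows survive.\<close>
  have par: "hs 1 y + hs (-1) y = (((cmod \<zeta>)\<^sup>2 + 1) * ((cmod (A y $ 1 $ 1))\<^sup>2 + (cmod (A y $ 1 $ 2))\<^sup>2) +
      (1 + (1 / cmod \<zeta>)\<^sup>2) * ((cmod (A y $ 2 $ 1))\<^sup>2 + (cmod (A y $ 2 $ 2))\<^sup>2)) / 2" for y
  proof -
    have e: "(cmod (u + v))\<^sup>2 + (cmod (u - v))\<^sup>2 = 2 * (cmod u)\<^sup>2 + 2 * (cmod v)\<^sup>2" for u v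
      unfolding cmod_power2 by (simp add: power2_eq_square algebra_simps)
    have "hs 1 y + hs (-1) y = (((cmod (\<zeta> * A y $ 1 $ 1 + A y $ 2 $ 1))\<^sup>2 + (cmod (\<zeta> * A y $ 1 $ 1 - A y $ 2 $ 1))\<^sup>2) +
        ((cmod (\<zeta> * A y $ 1 $ 2 + A y $ 2 $ 2))\<^sup>2 + (cmod (\<zeta> * A y $ 1 $ 2 - A y $ 2 $ 2))\<^sup>2) +
        ((cmod (A y $ 2 $ 1 / \<zeta> + A y $ 1 $ 1))\<^sup>2 + (cmod (A y $ 2 $ 1 / \<zeta> - A y $ 1 $ 1))\<^sup>2) +
        ((cmod (A y $ 2 $ 2 / \<zeta> + A y $ 1 $ 2))\<^sup>2 + (cmod (A y $ 2 $ 2 / \<zeta> - A y $ 1 $ 2))\<^sup>2)) / 4"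
      by (simp add: hs_def add.commute add_divide_distrib)
    then show ?thesis
      unfolding e by (simp add: norm_mult norm_divide power_mult_distrib power_divide algebra_simps add_divide_distrib)
  qed
  have ihs: "integrable lborel (\<lambda>y. hs 1 y + hs (-1) y)" "(LINT y|lborel. hs 1 y + hs (-1) y) = hs_bound \<zeta> A"
  proof -
    have "integrable lborel (\<lambda>y. (cmod (A y $ i $ 1))\<^sup>2 + (cmod (A y $ i $ 2))\<^sup>2)" for i
      using A by (auto simp: csq_def)
    then show "integrable lborel (\<lambda>y. hs 1 y + hs (-1) y)" "(LINT y|lborel. hs 1 y + hs (-1) y) = hs_bound \<zeta> A"
      unfolding par hs_bound_def row_norm_def by simp_all
  qed
  have hsb0: "0 \<le> hs_bound \<zeta> A"
    unfolding ihs(2)[symmetric] by (rule Bochner_Integration.integral_nonneg) (simp add: hs0)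
  have k2: "0 < Im (2 * k)" using k by simp
  have "(LINT y|lborel. w t y) \<le> hs_bound \<zeta> A"
    unfolding ihs(2)[symmetric]
  proof (rule integral_mono[OF iw ihs(1)])
    show "w t y \<le> hs 1 y + hs (-1) y" for y
      unfolding w_eq by (intro add_mono mult_left_le_one_le hs0 norm_exp_ker_le_1[OF k2]) auto
  qed
  from mult_right_mono[OF this zero_le_power2[of "norm f"]] Uw[of t]
  show "(norm (green_conv k \<zeta> (rep_l2 g) t))\<^sup>2 \<le> hs_bound \<zeta> A * (norm f)\<^sup>2" by linarith
  have w0: "0 \<le> w t y" for t y by (simp add: w_def)
  have sU: "sq_int (green_conv k \<zeta> (rep_l2 g))" by (rule green_conv_sq_int[OF k sq_int_rep])
  have "ennreal ((norm (green_op k \<zeta> g))\<^sup>2) = (\<integral>\<^sup>+t. ennreal ((norm (green_conv k \<zeta> (rep_l2 g) t))\<^sup>2) \<partial>lborel)"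
    unfolding norm_l2_nn_integral
    by (rule nn_integral_cong_AE) (use rep_green_op[OF k, of \<zeta> g] in eventually_elim, simp)
  also have "\<dots> \<le> (\<integral>\<^sup>+t. (\<integral>\<^sup>+y. ennreal (w t y) \<partial>lborel) * ennreal ((norm f)\<^sup>2) \<partial>lborel)"
  proof (rule nn_integral_mono)
    fix t
    have "(\<integral>\<^sup>+y. ennreal (w t y) \<partial>lborel) * ennreal ((norm f)\<^sup>2) = ennreal ((LINT y|lborel. w t y) * (norm f)\<^sup>2)"
      by (subst nn_integral_eq_integral[OF iw]) (auto simp: w0 intro!: ennreal_mult[symmetric] Bochner_Integration.integral_nonneg)
    then show "ennreal ((norm (green_conv k \<zeta> (rep_l2 g) t))\<^sup>2) \<le> (\<integral>\<^sup>+y. ennreal (w t y) \<partial>lborel) * ennreal ((norm f)\<^sup>2)"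
      by (simp add: ennreal_leI Uw)
  qed
  also have "\<dots> = (\<integral>\<^sup>+t. \<integral>\<^sup>+y. ennreal (w t y) \<partial>lborel \<partial>lborel) * ennreal ((norm f)\<^sup>2)"
    by (rule nn_integral_multc) (unfold w_eq, measurable)
  also have "(\<integral>\<^sup>+t. \<integral>\<^sup>+y. ennreal (w t y) \<partial>lborel \<partial>lborel) = (\<integral>\<^sup>+y. \<integral>\<^sup>+t. ennreal (w t y) \<partial>lborel \<partial>lborel)"
    by (rule lborel_pair.Fubini') (unfold w_eq, measurable)
  \<comment> \<open>Each half-line contributes the mass 1 / (2 Im k) of the squared exponential. As
    the two masses agree, only the sum over the signs enters.\<close>
  also have "\<dots> = (\<integral>\<^sup>+y. ennreal (1 / Im (2 * k)) * ennreal (hs 1 y + hs (-1) y) \<partial>lborel)"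
  proof (rule nn_integral_cong)
    fix y
    show "(\<integral>\<^sup>+t. ennreal (w t y) \<partial>lborel) = ennreal (1 / Im (2 * k)) * ennreal (hs 1 y + hs (-1) y)"
      unfolding w_eq
      by (simp add: ennreal_plus ennreal_mult hs0 nn_integral_add nn_integral_multc nn_integral_exp_ker_shift[OF k2, simplified] distrib_left)
  qed
  also have "\<dots> = ennreal (1 / Im (2 * k)) * ennreal (hs_bound \<zeta> A)"
    by (subst nn_integral_cmult, measurable, subst nn_integral_eq_integral[OF ihs(1)])
      (auto simp: hs0 ihs(2))
  finally have "ennreal ((norm (green_op k \<zeta> g))\<^sup>2) \<le> ennreal (1 / Im (2 * k)) * ennreal (hs_bound \<zeta> A) * ennreal ((norm f)\<^sup>2)" .
  also have "\<dots> = ennreal (1 / Im (2 * k) * hs_bound \<zeta> A * (norm f)\<^sup>2)"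
    using k2 hsb0 by (simp add: ennreal_mult[symmetric] del: Im_divide)
  finally have "(norm (green_op k \<zeta> g))\<^sup>2 \<le> 1 / Im (2 * k) * hs_bound \<zeta> A * (norm f)\<^sup>2"
    by (subst (asm) ennreal_le_iff) (use k2 hsb0 in auto)
  then show "(norm (green_op k \<zeta> g))\<^sup>2 \<le> hs_bound \<zeta> A / (2 * Im k) * (norm f)\<^sup>2"
    by simp
qed

text \<open>Both k \<zeta> and k / \<zeta> have imaginary part Im z. The second gives
  \<open>Im z * (cmod \<zeta>)\<^sup>2\<close> = Im (k cnj \<zeta>), and adding Im (k \<zeta>)
  leaves 2 Im k Re \<zeta>. Dividing by the square of |\<zeta>| gives the companion identity for 1 /
  \<zeta>.\<close>

lemma hs_bound_Re:
  "Im z * (hs_bound \<zeta> A / (2 * Im k)) = (Re \<zeta> * row_norm A 1 + Re (1 / \<zeta>) * row_norm A 2) / 2"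
proof -
  have "k / \<zeta> = z - of_real m" using \<zeta>k \<zeta>_nonzero by (simp add: field_simps)
  have z1: "Im z = Im (k * \<zeta>)" by (simp add: k\<zeta>)
  have z2: "Im z = Im (k / \<zeta>)" using \<open>k / \<zeta> = _\<close> by simp
  have n: "(cmod \<zeta>)\<^sup>2 > 0" using \<zeta>_nonzero by simp
  have "Im z * (cmod \<zeta>)\<^sup>2 = Im (k * cnj \<zeta>)"
    using z2 n by (subst (asm) complex_div_cnj) (simp add: field_simps)
  with z1 have e: "Im z * ((cmod \<zeta>)\<^sup>2 + 1) = 2 * Im k * Re \<zeta>"
    by (simp add: algebra_simps)
  have r: "Re (1 / \<zeta>) = Re \<zeta> / (cmod \<zeta>)\<^sup>2"
    by (subst complex_div_cnj) simp
  have e2: "Im z * (1 + (1 / cmod \<zeta>)\<^sup>2) = 2 * Im k * Re (1 / \<zeta>)"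
  proof -
    have "1 + (1 / cmod \<zeta>)\<^sup>2 = ((cmod \<zeta>)\<^sup>2 + 1) / (cmod \<zeta>)\<^sup>2"
      using n by (simp add: power_divide field_simps)
    then show ?thesis unfolding r using e by (metis times_divide_eq_right)
  qed
  have "Im z * (hs_bound \<zeta> A / (2 * Im k)) =
      (Im z * ((cmod \<zeta>)\<^sup>2 + 1) * row_norm A 1 + Im z * (1 + (1 / cmod \<zeta>)\<^sup>2) * row_norm A 2) / (4 * Im k)"
    unfolding hs_bound_def by (simp add: algebra_simps)
  also have "\<dots> = (Re \<zeta> * row_norm A 1 + Re (1 / \<zeta>) * row_norm A 2) / 2"
    unfolding e e2 using k by (simp add: add_divide_distrib)
  finally show ?thesis .
qed

end

text \<open>Off the two rays no root is real: a real root s would give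
  \<open>z\<^sup>2 = m\<^sup>2 + s\<^sup>2\<close>, so z would be real with modulus at least m.
  Hence exactly one of the two roots lies in the upper half plane and the definite description is
  meaningful.\<close>

lemma green_dirac_sqrt:
  assumes m: "0 \<le> m" and z: "z \<notin> {complex_of_real x |x. x \<le> - m \<or> m \<le> x}"
  shows "green m z (dirac_sqrt m z) ((z + of_real m) / dirac_sqrt m z)"
proof -
  define c where "c = z\<^sup>2 - (complex_of_real m)\<^sup>2"
  define s where "s = csqrt c"
  have s2: "s\<^sup>2 = c" by (simp add: s_def)
  have "Im s \<noteq> 0"
  proof
    assume "Im s = 0"
    then have "s = of_real (Re s)" by (simp add: complex_eq_iff)
    then have "c = of_real ((Re s)\<^sup>2)" using s2 by (metis of_real_power)
    then have z2: "z\<^sup>2 = of_real (m\<^sup>2 + (Re s)\<^sup>2)" by (simp add: c_def algebra_simps)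
    define t where "t = sqrt (m\<^sup>2 + (Re s)\<^sup>2)"
    have t: "m \<le> t" unfolding t_def by (rule real_le_rsqrt) simp
    have "t\<^sup>2 = m\<^sup>2 + (Re s)\<^sup>2" by (simp add: t_def)
    then have "z\<^sup>2 = (of_real t)\<^sup>2" unfolding z2 by (metis of_real_power)
    then have "z = of_real t \<or> z = of_real (- t)" by (simp add: power2_eq_iff)
    then show False using z t by force
  qed
  define w where "w = (if 0 < Im s then s else - s)"
  have w: "w\<^sup>2 = c" "0 < Im w" using s2 \<open>Im s \<noteq> 0\<close> by (auto simp: w_def)
  have dw: "dirac_sqrt m z = w"
    unfolding dirac_sqrt_def
  proof (rule the_equality)
    show "w\<^sup>2 = z\<^sup>2 - (complex_of_real m)\<^sup>2 \<and> 0 < Im w" using w by (simp add: c_def)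
    fix v assume v: "v\<^sup>2 = z\<^sup>2 - (complex_of_real m)\<^sup>2 \<and> 0 < Im v"
    then have "v\<^sup>2 = w\<^sup>2" using w by (simp add: c_def)
    then have "v = w \<or> v = - w" by (simp add: power2_eq_iff)
    then show "v = w" using v w by auto
  qed
  have w0: "w \<noteq> 0" using w by auto
  show ?thesis
    unfolding dw
  proof
    show "(z + of_real m) / w * (z - of_real m) = w"
      using w(1) w0 by (simp add: c_def power2_eq_square field_simps)
  qed (use w w0 in auto)
qed

text \<open>The equations say that exp (\<i> \<kappa> x) (v, w) is a bounded solution of H_0 f = lam
  f. The determinant of the system vanishes for
  \<open>\<kappa>\<^sup>2 = lam\<^sup>2 - m\<^sup>2\<close>. A solution read off from one row may be
  zero, so the choice depends on which of lam - m and lam + m is nonzero.\<close>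

lemma dirac_plane_wave:
  assumes "m \<le> \<bar>lam\<bar>" "0 \<le> (m::real)"
  obtains \<kappa> :: real and v w :: complex where
    "of_real \<kappa> * w = of_real (lam - m) * v" "of_real \<kappa> * v = of_real (lam + m) * w" "v \<noteq> 0 \<or> w \<noteq> 0"
proof -
  define \<kappa> where "\<kappa> = sqrt (lam\<^sup>2 - m\<^sup>2)"
  have "m\<^sup>2 \<le> lam\<^sup>2" using power_mono[OF assms, of 2] by simp
  then have k2: "\<kappa> * \<kappa> = (lam - m) * (lam + m)"
    by (simp add: \<kappa>_def algebra_simps power2_eq_square)
  have k2c: "complex_of_real \<kappa> * of_real \<kappa> = of_real ((lam - m) * (lam + m))"
    using k2 by (metis of_real_mult)
  consider "lam \<noteq> m" | "lam + m \<noteq> 0" | "lam = 0" "m = 0" by fastforce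
  then show ?thesis
  proof cases
    case 1
    show ?thesis
      by (rule that[of \<kappa> "of_real (lam - m)" "of_real \<kappa>"]) (use 1 k2c in \<open>auto simp: algebra_simps\<close>)
  next
    case 2
    then have "complex_of_real (lam + m) \<noteq> 0" by (simp only: of_real_eq_0_iff) simp
    then show ?thesis
      by (intro that[of \<kappa> "of_real \<kappa>" "of_real (lam + m)"]) (use k2c in \<open>auto simp: algebra_simps\<close>)
  next
    case 3
    then show ?thesis by (intro that[of 0 0 1]) auto
  qed
qed

section \<open>Damped plane waves and the spectrum of the free operator\<close>

definition damped_wave :: "real \<Rightarrow> real \<Rightarrow> real \<Rightarrow> real \<Rightarrow> complex" where
  "damped_wave e s \<kappa> x = exp (of_real (- (e * \<bar>x - s\<bar>)) + \<i> * of_real (\<kappa> * x))"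

lemma norm_damped_wave: "cmod (damped_wave e s \<kappa> x) = exp (- (e * \<bar>x - s\<bar>))"
  by (simp add: damped_wave_def)

lemma integrable_exp_minus_abs_shift:
  fixes c s :: real
  assumes "0 < c"
  shows "integrable lborel (\<lambda>x. exp (- (c * \<bar>x - s\<bar>)))"
    "(LINT x|lborel. exp (- (c * \<bar>x - s\<bar>))) = (LINT x|lborel. exp (- (c * \<bar>x\<bar>)))"
proof -
  show "integrable lborel (\<lambda>x. exp (- (c * \<bar>x - s\<bar>)))"
    using lborel_integrable_real_affine[OF integrable_exp_minus_abs[OF assms], of 1 "- s"] by (simp add: algebra_simps)
  show "(LINT x|lborel. exp (- (c * \<bar>x - s\<bar>))) = (LINT x|lborel. exp (- (c * \<bar>x\<bar>)))"
    by (subst (2) lborel_integral_real_affine[where c = 1 and t = "- s"]) (simp_all add: algebra_simps)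
qed

lemma damped_wave_measurable [measurable]: "damped_wave e s \<kappa> \<in> borel_measurable borel"
  unfolding damped_wave_def[abs_def]
  by (intro borel_measurable_continuous_onI continuous_intros)

lemma csq_damped_wave: "0 < e \<Longrightarrow> csq (damped_wave e s \<kappa>)"
  using integrable_exp_minus_abs_shift(1)[of "2 * e" s]
  by (simp add: csq_def norm_damped_wave power2_eq_square mult.assoc flip: exp_add)

lemma damped_wave_integral:
  assumes "a \<le> b"
  shows "((\<lambda>x. (of_real (- e * sgn (x - s)) + \<i> * of_real \<kappa>) * damped_wave e s \<kappa> x) has_integral
    (damped_wave e s \<kappa> b - damped_wave e s \<kappa> a)) {a..b}"
proof (rule fundamental_theorem_of_calculus_interior_strong[of "{s}"])
  show "continuous_on {a..b} (damped_wave e s \<kappa>)"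
    unfolding damped_wave_def[abs_def] by (intro continuous_intros)
  fix x assume x: "x \<in> {a<..<b} - {s}"
  define S where "S = (if s < x then {s<..} else {..<s})"
  have S: "open S" "x \<in> S" "\<And>y. y \<in> S \<Longrightarrow> \<bar>y - s\<bar> = sgn (x - s) * (y - s)"
    using x by (auto simp: S_def sgn_real_def split: if_splits)
  let ?d = "complex_of_real (- e * sgn (x - s))"
  have "((\<lambda>w. exp (?d * (w - of_real s) + \<i> * of_real \<kappa> * w)) has_field_derivative
      (?d + \<i> * of_real \<kappa>) *
      exp (?d * (of_real x - of_real s) + \<i> * of_real \<kappa> * of_real x)) (at (of_real x))"
    by (auto intro!: derivative_eq_intros)
  from has_vector_derivative_real_field[OF this, of UNIV]
  have "((\<lambda>y. exp (?d * (of_real y - of_real s) + \<i> * of_real \<kappa> * of_real y)) has_vector_derivative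
      (?d + \<i> * of_real \<kappa>) *
      exp (?d * (of_real x - of_real s) + \<i> * of_real \<kappa> * of_real x)) (at x)" .
  moreover have eq: "exp (?d * (of_real y - of_real s) + \<i> * of_real \<kappa> * of_real y) =
      damped_wave e s \<kappa> y" if "y \<in> S" for y
    unfolding damped_wave_def S(3)[OF that] by (simp add: mult.assoc)
  ultimately show "(damped_wave e s \<kappa> has_vector_derivative
      (?d + \<i> * of_real \<kappa>) * damped_wave e s \<kappa> x) (at x)"
    using has_vector_derivative_transform_within_open[OF _ S(1,2) eq] eq[OF S(2)] by simp
qed (use assms in auto)

text \<open>On the damped plane wave \<open>exp (- \<epsilon> \<bar>x - s\<bar> + \<i> \<kappa> x) v\<close> the residual of
  \<open>H\<^sub>0 - \<lambda>\<close> has pointwise norm exactly \<open>\<epsilon>\<close> times that of the wave.\<close>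

lemma free_dirac_Weyl:
  assumes m: "0 \<le> m" "m \<le> \<bar>lam\<bar>" and e: "0 < e"
  obtains C where "0 < C"
    "\<And>s. \<exists>u r. (u, of_real lam *\<^sub>C u + r) \<in> free_dirac m \<and> norm r = e * norm u \<and>
      (AE x in lborel. norm (rep_l2 u x) = C * exp (- (e * \<bar>x - s\<bar>)))"
proof -
  obtain \<kappa> :: real and v w :: complex where vw:
    "of_real \<kappa> * w = of_real (lam - m) * v" "of_real \<kappa> * v = of_real (lam + m) * w" "v \<noteq> 0 \<or> w \<noteq> 0"
    using dirac_plane_wave[OF m(2,1)] by blast
  define C where "C = sqrt ((cmod v)\<^sup>2 + (cmod w)\<^sup>2)"
  have C: "0 < C" using vw(3) by (auto simp: C_def sum_power2_gt_zero_iff)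
  have "\<exists>u r. (u, of_real lam *\<^sub>C u + r) \<in> free_dirac m \<and> norm r = e * norm u \<and>
      (AE x in lborel. norm (rep_l2 u x) = C * exp (- (e * \<bar>x - s\<bar>)))" for s
  proof -
    define E where "E = damped_wave e s \<kappa>"
    have csE: "csq E" unfolding E_def by (rule csq_damped_wave[OF e])
    define sg where "sg x = complex_of_real (sgn (x - s))" for x
    have csgE: "csq (\<lambda>x. sg x * E x)"
    proof (rule csq_bound[OF _ csE, where C = 1])
      show "(\<lambda>x. sg x * E x) \<in> borel_measurable borel"
        unfolding sg_def E_def by measurable
    qed (auto simp: sg_def norm_mult sgn_real_def)
    define U where "U x = (vector [v * E x, w * E x] :: complex^2)" for x
    define D where "D x = (vector [v * (of_real (- e) * (sg x * E x) + \<i> * of_real \<kappa> * E x),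
        w * (of_real (- e) * (sg x * E x) + \<i> * of_real \<kappa> * E x)] :: complex^2)" for x
    \<comment> \<open>The exponential decay contributes - e sgn (x - s) to the logarithmic
      derivative; multiplied by - \<i> sigma1 it becomes the residual. As sigma1 only swaps the
      components, the norm is multiplied by e off the single point s.\<close>
    define R where "R x = (vector [\<i> * of_real e * w * (sg x * E x), \<i> * of_real e * v * (sg x * E x)] :: complex^2)" for x
    have sU: "sq_int U" and sD: "sq_int D" and sR: "sq_int R"
      unfolding sq_int_iff_csq U_def D_def R_def
      by (auto intro!: csq_cmult csq_add csq_diff csE csgE simp: mult.commute[of "E _"])
    define u u' r where "u = abs_l2 U" and "u' = abs_l2 D" and "r = abs_l2 R"
    note ae = rep_abs_l2[OF sU, folded u_def] rep_abs_l2[OF sD, folded u'_def] rep_abs_l2[OF sR, folded r_def]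
    have int: "(D has_integral (U b - U a)) {a..b}" if "a \<le> b" for a b
    proof -
      have "((\<lambda>x. of_real (- e) * (sg x * E x) + \<i> * of_real \<kappa> * E x) has_integral (E b - E a)) {a..b}"
        using damped_wave_integral[OF that, of e s \<kappa>] by (simp add: E_def sg_def algebra_simps)
      from has_integral_mult_right[OF this, of v] has_integral_mult_right[OF this, of w]
      show ?thesis
        unfolding has_integral_vec2 by (simp add: U_def D_def right_diff_distrib)
    qed
    have "(u, u') \<in> deriv_op"
      unfolding deriv_op_def using ae(1) int by (auto simp: has_integral_AE_cong[OF ae(2)])
    moreover have "AE x in lborel.
      dirac_eq m (rep_l2 (of_real lam *\<^sub>C u + r) x) (rep_l2 u' x) (rep_l2 u x)"
      using ae rep_plus[of "of_real lam *\<^sub>C u" r] rep_scaleC[of "of_real lam" u]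
    proof eventually_elim
      case (elim x)
      have "of_real lam * (v * E x) + \<i> * of_real e * w * (sg x * E x) =
          - \<i> * (w * (of_real (- e) * (sg x * E x) + \<i> * of_real \<kappa> * E x)) + of_real m * (v * E x)"
      proof -
        have "- \<i> * (w * (of_real (- e) * (sg x * E x) + \<i> * of_real \<kappa> * E x)) + of_real m * (v * E x) =
            \<i> * of_real e * w * (sg x * E x) + (of_real \<kappa> * w) * E x + of_real m * (v * E x)"
          by (simp add: algebra_simps)
        then show ?thesis unfolding vw(1) by (simp add: algebra_simps)
      qed
      moreover have "of_real lam * (w * E x) + \<i> * of_real e * v * (sg x * E x) =
          - \<i> * (v * (of_real (- e) * (sg x * E x) + \<i> * of_real \<kappa> * E x)) - of_real m * (w * E x)"
      proof -
        have "- \<i> * (v * (of_real (- e) * (sg x * E x) + \<i> * of_real \<kappa> * E x)) - of_real m * (w * E x) =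
            \<i> * of_real e * v * (sg x * E x) + (of_real \<kappa> * v) * E x - of_real m * (w * E x)"
          by (simp add: algebra_simps)
        then show ?thesis unfolding vw(2) by (simp add: algebra_simps)
      qed
      ultimately show ?case using elim by (simp add: U_def D_def R_def)
    qed
    ultimately have "(u, of_real lam *\<^sub>C u + r) \<in> free_dirac m" unfolding free_dirac_iff by blast
    moreover have nU: "norm (U x) = C * exp (- (e * \<bar>x - s\<bar>))" for x
    proof (rule power2_eq_imp_eq)
      show "(norm (U x))\<^sup>2 = (C * exp (- (e * \<bar>x - s\<bar>)))\<^sup>2"
        by (simp add: norm_vec2 U_def norm_mult power_mult_distrib C_def E_def norm_damped_wave distrib_right)
    qed (use C in auto)
    have "AE x in lborel. norm (rep_l2 u x) = C * exp (- (e * \<bar>x - s\<bar>))"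
      using ae(1) by eventually_elim (simp add: nU)
    moreover have "norm r = e * norm u"
    proof (rule power2_eq_imp_eq)
      have nR: "(norm (R x))\<^sup>2 = e\<^sup>2 * (norm (U x))\<^sup>2" if "x \<noteq> s" for x
        using that e by (simp add: norm_vec2 R_def U_def norm_mult power_mult_distrib sg_def sgn_real_def algebra_simps)
      have "(norm r)\<^sup>2 = (LINT x|lborel. e\<^sup>2 * (norm (rep_l2 u x))\<^sup>2)"
        unfolding norm_l2_integral
        by (rule integral_cong_AE, measurable)
          (use ae(1,3) AE_lborel_singleton[of s] in eventually_elim, simp add: nR)
      then show "(norm r)\<^sup>2 = (e * norm u)\<^sup>2" by (simp add: norm_l2_integral power_mult_distrib)
    qed (use e in auto)
    ultimately show ?thesis by blast
  qed
  with C show ?thesis by (rule that)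
qed

lemma norm_damped:
  assumes e: "0 < e" and u: "AE x in lborel. norm (rep_l2 u x) = C * exp (- (e * \<bar>x - s\<bar>))"
  shows "(norm u)\<^sup>2 = C\<^sup>2 * (LINT x|lborel. exp (- (2 * e * \<bar>x\<bar>)))"
proof -
  have "(norm u)\<^sup>2 = (LINT x|lborel. C\<^sup>2 * exp (- (2 * e * \<bar>x - s\<bar>)))"
    unfolding norm_l2_integral
    by (rule integral_cong_AE, measurable)
      (use u in eventually_elim, simp add: power_mult_distrib, simp add: power2_eq_square flip: exp_add)
  then show ?thesis
    using integrable_exp_minus_abs_shift[of "2 * e" s] e by simp
qed

lemma exp_minus_abs_integral_pos:
  assumes "0 < c"
  shows "0 < (LINT x|lborel. exp (- (c * \<bar>x\<bar>)) :: real)"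
proof -
  have "(LINT x|lborel. exp (- (c * \<bar>x\<bar>)) :: real) \<noteq> 0"
  proof
    assume "(LINT x|lborel. exp (- (c * \<bar>x\<bar>)) :: real) = 0"
    then have "AE x in lborel. exp (- (c * \<bar>x\<bar>)) = (0 :: real)"
      using integrable_exp_minus_abs[OF assms] by (subst (asm) integral_nonneg_eq_0_iff_AE) auto
    then have "AE x :: real in lborel. False" by simp
    then show False by (simp add: eventually_False ae_filter_eq_bot_iff)
  qed
  moreover have "0 \<le> (LINT x|lborel. exp (- (c * \<bar>x\<bar>)) :: real)"
    by (rule Bochner_Integration.integral_nonneg) simp
  ultimately show ?thesis by (metis less_le)
qed

lemma bounded_op_bound:
  assumes "bounded_op T"
  obtains K where "0 < K" "\<And>f g. (f, g) \<in> T \<Longrightarrow> norm g \<le> K * norm f"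
proof -
  obtain F where F: "bounded_linear F" "T = {(f, F f) |f. True}"
    using assms by (auto simp: bounded_op_def)
  obtain K where "0 < K" "\<And>f. norm (F f) \<le> norm f * K"
    using bounded_linear.pos_bounded[OF F(1)] by blast
  then show ?thesis using F(2) by (intro that[of K]) (auto simp: mult.commute)
qed

lemma notin_resolvent_set_free_dirac:
  assumes m: "0 \<le> m" "m \<le> \<bar>lam\<bar>"
  shows "complex_of_real lam \<notin> resolvent_set (free_dirac m)"
proof
  assume "complex_of_real lam \<in> resolvent_set (free_dirac m)"
  then have "bounded_op (resolvent (free_dirac m) (of_real lam))" by (simp add: resolvent_set_def)
  then obtain K where K: "0 < K" "\<And>f g. (f, g) \<in> resolvent (free_dirac m) (of_real lam) \<Longrightarrow> norm g \<le> K * norm f"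
    using bounded_op_bound by blast
  \<comment> \<open>With this rate the bound on the resolvent would give norm u \<le> norm u /
    2.\<close>
  define e where "e = 1 / (2 * K)"
  have e: "0 < e" using K by (simp add: e_def)
  obtain C where C: "0 < C" "\<And>s. \<exists>u r. (u, of_real lam *\<^sub>C u + r) \<in> free_dirac m \<and> norm r = e * norm u \<and>
      (AE x in lborel. norm (rep_l2 u x) = C * exp (- (e * \<bar>x - s\<bar>)))"
    using free_dirac_Weyl[OF m e] by blast
  from C(2)[of 0] obtain u r where u: "(u, of_real lam *\<^sub>C u + r) \<in> free_dirac m" "norm r = e * norm u"
    "AE x in lborel. norm (rep_l2 u x) = C * exp (- (e * \<bar>x - 0\<bar>))" by blast
  have "(r, u) \<in> resolvent (free_dirac m) (of_real lam)"
    using u(1) by (force simp: resolvent_def op_shift_def)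
  from K(2)[OF this] have "norm u \<le> norm u / 2" using K(1) unfolding u(2) by (simp add: e_def)
  then have "norm u = 0" using norm_ge_zero[of u] by linarith
  moreover have "(norm u)\<^sup>2 > 0"
    unfolding norm_damped[OF e u(3)] using C(1) e exp_minus_abs_integral_pos[of "2 * e"] by simp
  ultimately show False by simp
qed

section \<open>Borel representatives and factorization of the potential\<close>

lemma lebesgue_complex_ex_borel:
  fixes f :: "real \<Rightarrow> complex"
  assumes "f \<in> borel_measurable lebesgue"
  obtains g where "g \<in> borel_measurable borel" "AE x in lborel. f x = g x"
proof -
  have "(\<lambda>x. Re (f x)) \<in> borel_measurable (completion lborel)" "(\<lambda>x. Im (f x)) \<in> borel_measurable (completion lborel)"
    using assms by measurable
  then obtain a b where ab: "a \<in> borel_measurable lborel" "AE x in lborel. Re (f x) = a x"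
      "b \<in> borel_measurable lborel" "AE x in lborel. Im (f x) = b x"
    using completion_ex_borel_measurable_real by metis
  have "(\<lambda>x. complex_of_real (a x) + \<i> * complex_of_real (b x)) \<in> borel_measurable borel"
    using ab(1,3) by measurable
  moreover have "AE x in lborel. f x = complex_of_real (a x) + \<i> * complex_of_real (b x)"
    using ab(2,4) by eventually_elim (simp add: complex_eq_iff)
  ultimately show ?thesis by (rule that)
qed

lemma mult_op_cong:
  assumes "AE x in lborel. M x = N x"
  shows "mult_op M = mult_op N"
proof -
  have "(AE x in lborel. rep_l2 g x = M x *v rep_l2 f x) \<longleftrightarrow> (AE x in lborel. rep_l2 g x = N x *v rep_l2 f x)" for f g
  proof
    show "AE x in lborel. rep_l2 g x = N x *v rep_l2 f x" if "AE x in lborel. rep_l2 g x = M x *v rep_l2 f x"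
      using assms that by eventually_elim simp
    show "AE x in lborel. rep_l2 g x = M x *v rep_l2 f x" if "AE x in lborel. rep_l2 g x = N x *v rep_l2 f x"
      using assms that by eventually_elim simp
  qed
  then show ?thesis by (simp add: mult_op_def)
qed

text \<open>After this lemma the polar decomposition and the square roots are gone: the operators A
  and B of the definition of H are multiplication by A and by \<i> A with one explicit Borel
  function. The entries of A are square integrable because the rows of A have squared lengths equal
  to the diagonal entries of \<open>Vt\<close>.\<close>

lemma potential_factorization:
  fixes Vt :: "real \<Rightarrow> complex^2^2"
  assumes psd: "AE x in lebesgue. psd (Vt x)"
    and int: "\<And>i j. integrable lebesgue (\<lambda>x. Vt x $ i $ j)"
  obtains A where "\<And>i j. csq (\<lambda>x. A x $ i $ j)" "AE x in lborel. cadjoint (A x) = A x"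
    "op_A (\<lambda>x. iscale (Vt x)) = mult_op A" "op_B (\<lambda>x. iscale (Vt x)) = mult_op (\<lambda>x. iscale (A x))"
    "\<And>i. row_norm A i = L1_norm (\<lambda>x. Vt x $ i $ i)"
proof -
  have "\<exists>g. g \<in> borel_measurable borel \<and> (AE x in lborel. Vt x $ i $ j = g x)" for i j
    using lebesgue_complex_ex_borel[OF borel_measurable_integrable[OF int[of i j]]] by metis
  then obtain g where g: "\<And>i j. g i j \<in> borel_measurable borel" "\<And>i j. AE x in lborel. Vt x $ i $ j = g i j x"
    by metis
  define W where "W x = (\<chi> i j. g i j x)" for x
  have [measurable]: "(\<lambda>x. W x $ i $ j) \<in> borel_measurable borel" for i j
    by (simp add: W_def g)
  have WV: "AE x in lborel. W x = Vt x"
    using g(2)[of 1 1] g(2)[of 1 2] g(2)[of 2 1] g(2)[of 2 2]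
    by eventually_elim (simp add: mat2_eq_iff W_def)
  have psd': "AE x in lborel. psd (Vt x)" using psd by (simp add: AE_completion_iff)
  \<comment> \<open>The closed formula for the root is evidently measurable in the entries, in
    contrast to a pointwise definite description. Off a null set \<open>W\<close> is the positive
    semidefinite \<open>Vt\<close>.\<close>
  define A where "A x = psd_root (W x)" for x
  have good: "AE x in lborel. psd (Vt x) \<and> W x = Vt x \<and> A x = psd_root (Vt x)"
    using WV psd' by eventually_elim (simp add: A_def)
  have meas: "(\<lambda>x. A x $ i $ j) \<in> borel_measurable borel" for i j
    unfolding A_def psd_root_def root_trace_def root_det_def vec_lambda_beta by measurable
  have row: "AE x in lborel. (cmod (A x $ i $ 1))\<^sup>2 + (cmod (A x $ i $ 2))\<^sup>2 = cmod (W x $ i $ i)" for i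
    using good
  proof eventually_elim
    case (elim x)
    then have p: "psd (Vt x)" and e: "W x = Vt x" "A x = psd_root (Vt x)" by auto
    have pA: "psd (A x)" "A x ** A x = Vt x" unfolding e using psd_root_psd[OF p] by auto
    have h: "A x $ j $ l = cnj (A x $ l $ j)" for j l
      using pA(1) cadjoint_nth[of "A x" j l] by (simp add: psd_def)
    have "Vt x $ i $ i = A x $ i $ 1 * cnj (A x $ i $ 1) + A x $ i $ 2 * cnj (A x $ i $ 2)"
      unfolding pA(2)[symmetric] mat2_mult_nth using h[of 1 i] h[of 2 i] by simp
    also have "\<dots> = of_real ((cmod (A x $ i $ 1))\<^sup>2 + (cmod (A x $ i $ 2))\<^sup>2)"
      by (simp only: of_real_add complex_norm_square)
    finally show ?case unfolding e(1) by (simp only: norm_of_real) simp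
  qed
  have intW: "integrable lborel (\<lambda>x. cmod (W x $ i $ i))" "(LINT x|lborel. cmod (W x $ i $ i)) = L1_norm (\<lambda>x. Vt x $ i $ i)" for i
  proof -
    have ae: "AE x in lebesgue. Vt x $ i $ i = W x $ i $ i"
      using AE_completion[OF WV] by eventually_elim simp
    have mW: "(\<lambda>x. W x $ i $ i) \<in> borel_measurable lborel" by measurable
    have "integrable lebesgue (\<lambda>x. W x $ i $ i)"
      using int[of i i] by (subst integrable_cong_AE[symmetric, OF _ _ ae]) (use mW in \<open>auto intro: measurable_completion borel_measurable_integrable\<close>)
    then have "integrable lborel (\<lambda>x. W x $ i $ i)" using mW by (simp add: integrable_completion)
    then show "integrable lborel (\<lambda>x. cmod (W x $ i $ i))" by (rule integrable_norm)
    have "L1_norm (\<lambda>x. Vt x $ i $ i) = (LINT x|lebesgue. cmod (W x $ i $ i))"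
      unfolding L1_norm_def
    proof (rule integral_cong_AE)
      show "(\<lambda>x. cmod (Vt x $ i $ i)) \<in> borel_measurable lebesgue"
        using borel_measurable_integrable[OF int[of i i]] by measurable
      show "(\<lambda>x. cmod (W x $ i $ i)) \<in> borel_measurable lebesgue"
        by (rule measurable_completion) measurable
      show "AE x in lebesgue. cmod (Vt x $ i $ i) = cmod (W x $ i $ i)"
        using ae by eventually_elim simp
    qed
    also have "\<dots> = (LINT x|lborel. cmod (W x $ i $ i))"
      by (rule integral_completion) measurable
    finally show "(LINT x|lborel. cmod (W x $ i $ i)) = L1_norm (\<lambda>x. Vt x $ i $ i)" by simp
  qed
  show ?thesis
  proof (rule that[of A])
    show "csq (\<lambda>x. A x $ i $ j)" for i j
      unfolding csq_def
    proof (rule conjI, rule meas, rule Bochner_Integration.integrable_bound[OF intW(1)[of i]])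
      show "AE x in lborel. norm ((cmod (A x $ i $ j))\<^sup>2) \<le> norm (cmod (W x $ i $ i))"
        using row[of i]
      proof eventually_elim
        case (elim x)
        have "(cmod (A x $ i $ j))\<^sup>2 \<le> (cmod (A x $ i $ 1))\<^sup>2 + (cmod (A x $ i $ 2))\<^sup>2"
          using exhaust_2[of j] by auto
        then show ?case using elim by simp
      qed
    qed (use meas in measurable)
    show "AE x in lborel. cadjoint (A x) = A x"
      using good by eventually_elim (use psd_root_psd(1) in \<open>auto simp: psd_def\<close>)
    show "op_A (\<lambda>x. iscale (Vt x)) = mult_op A"
      unfolding op_A_def
      by (rule mult_op_cong) (use good in eventually_elim, simp add: mat_abs_iscale psd_sqrt_eq_psd_root)
    show "op_B (\<lambda>x. iscale (Vt x)) = mult_op (\<lambda>x. iscale (A x))"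
      unfolding op_B_def
      by (rule mult_op_cong)
        (use good in eventually_elim, simp add: mat_abs_iscale psd_sqrt_eq_psd_root polar_part_iscale)
    show "row_norm A i = L1_norm (\<lambda>x. Vt x $ i $ i)" for i
      unfolding row_norm_def intW(2)[symmetric]
      by (rule integral_cong_AE[OF _ _ row]) (use meas in \<open>measurable\<close>)
  qed
qed

section \<open>The Birman--Schwinger operator\<close>

locale factor =
  fixes A :: "real \<Rightarrow> complex^2^2"
  assumes csA: "\<And>i j. csq (\<lambda>x. A x $ i $ j)"
    and herm: "AE x in lborel. cadjoint (A x) = A x"
begin

definition hs :: "real \<Rightarrow> real" where
  "hs x = ((cmod (A x $ 1 $ 1))\<^sup>2 + (cmod (A x $ 1 $ 2))\<^sup>2) + ((cmod (A x $ 2 $ 1))\<^sup>2 + (cmod (A x $ 2 $ 2))\<^sup>2)"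

abbreviation iA :: "real \<Rightarrow> complex^2^2" where "iA \<equiv> \<lambda>x. iscale (A x)"

lemma A_measurable [measurable]: "(\<lambda>x. A x $ i $ j) \<in> borel_measurable borel"
  using csA by (simp add: csq_def)

lemma hs_measurable [measurable]: "hs \<in> borel_measurable borel"
  unfolding hs_def[abs_def] by measurable

lemma hs_nonneg: "0 \<le> hs x" by (simp add: hs_def)

lemma hs_integrable: "integrable lborel hs"
  unfolding hs_def[abs_def] using csA by (auto simp: csq_def)

lemma norm_mult_le: "(norm (A x *v w))\<^sup>2 \<le> hs x * (norm w)\<^sup>2"
  using cmod_Cauchy_Schwarz[of "A x $ 1 $ 1" "w $ 1" "A x $ 1 $ 2" "w $ 2"]
    cmod_Cauchy_Schwarz[of "A x $ 2 $ 1" "w $ 1" "A x $ 2 $ 2" "w $ 2"]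
  unfolding norm_vec2 mat2_vec_nth hs_def by (simp add: distrib_right)

lemma mult_measurable:
  assumes "U \<in> borel_measurable borel"
  shows "(\<lambda>x. A x *v U x) \<in> borel_measurable borel"
  using assms unfolding measurable_vec2 mat2_vec_nth by auto

lemma norm_iA: "norm (iscale M *v w) = norm (M *v w)"
proof -
  have "iscale M *v w = \<i> *s (M *v w)"
    by (simp add: vec2_eq_iff mat2_vec_nth ring_distribs mult.assoc)
  then show ?thesis by (simp add: norm_vector_smult)
qed

text \<open>A has square-integrable entries but need not be bounded, so it maps bounded functions,
  rather than all of \<open>l2\<close>, into \<open>l2\<close>. Together with the uniform bound on
  the Green convolution this makes \<open>Q\<close> bounded.\<close>

lemma mult_bounded:
  assumes U: "U \<in> borel_measurable borel" and C: "\<And>x. (norm (U x))\<^sup>2 \<le> C"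
  shows "sq_int (\<lambda>x. A x *v U x)"
    "(LINT x|lborel. (norm (A x *v U x))\<^sup>2) \<le> (LINT x|lborel. hs x) * C"
proof -
  have pw: "(norm (A x *v U x))\<^sup>2 \<le> hs x * C" for x
    using norm_mult_le[of x "U x"] mult_left_mono[OF C[of x] hs_nonneg[of x]] by linarith
  have i: "integrable lborel (\<lambda>x. hs x * C)" using hs_integrable by simp
  have "integrable lborel (\<lambda>x. (norm (A x *v U x))\<^sup>2)"
    by (rule Bochner_Integration.integrable_bound[OF i])
      (use mult_measurable[OF U] pw in \<open>auto intro!: AE_I2 order_trans[OF _ abs_ge_self]\<close>)
  then show "sq_int (\<lambda>x. A x *v U x)" using mult_measurable[OF U] by (simp add: sq_int_def)
  show "(LINT x|lborel. (norm (A x *v U x))\<^sup>2) \<le> (LINT x|lborel. hs x) * C"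
    using integral_mono[OF \<open>integrable lborel (\<lambda>x. (norm (A x *v U x))\<^sup>2)\<close> i pw] by simp
qed

text \<open>Cutting f off to the set where \<open>hs\<close> is at most n puts it into the domain,
  and dominated convergence removes the cutoff.\<close>

lemma dense_domain: "closure {f. \<exists>g. (f, g) \<in> mult_op iA} = UNIV"
proof -
  have "f \<in> closure {f. \<exists>g. (f, g) \<in> mult_op iA}" for f
    unfolding closure_sequential
  proof (intro exI conjI allI)
    define u where "u n x = (if hs x \<le> real n then rep_l2 f x else 0)" for n :: nat and x
    have um [measurable]: "u n \<in> borel_measurable borel" for n
      unfolding u_def[abs_def] by measurable
    have su: "sq_int (u n)" for n
      unfolding sq_int_def
      by (auto intro!: Bochner_Integration.integrable_bound[OF rep_integrable[of f]] simp: u_def)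
    have sd: "sq_int (\<lambda>x. u n x - rep_l2 f x)" for n by (rule sq_int_diff[OF su sq_int_rep])
    show "abs_l2 (u n) \<in> {f. \<exists>g. (f, g) \<in> mult_op iA}" for n
    proof -
      have meas: "(\<lambda>x. iA x *v u n x) \<in> borel_measurable borel"
      proof -
        have e: "(\<lambda>x. iA x *v u n x) = (\<lambda>x. \<i> *s (A x *v u n x))"
          by (simp add: fun_eq_iff vec2_eq_iff mat2_vec_nth ring_distribs mult.assoc)
        have "(\<lambda>x. (A x *v u n x) $ 1) \<in> borel_measurable borel"
          "(\<lambda>x. (A x *v u n x) $ 2) \<in> borel_measurable borel"
          using mult_measurable[OF um[of n]] by (simp_all add: measurable_vec2)
        then show ?thesis
          unfolding e unfolding measurable_vec2 vector_smult_component
          by (intro conjI borel_measurable_times borel_measurable_const)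
      qed
      have "sq_int (\<lambda>x. iA x *v u n x)"
        unfolding sq_int_def
      proof
        have i: "integrable lborel (\<lambda>x. real n * (norm (rep_l2 f x))\<^sup>2)" by (simp add: rep_integrable)
        show "integrable lborel (\<lambda>x. (norm (iA x *v u n x))\<^sup>2)"
        proof (rule Bochner_Integration.integrable_bound[OF i])
          have "(norm (A x *v u n x))\<^sup>2 \<le> real n * (norm (rep_l2 f x))\<^sup>2" for x
          proof (cases "hs x \<le> real n")
            case True
            then show ?thesis
              using norm_mult_le[of x "rep_l2 f x"] mult_right_mono[OF True zero_le_power2[of "norm (rep_l2 f x)"]]
              by (simp add: u_def)
          qed (simp add: u_def)
          then show "AE x in lborel. norm ((norm (iA x *v u n x))\<^sup>2) \<le> norm (real n * (norm (rep_l2 f x))\<^sup>2)"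
            by (simp add: norm_iA)
        qed (use meas in measurable)
      qed (use meas in simp)
      from rep_abs_l2[OF this] rep_abs_l2[OF su[of n]]
      have "AE x in lborel. rep_l2 (abs_l2 (\<lambda>x. iA x *v u n x)) x = iA x *v rep_l2 (abs_l2 (u n)) x"
        by eventually_elim simp
      then have "(abs_l2 (u n), abs_l2 (\<lambda>x. iA x *v u n x)) \<in> mult_op iA"
        by (simp add: mult_op_def)
      then show ?thesis by blast
    qed
    have "(\<lambda>n. LINT x|lborel. (norm (u n x - rep_l2 f x))\<^sup>2) \<longlonglongrightarrow> (LINT x :: real|lborel. 0 :: real)"
    proof (rule integral_dominated_convergence[OF _ _ rep_integrable[of f]])
      show "AE x in lborel. (\<lambda>n. (norm (u n x - rep_l2 f x))\<^sup>2) \<longlonglongrightarrow> 0"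
      proof (rule AE_I2)
        fix x
        obtain N :: nat where N: "hs x \<le> real N" using real_arch_simple by blast
        then have "u n x = rep_l2 f x" if "n \<ge> N" for n
          using that by (auto simp: u_def intro: order_trans)
        then show "(\<lambda>n. (norm (u n x - rep_l2 f x))\<^sup>2) \<longlonglongrightarrow> 0"
          by (intro tendsto_eventually eventually_sequentiallyI[of N]) simp
      qed
    qed (auto simp: u_def)
    moreover have "(norm (abs_l2 (u n) - f))\<^sup>2 = (LINT x|lborel. (norm (u n x - rep_l2 f x))\<^sup>2)" for n
      unfolding norm_l2_integral
      by (rule integral_cong_AE, measurable)
        (use rep_minus[of "abs_l2 (u n)" f] rep_abs_l2[OF su[of n]] in eventually_elim, simp)
    ultimately have "(\<lambda>n. (norm (abs_l2 (u n) - f))\<^sup>2) \<longlonglongrightarrow> 0" by simp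
    from tendsto_real_sqrt[OF this] have "(\<lambda>n. norm (abs_l2 (u n) - f)) \<longlonglongrightarrow> 0" by simp
    then show "(\<lambda>n. abs_l2 (u n)) \<longlonglongrightarrow> f" by (simp add: LIM_zero_iff tendsto_norm_zero_iff)
  qed
  then show ?thesis by blast
qed

lemma hs_bound_iA: "hs_bound \<zeta> iA = hs_bound \<zeta> A"
  by (simp add: hs_bound_def row_norm_def norm_mult)

lemma row_norm_nonneg: "0 \<le> row_norm A i"
  unfolding row_norm_def by (rule Bochner_Integration.integral_nonneg) simp

lemma hs_bound_nonneg: "0 \<le> hs_bound \<zeta> A"
  unfolding hs_bound_def using row_norm_nonneg[of 1] row_norm_nonneg[of 2] by simp

lemma mult_op_add:
  assumes "(f, g) \<in> mult_op M" "(f', g') \<in> mult_op M"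
  shows "(f + f', g + g') \<in> mult_op M"
proof -
  have "AE x in lborel. rep_l2 g x = M x *v rep_l2 f x" "AE x in lborel. rep_l2 g' x = M x *v rep_l2 f' x"
    using assms by (auto simp: mult_op_def)
  then have "AE x in lborel. rep_l2 (g + g') x = M x *v rep_l2 (f + f') x"
    using rep_plus[of f f'] rep_plus[of g g'] by eventually_elim (simp add: matrix_vector_right_distrib)
  then show ?thesis by (simp add: mult_op_def)
qed

lemma mult_op_scaleC:
  assumes "(f, g) \<in> mult_op M"
  shows "(c *\<^sub>C f, c *\<^sub>C g) \<in> mult_op M"
proof -
  have "AE x in lborel. rep_l2 g x = M x *v rep_l2 f x"
    using assms by (auto simp: mult_op_def)
  then have "AE x in lborel. rep_l2 (c *\<^sub>C g) x = M x *v rep_l2 (c *\<^sub>C f) x"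
    using rep_scaleC[of c f] rep_scaleC[of c g]
    by eventually_elim (simp add: vec2_eq_iff mat2_vec_nth algebra_simps)
  then show ?thesis by (simp add: mult_op_def)
qed

end

locale birman_schwinger = factor A + green m z k \<zeta> for A m z k \<zeta>
begin

lemma csq_iA: "csq (\<lambda>x. iA x $ i $ j)"
  using csq_cmult[OF csA, of \<i>] by simp

lemma mult_green_bounds:
  assumes "(f, g) \<in> mult_op iA"
  shows "(norm (green_conv k \<zeta> (rep_l2 g) t))\<^sup>2 \<le> hs_bound \<zeta> A * (norm f)\<^sup>2"
    "(norm (green_op k \<zeta> g))\<^sup>2 \<le> hs_bound \<zeta> A / (2 * Im k) * (norm f)\<^sup>2"
  using green_conv_mult_bounds(1)[OF csq_iA, of g f t] green_conv_mult_bounds(2)[OF csq_iA, of g f] assms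
  by (simp_all add: mult_op_def hs_bound_iA)

lemma RB_closure_bound:
  assumes "(f, u) \<in> closure (mult_op iA O resolvent (free_dirac m) z)"
  shows "norm u \<le> sqrt (hs_bound \<zeta> A / (2 * Im k)) * norm f"
proof -
  define K where "K = hs_bound \<zeta> A / (2 * Im k)"
  have K: "0 \<le> K" using hs_bound_nonneg k by (simp add: K_def)
  have b: "norm u \<le> sqrt K * norm f" if fu: "(f, u) \<in> mult_op iA O resolvent (free_dirac m) z" for f u
  proof -
    obtain g where g: "(f, g) \<in> mult_op iA" "u = green_op k \<zeta> g"
      using fu by (auto simp: resolvent_iff)
    have "(norm u)\<^sup>2 \<le> (sqrt K * norm f)\<^sup>2"
      using mult_green_bounds(2)[OF g(1)] K by (simp add: g(2) K_def power_mult_distrib)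
    then show ?thesis by (rule power2_le_imp_le) (simp add: K)
  qed
  obtain X where X: "\<And>n. X n \<in> mult_op iA O resolvent (free_dirac m) z" "X \<longlonglongrightarrow> (f, u)"
    using assms by (auto simp: closure_sequential)
  have "(\<lambda>n. norm (snd (X n))) \<longlonglongrightarrow> norm u" "(\<lambda>n. sqrt K * norm (fst (X n))) \<longlonglongrightarrow> sqrt K * norm f"
    using tendsto_fst[OF X(2)] tendsto_snd[OF X(2)] by (auto intro!: tendsto_intros)
  moreover have "norm (snd (X n)) \<le> sqrt K * norm (fst (X n))" for n
    using b[of "fst (X n)" "snd (X n)"] X(1)[of n] by simp
  ultimately show ?thesis unfolding K_def[symmetric] by (auto intro: LIMSEQ_le)
qed

text \<open>Since \<open>B = \<i> A\<close>, the Birman--Schwinger operator is \<open>Q = \<i> A R\<^sub>0 A\<close>, so the real part of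
  \<open>I + Q\<close> is \<open>I - A (Im R\<^sub>0) A\<close>. The trace of \<open>A (Im R\<^sub>0) A\<close> bounds its norm.\<close>

lemma minus_one_in_resolvent_set_Q:
  assumes cond: "Im z \<le> 0 \<or> Re \<zeta> * row_norm A 1 + Re (1 / \<zeta>) * row_norm A 2 < 2"
  shows "-1 \<in> resolvent_set (closure (mult_op iA O resolvent (free_dirac m) z O mult_op A))"
proof -
  define q where "q = mult_op iA O resolvent (free_dirac m) z O mult_op A"
  have q_iff: "(f, h) \<in> q \<longleftrightarrow> (\<exists>g. (f, g) \<in> mult_op iA \<and> (green_op k \<zeta> g, h) \<in> mult_op A)" for f h
    unfolding q_def by (auto simp: resolvent_iff relcomp_unfold)
  let ?T = "\<lambda>g x. A x *v green_conv k \<zeta> (rep_l2 g) x"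
  define S where "S = (LINT x|lborel. hs x)"
  have S0: "0 \<le> S" unfolding S_def by (rule Bochner_Integration.integral_nonneg) (rule hs_nonneg)
  \<comment> \<open>The uniform bound for the resolvent of B f, multiplied by the
    square-integrability constant of A.\<close>
  define C where "C = sqrt (S * hs_bound \<zeta> A)"
  define K where "K = hs_bound \<zeta> A / (2 * Im k)"
  have K: "0 \<le> K" using hs_bound_nonneg k by (simp add: K_def)
  \<comment> \<open>For Im z \<le> 0 this is 0. For Im z > 0, \<open>hs_bound_Re\<close> makes it
    half the left-hand side of the criterion, hence less than 1. The coercivity constant of I + Q is
    1 - t.\<close>
  define t where "t = max 0 (Im z * K)"
  have t: "0 \<le> t" "t < 1"
    using cond hs_bound_Re[of A] mult_nonpos_nonneg[OF _ K, of "Im z"] by (auto simp: t_def K_def)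
  have bounded: "sq_int (?T g)"
    "(LINT x|lborel. (norm (?T g x))\<^sup>2) \<le> S * (hs_bound \<zeta> A * (norm f)\<^sup>2)"
    if "(f, g) \<in> mult_op iA" for f g
  proof -
    have m: "green_conv k \<zeta> (rep_l2 g) \<in> borel_measurable borel"
      using green_conv_sq_int[OF k sq_int_rep[of g]] by (simp add: sq_int_def)
    note mb = mult_bounded[OF m mult_green_bounds(1)[OF that]]
    show "sq_int (?T g)" by (rule mb(1))
    show "(LINT x|lborel. (norm (?T g x))\<^sup>2) \<le> S * (hs_bound \<zeta> A * (norm f)\<^sup>2)"
      unfolding S_def by (rule mb(2))
  qed
  have "-1 \<in> resolvent_set (closure q)"
  proof (rule minus_one_in_resolvent_set_closure[where C = C and c = "1 - t"])
    show "0 < 1 - t" "1 - t \<le> 1" using t by auto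
    show "0 \<le> C" using S0 hs_bound_nonneg by (simp add: C_def)
  next
    fix f g f' g' assume "(f, g) \<in> q" "(f', g') \<in> q"
    then show "(f + f', g + g') \<in> q"
      unfolding q_iff by (metis mult_op_add green_op_add[OF k])
  next
    fix a f g assume "(f, g) \<in> q"
    then show "(a *\<^sub>C f, a *\<^sub>C g) \<in> q"
      unfolding q_iff by (metis mult_op_scaleC green_op_scaleC[OF k])
  next
    \<comment> \<open>Once B f lies in \<open>l2\<close>, its resolvent is a bounded function, which
      A maps into \<open>l2\<close>; so the domain of \<open>q\<close> contains that of B.\<close>
    have "{f. \<exists>g. (f, g) \<in> mult_op iA} \<subseteq> Domain q"
    proof clarify
      fix f g assume fg: "(f, g) \<in> mult_op iA"
      have "(green_op k \<zeta> g, abs_l2 (?T g)) \<in> mult_op A"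
        unfolding mult_op_def mem_Collect_eq case_prod_conv
        using rep_abs_l2[OF bounded(1)[OF fg]] rep_green_op[OF k, of \<zeta> g] by eventually_elim simp
      then show "f \<in> Domain q" using fg unfolding Domain_iff q_iff by blast
    qed
    from closure_mono[OF this] show "closure (Domain q) = UNIV" by (simp add: dense_domain top.extremum_unique)
  next
    fix f h assume "(f, h) \<in> q"
    then obtain g where g: "(f, g) \<in> mult_op iA" "(green_op k \<zeta> g, h) \<in> mult_op A" by (auto simp: q_iff)
    have h: "AE x in lborel. rep_l2 h x = ?T g x"
      using g(2) unfolding mult_op_def mem_Collect_eq case_prod_conv
      using rep_green_op[OF k, of \<zeta> g] by eventually_elim simp
    have [measurable]: "(?T g) \<in> borel_measurable borel"
      using bounded(1)[OF g(1)] by (simp add: sq_int_def)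
    have "(norm h)\<^sup>2 = (LINT x|lborel. (norm (?T g x))\<^sup>2)"
      unfolding norm_l2_integral
      by (rule integral_cong_AE, measurable) (use h in eventually_elim, simp)
    also have "\<dots> \<le> (C * norm f)\<^sup>2"
      using bounded(2)[OF g(1)] S0 hs_bound_nonneg by (simp add: C_def power_mult_distrib mult.assoc)
    finally show "norm h \<le> C * norm f"
      by (rule power2_le_imp_le) (use S0 hs_bound_nonneg in \<open>simp add: C_def\<close>)
    define u where "u = green_op k \<zeta> g"
    \<comment> \<open>A is Hermitian, so it can be moved from h = A u to f, and A f = - \<i> g
      because g = \<i> A f. This brings the form of \<open>Q\<close> into the shape treated by
      \<open>inner_green_op\<close>.\<close>
    have "inner f h = inner g (\<i> *\<^sub>C u)"
      unfolding inner_l2_integral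
    proof (rule integral_cong_AE)
      show "AE x in lborel. rep_l2 f x \<bullet> rep_l2 h x = rep_l2 g x \<bullet> rep_l2 (\<i> *\<^sub>C u) x"
        using g(1) g(2) herm rep_scaleC[of \<i> u] unfolding mult_op_def mem_Collect_eq case_prod_conv u_def[symmetric]
      proof eventually_elim
        case (elim x)
        have hA: "A x $ i $ j = cnj (A x $ j $ i)" for i j
          using arg_cong[OF elim(3), of "\<lambda>M. M $ i $ j"] by simp
        have "v \<bullet> (A x *v w) = (iA x *v v) \<bullet> (\<i> *s w)" for v w :: "complex^2"
        proof -
          have c: "cnj (A x $ 1 $ 1) = A x $ 1 $ 1" "cnj (A x $ 1 $ 2) = A x $ 2 $ 1"
            "cnj (A x $ 2 $ 1) = A x $ 1 $ 2" "cnj (A x $ 2 $ 2) = A x $ 2 $ 2"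
            using hA by metis+
          have i: "(\<i> * a * b + \<i> * a' * b') * cnj (\<i> * d) = (a * b + a' * b') * cnj d" for a b a' b' d
            by (simp add: complex_eq_iff algebra_simps)
          show ?thesis
            unfolding inner_vec2 mat2_vec_nth iscale_nth vector_smult_component i
            by (simp add: c algebra_simps)
        qed
        then show ?case using elim by simp
      qed
    qed measurable
    also have "\<dots> = - Im z * (norm u)\<^sup>2" unfolding u_def by (rule inner_green_op)
    also have "\<dots> \<ge> - t * (norm f)\<^sup>2"
    proof (cases "Im z \<le> 0")
      case True
      then have "0 \<le> - Im z * (norm u)\<^sup>2" by (simp add: mult_nonpos_nonneg)
      moreover have "- t * (norm f)\<^sup>2 \<le> 0" using t by simp
      ultimately show ?thesis by linarith
    next
      case False
      have "Im z * (norm u)\<^sup>2 \<le> Im z * (K * (norm f)\<^sup>2)"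
        using mult_green_bounds(2)[OF g(1)] False by (intro mult_left_mono) (auto simp: u_def K_def)
      also have "\<dots> \<le> t * (norm f)\<^sup>2" unfolding mult.assoc[symmetric] by (rule mult_right_mono) (auto simp: t_def)
      finally show ?thesis by simp
    qed
    finally show "(1 - t - 1) * (norm f)\<^sup>2 \<le> inner f h" by simp
  qed
  then show ?thesis by (simp add: q_def)
qed

text \<open>If \<open>\<lambda>\<close> were in the resolvent set, the Weyl sequence of \<open>H\<^sub>0\<close>, translated to infinity where
  \<open>A\<close> is small, would also be one for \<open>H\<close>.\<close>

lemma notin_resolvent_set:
  assumes m: "0 \<le> m" "m \<le> \<bar>lam\<bar>"
    and z: "z \<in> resolvent_set H"
    and Q: "-1 \<in> resolvent_set Q"
    and res: "resolvent H z = op_diff (resolvent (free_dirac m) z)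
      ((resolvent (free_dirac m) z O mult_op A) O resolvent Q (-1) O
        closure (mult_op iA O resolvent (free_dirac m) z))"
  shows "complex_of_real lam \<notin> resolvent_set H"
proof
  assume "complex_of_real lam \<in> resolvent_set H"
  then have "bounded_op (resolvent H (of_real lam))" by (simp add: resolvent_set_def)
  then obtain L where L: "0 < L" "\<And>f g. (f, g) \<in> resolvent H (of_real lam) \<Longrightarrow> norm g \<le> L * norm f"
    using bounded_op_bound by blast
  have "bounded_op (resolvent Q (-1))" using Q by (simp add: resolvent_set_def)
  then obtain K1 where K1: "0 < K1" "\<And>f g. (f, g) \<in> resolvent Q (-1) \<Longrightarrow> norm g \<le> K1 * norm f"
    using bounded_op_bound by blast
  define K where "K = sqrt (hs_bound \<zeta> A / (2 * Im k)) * K1"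
  have K: "0 \<le> K" using hs_bound_nonneg[of \<zeta>] k K1 by (simp add: K_def)
  \<comment> \<open>The residual then accounts for at most half of the norm of the test vector,
    leaving a fixed positive amount for the contradiction.\<close>
  define e where "e = 1 / (2 * L)"
  have e: "0 < e" using L by (simp add: e_def)
  obtain C where C: "0 < C" "\<And>s. \<exists>u r. (u, of_real lam *\<^sub>C u + r) \<in> free_dirac m \<and> norm r = e * norm u \<and>
      (AE x in lborel. norm (rep_l2 u x) = C * exp (- (e * \<bar>x - s\<bar>)))"
    using free_dirac_Weyl[OF m e] by blast
  define N where "N = C * sqrt (LINT x|lborel. exp (- (2 * e * \<bar>x\<bar>)))"
  have N: "0 < N" using C exp_minus_abs_integral_pos[of "2 * e"] e by (simp add: N_def)
  \<comment> \<open>A bound for the squared norm of A u, where u is the damped wave centred at s. It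
    tends to 0 as s moves to infinity, whereas the norm N of u does not depend on s.\<close>
  define a where "a s = C\<^sup>2 * (LINT x|lborel. hs x * exp (- (2 * e * \<bar>x - s\<bar>)))" for s
  have main: "N / 2 \<le> (1 + L * cmod (of_real lam - z)) * (K * sqrt (a s))" for s
  proof -
    from C(2)[of s] obtain u r where u: "(u, of_real lam *\<^sub>C u + r) \<in> free_dirac m" "norm r = e * norm u"
      "AE x in lborel. norm (rep_l2 u x) = C * exp (- (e * \<bar>x - s\<bar>))" by blast
    have nu: "norm u = N"
    proof (rule power2_eq_imp_eq)
      show "(norm u)\<^sup>2 = N\<^sup>2"
        unfolding norm_damped[OF e u(3)] N_def
        by (simp add: power_mult_distrib Bochner_Integration.integral_nonneg)
    qed (use N in auto)
    define d where "d = of_real lam - z"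
    define g where "g = d *\<^sub>C u + r"
    have "(u, g + z *\<^sub>C u) \<in> free_dirac m"
      using u(1) by (simp add: g_def d_def scaleC_diff_left algebra_simps)
    then have gu: "(g, u) \<in> resolvent (free_dirac m) z" by (force simp: resolvent_def op_shift_def)
    then have gu_iff: "(g, v) \<in> resolvent (free_dirac m) z \<longleftrightarrow> v = u" for v by (simp add: resolvent_iff)
    \<comment> \<open>The resolvent of H at z is everywhere defined, so its formula, applied to g =
      (H_0 - z) u, forces u into the domain of A and supplies p = A u.\<close>
    obtain w where w: "(g, w) \<in> resolvent H z"
      using z by (auto simp: resolvent_set_def bounded_op_def)
    then obtain h where h: "w = u - h" "(g, h) \<in> (resolvent (free_dirac m) z O mult_op A) O resolvent Q (-1) O
        closure (mult_op iA O resolvent (free_dirac m) z)"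
      unfolding res op_diff_def by (auto simp: gu_iff)
    then obtain p b where p: "(u, p) \<in> mult_op A" "(p, b) \<in> resolvent Q (-1)"
      "(b, h) \<in> closure (mult_op iA O resolvent (free_dirac m) z)"
      by (auto simp: gu_iff elim!: relcompE)
    have pe: "(norm p)\<^sup>2 \<le> a s"
    proof -
      have i: "integrable lborel (\<lambda>x. hs x * exp (- (2 * e * \<bar>x - s\<bar>)))"
        by (rule Bochner_Integration.integrable_bound[OF hs_integrable])
          (use e in \<open>auto simp: hs_nonneg intro!: AE_I2 mult_left_le\<close>)
      have "(norm p)\<^sup>2 \<le> (LINT x|lborel. C\<^sup>2 * (hs x * exp (- (2 * e * \<bar>x - s\<bar>))))"
        unfolding norm_l2_integral
      proof (rule integral_mono_AE)
        show "AE x in lborel. (norm (rep_l2 p x))\<^sup>2 \<le> C\<^sup>2 * (hs x * exp (- (2 * e * \<bar>x - s\<bar>)))"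
          using p(1) u(3) unfolding mult_op_def mem_Collect_eq case_prod_conv
        proof eventually_elim
          case (elim x)
          have "(norm (rep_l2 u x))\<^sup>2 = C\<^sup>2 * exp (- (2 * e * \<bar>x - s\<bar>))"
            unfolding elim(2) by (simp add: power_mult_distrib) (simp add: power2_eq_square flip: exp_add)
          then show ?case using norm_mult_le[of x "rep_l2 u x"] elim(1) by (simp add: mult_ac)
        qed
      qed (use i in \<open>auto intro: rep_integrable\<close>)
      then show ?thesis using i by (simp add: a_def)
    qed
    have "norm h \<le> sqrt (hs_bound \<zeta> A / (2 * Im k)) * norm b" by (rule RB_closure_bound[OF p(3)])
    also have "\<dots> \<le> sqrt (hs_bound \<zeta> A / (2 * Im k)) * (K1 * norm p)"
      using hs_bound_nonneg[of \<zeta>] k by (intro mult_left_mono K1(2)[OF p(2)]) auto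
    also have "\<dots> \<le> K * sqrt (a s)"
      unfolding K_def[symmetric] mult.assoc[symmetric] using pe by (intro mult_left_mono K) (rule real_le_rsqrt)
    finally have nh: "norm h \<le> K * sqrt (a s)" .
    \<comment> \<open>On w = u - h one finds (H - lam) w = r + d h: the free residual r plus a term
      that is small with A u.\<close>
    have "(w, g + z *\<^sub>C w) \<in> H" using w by (auto simp: resolvent_def op_shift_def)
    then have "(g + z *\<^sub>C w - of_real lam *\<^sub>C w, w) \<in> resolvent H (of_real lam)"
      by (force simp: resolvent_def op_shift_def)
    moreover have "g + z *\<^sub>C w - of_real lam *\<^sub>C w = r + d *\<^sub>C h"
      by (simp add: g_def d_def h(1) scaleC_diff_left scaleC_diff_right)
    ultimately have "norm w \<le> L * norm (r + d *\<^sub>C h)" using L(2) by metis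
    also have "\<dots> \<le> L * (e * norm u + cmod d * norm h)"
      using L(1) norm_triangle_ineq[of r "d *\<^sub>C h"] by (intro mult_left_mono) (auto simp: u(2) norm_scaleC)
    also have "\<dots> = N / 2 + L * cmod d * norm h" using L(1) by (simp add: e_def nu algebra_simps)
    finally have "norm w \<le> N / 2 + L * cmod d * norm h" .
    moreover have "N - norm h \<le> norm w" unfolding h(1) nu[symmetric] by (rule norm_triangle_ineq2)
    ultimately have "N / 2 \<le> (1 + L * cmod d) * norm h" by (simp add: algebra_simps)
    also have "\<dots> \<le> (1 + L * cmod d) * (K * sqrt (a s))" using L(1) nh by (intro mult_left_mono) auto
    finally show ?thesis by (simp add: d_def)
  qed
  have "(\<lambda>n. LINT x|lborel. hs x * exp (- (2 * e * \<bar>x - real n\<bar>))) \<longlonglongrightarrow> (LINT x :: real|lborel. 0 :: real)"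
  proof (rule integral_dominated_convergence[OF _ _ hs_integrable])
    show "AE x in lborel. (\<lambda>n. hs x * exp (- (2 * e * \<bar>x - real n\<bar>))) \<longlonglongrightarrow> 0"
    proof (rule AE_I2)
      fix x
      have lim: "(\<lambda>n. hs x * exp (2 * e * x) * exp (- (2 * e)) ^ n) \<longlonglongrightarrow> hs x * exp (2 * e * x) * 0"
        using e by (intro tendsto_intros LIMSEQ_realpow_zero) auto
      show "(\<lambda>n. hs x * exp (- (2 * e * \<bar>x - real n\<bar>))) \<longlonglongrightarrow> 0"
      proof (rule tendsto_sandwich[OF _ _ tendsto_const])
        show "(\<lambda>n. hs x * exp (2 * e * x) * exp (- (2 * e)) ^ n) \<longlonglongrightarrow> 0" using lim by simp
        have "exp (- (2 * e * \<bar>x - real n\<bar>)) \<le> exp (2 * e * x) * exp (- (2 * e)) ^ n" for n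
        proof -
          have "e * (real n - x) \<le> e * \<bar>x - real n\<bar>" using e by (intro mult_left_mono) auto
          then show ?thesis by (simp add: algebra_simps flip: exp_of_nat_mult exp_add)
        qed
        then show "\<forall>\<^sub>F n in sequentially. hs x * exp (- (2 * e * \<bar>x - real n\<bar>)) \<le> hs x * exp (2 * e * x) * exp (- (2 * e)) ^ n"
          unfolding mult.assoc[of "hs x"] by (intro always_eventually allI mult_left_mono hs_nonneg)
      qed (simp add: hs_nonneg)
    qed
    show "AE x in lborel. norm (hs x * exp (- (2 * e * \<bar>x - real n\<bar>))) \<le> hs x" for n
      using e by (auto simp: hs_nonneg intro!: AE_I2 mult_left_le)
  qed measurable
  then have "(\<lambda>n. a (real n)) \<longlonglongrightarrow> 0" unfolding a_def by (auto intro: tendsto_mult_right_zero)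
  then have "(\<lambda>n. (1 + L * cmod (of_real lam - z)) * (K * sqrt (a (real n)))) \<longlonglongrightarrow>
      (1 + L * cmod (of_real lam - z)) * (K * sqrt 0)"
    by (intro tendsto_intros)
  then have "N / 2 \<le> 0"
    by (intro LIMSEQ_le_const[where X = "\<lambda>n. (1 + L * cmod (of_real lam - z)) * (K * sqrt (a (real n)))"]) (use main in auto)
  then show False using N by simp
qed

end

section \<open>Spectrum of the Dirac operator with potential \<i> Vt\<close>

theorem theorem3p2:
  fixes m :: real and Vt :: "real \<Rightarrow> complex^2^2" and H :: l2_rel
  assumes "m \<ge> 0"
    and "AE x in lebesgue. psd (Vt x)"
    and "\<And>i j. integrable lebesgue (\<lambda>x. Vt x $ i $ j)"
    and "dirac_operator m (\<lambda>x. \<chi> i j. \<i> * Vt x $ i $ j) H"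
  shows "discrete_spectrum H \<subseteq> {z. Im z > 0} \<and>
    resolvent_set (free_dirac m) = - {complex_of_real x |x. x \<le> - m \<or> m \<le> x} \<and>
    (\<forall>z \<in> resolvent_set (free_dirac m).
       Re ((z + complex_of_real m) / dirac_sqrt m z) * L1_norm (\<lambda>x. Vt x $ 1 $ 1) +
       Re (dirac_sqrt m z / (z + complex_of_real m)) * L1_norm (\<lambda>x. Vt x $ 2 $ 2) < 2
       \<longrightarrow> z \<notin> spectrum H) \<and>
    (m = 0 \<and> L1_norm (\<lambda>x. Vt x $ 1 $ 1) + L1_norm (\<lambda>x. Vt x $ 2 $ 2) < 2
       \<longrightarrow> spectrum H = \<real>)"
proof -
  obtain A where A: "\<And>i j. csq (\<lambda>x. A x $ i $ j)" "AE x in lborel. cadjoint (A x) = A x"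
    "op_A (\<lambda>x. iscale (Vt x)) = mult_op A" "op_B (\<lambda>x. iscale (Vt x)) = mult_op (\<lambda>x. iscale (A x))"
    "\<And>i. row_norm A i = L1_norm (\<lambda>x. Vt x $ i $ i)"
    using potential_factorization[OF assms(2,3)] by blast
  define S where "S = {complex_of_real x |x. x \<le> - m \<or> m \<le> x}"
  define k where "k z = dirac_sqrt m z" for z
  define \<zeta> where "\<zeta> z = (z + of_real m) / k z" for z
  have bs: "birman_schwinger A m z (k z) (\<zeta> z)" if "z \<notin> S" for z
    using that A(1,2) green_dirac_sqrt[OF assms(1), of z]
    by (simp add: birman_schwinger_def factor_def S_def k_def \<zeta>_def)
  have rho0: "resolvent_set (free_dirac m) = - S"
  proof -
    have "z \<in> resolvent_set (free_dirac m)" if "z \<notin> S" for z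
      using green.in_resolvent_set[OF birman_schwinger.axioms(2)[OF bs[OF that]]] .
    moreover have "z \<notin> resolvent_set (free_dirac m)" if "z \<in> S" for z
      using that notin_resolvent_set_free_dirac[OF assms(1)] by (auto simp: S_def)
    ultimately show ?thesis by blast
  qed
  have V: "(\<lambda>x. \<chi> i j. \<i> * Vt x $ i $ j) = (\<lambda>x. iscale (Vt x))" by (simp add: iscale_def)
  note H = assms(4)[unfolded V dirac_operator_def op_Q_def op_R0B_def A(3,4)]
  have rhoH: "resolvent_set H \<inter> resolvent_set (free_dirac m) = {z \<in> resolvent_set (free_dirac m).
      -1 \<in> resolvent_set (closure (mult_op (\<lambda>x. iscale (A x)) O resolvent (free_dirac m) z O mult_op A))}"
    using H by blast
  have in_rho: "z \<in> resolvent_set H"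
    if "z \<notin> S" "Im z \<le> 0 \<or> Re (\<zeta> z) * row_norm A 1 + Re (1 / \<zeta> z) * row_norm A 2 < 2" for z
    using birman_schwinger.minus_one_in_resolvent_set_Q[OF bs[OF that(1)] that(2)] rhoH rho0 that(1) by blast
  have S_spec: "S \<subseteq> spectrum H"
  proof
    fix z assume "z \<in> S"
    then obtain lam where lam: "z = of_real lam" "m \<le> \<bar>lam\<bar>" by (auto simp: S_def)
    \<comment> \<open>The resolvent formula for H needs a base point in both resolvent sets; the
      definition of H guarantees one, and any will do.\<close>
    obtain z0 where z0: "z0 \<in> resolvent_set H" "z0 \<in> resolvent_set (free_dirac m)" using H by blast
    then have "z0 \<notin> S" using rho0 by blast
    have "complex_of_real lam \<notin> resolvent_set H"
    proof (rule birman_schwinger.notin_resolvent_set[OF bs[OF \<open>z0 \<notin> S\<close>] assms(1) lam(2) z0(1)])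
      show "-1 \<in> resolvent_set (closure (mult_op (\<lambda>x. iscale (A x)) O resolvent (free_dirac m) z0 O mult_op A))"
        using rhoH z0 by blast
    qed (use H z0 in blast)
    then show "z \<in> spectrum H" by (simp add: spectrum_def lam(1))
  qed
  have not_isolated: "\<not> z isolated_in spectrum H" if zS: "z \<in> S" for z
  proof
    assume "z isolated_in spectrum H"
    then obtain T where T: "open T" "T \<inter> spectrum H = {z}" by (auto simp: isolated_in_def)
    obtain x where x: "z = of_real x" "x \<le> - m \<or> m \<le> x" using zS by (auto simp: S_def)
    obtain e where e: "0 < e" "ball z e \<subseteq> T" using T openE by blast
    \<comment> \<open>A step along the ray away from the gap stays in S, also when x is an
      endpoint.\<close>
    define y where "y = (if m \<le> x then x + e / 2 else x - e / 2)"
    have "of_real y \<in> S" using x e by (auto simp: S_def y_def)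
    moreover have "complex_of_real y \<in> ball z e"
      using e by (auto simp: x(1) dist_norm y_def simp flip: of_real_diff of_real_minus)
    ultimately have "complex_of_real y = z" using S_spec T e by blast
    then show False using e by (auto simp: x(1) y_def split: if_splits)
  qed
  have crit: "z \<notin> spectrum H" if "z \<notin> S"
    "Re ((z + complex_of_real m) / dirac_sqrt m z) * L1_norm (\<lambda>x. Vt x $ 1 $ 1) +
     Re (dirac_sqrt m z / (z + complex_of_real m)) * L1_norm (\<lambda>x. Vt x $ 2 $ 2) < 2" for z
    using in_rho[OF that(1)] that(2) by (simp add: spectrum_def \<zeta>_def k_def A(5))
  have "discrete_spectrum H \<subseteq> {z. Im z > 0}"
  proof
    fix z assume "z \<in> discrete_spectrum H"
    then have z: "z isolated_in spectrum H" by (simp add: discrete_spectrum_def)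
    then have "z \<notin> S" "z \<in> spectrum H" using not_isolated by (auto simp: isolated_in_def)
    then show "z \<in> {z. Im z > 0}" using in_rho[of z] by (force simp: spectrum_def)
  qed
  moreover have "spectrum H = \<real>" if m0: "m = 0" and small: "L1_norm (\<lambda>x. Vt x $ 1 $ 1) + L1_norm (\<lambda>x. Vt x $ 2 $ 2) < 2"
  proof -
    have SR: "S = \<real>" unfolding S_def m0 by (auto simp: Reals_def)
    have "z \<notin> spectrum H" if "z \<notin> \<real>" for z
    proof (cases "Im z \<le> 0")
      case True
      then show ?thesis using in_rho[of z] that SR by (simp add: spectrum_def)
    next
      case False
      have g: "green m z (k z) (\<zeta> z)" using bs that SR birman_schwinger.axioms(2) by blast
      have e: "k z * \<zeta> z = z" "\<zeta> z * z = k z" using green.k\<zeta>[OF g] green.\<zeta>k[OF g] by (simp_all add: m0)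
      have "(k z)\<^sup>2 = (\<zeta> z * z) * k z" using e(2) by (simp add: power2_eq_square)
      also have "\<dots> = z * (k z * \<zeta> z)" by (simp add: mult_ac)
      also have "\<dots> = z\<^sup>2" using e(1) by (simp add: power2_eq_square)
      finally have "(k z)\<^sup>2 = z\<^sup>2" .
      then have "k z = z \<or> k z = - z" by (simp add: power2_eq_iff)
      \<comment> \<open>For m = 0 and Im z > 0 the chosen root is z itself, so both coefficients in
        the criterion equal 1.\<close>
      then have kz: "k z = z" using green.k[OF g] False by auto
      have "z \<noteq> 0" using that by auto
      then show ?thesis
        using crit[of z] that SR small kz by (simp add: m0 k_def)
    qed
    then show ?thesis using S_spec SR by blast
  qed
  ultimately show ?thesis using crit rho0 by (simp add: S_def)
qed

end
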